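(* Let $\Omega\subset\mathbb{R}^n$ be a bounded, connected open set with Lipschitz boundary, let $\chi\in\mathcal{X}=\{\chi\in L^2(\Omega;[0,1])\}$ be a given design, and let $\lambda\in\mathbb{R}$. The problem $$ \inf\left\{L(u,\chi)=\int_\Omega \left(\frac12\sum_{i=1,2}k_i|\nabla u_i|^2+\frac12\chi(1-\chi)\,u\cdot Au-\lambda\chi\right)dx\;:\;u\in\mathcal{V}\right\}, $$ where $$\mathcal{V}=\{v\in H^1(\Omega;\mathbb{R}^2): v_i=u_i^*\text{ on }\partial_i\Omega,\ i=1,2\},$$ attains its minimum. Further, the minimizer $u$ is unique and satisfies the Euler--Lagrange equation $$ \int_\Omega\left(\sum_{i=1,2}k_i\nabla u_i\cdot\nabla\varphi_i+\chi(1-\chi)\,\varphi\cdot Au\right)dx=0 $$ for all $\varphi\in\mathcal{V}_0=\{v\in H^1(\Omega;\mathbb{R}^2): v_i=0\text{ on }\partial_i\Omega,\ i=1,2\}$.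
   Context: The boundary of $\Omega$ is divided into three regions, $\partial\Omega=\partial_1\Omega\cup\partial_2\Omega\cup\partial_0\Omega$. For $i=1,2$, the concentration $u_i$ of species $i$ is held at a prescribed value $u_i^*$ on $\partial_i\Omega$; $\partial_0\Omega$ is insulating. The set $\mathcal{X}$ consists of the functions in $L^2(\Omega)$ with values in $[0,1]$. The isotropic conductivities depend on $\chi$: $$k_1(x)=k_{11}\chi(x)+k_{12}(1-\chi(x)),\qquad k_2(x)=k_{21}\chi(x)+k_{22}(1-\chi(x)),$$ with constants satisfying $k_{11},k_{22}\gg k_{12},k_{21}>0$ ($\gg$ meaning, informally, "much larger than"). Finally, $A=k_s\begin{pmatrix}1&-1\\-1&1\end{pmatrix}$ with a constant $k_s>0$, so that $u\cdot Au=k_s(u_1-u_2)^2$ for $u=(u_1,u_2)$.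
   Formalization: Added: each ∂_iΩ (i=1,2) has positive surface measure (if ∂_1Ω is empty and χ=0, u_1 is unique only up to constants), and each u_i^* is the boundary value on ∂_iΩ of some H^1 function (otherwise 𝒱 is empty and no minimum exists). *)

theory Defs
  imports "HOL-Analysis.Analysis"
begin

section \<open>Hausdorff measure\<close>

text \<open>
  The factor \<open>unit_ball_vol d / 2 ^ d\<close> is the usual normalisation, under which the
  \<open>(n - 1)\<close>-dimensional measure is the classical surface area. The empty set is treated
  separately because \<open>0 ^ 0 = 1\<close>, which is the right weight for points in dimension 0 only.
  Covering sets are required to be bounded because \<open>diameter\<close> is unspecified otherwise.
\<close>

definition hausdorff_weight :: "nat \<Rightarrow> 'a::metric_space set \<Rightarrow> ennreal" where
  "hausdorff_weight d U =
     (if U = {} then 0 else ennreal (unit_ball_vol (real d) * (diameter U / 2) ^ d))"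

definition hausdorff_pre :: "nat \<Rightarrow> real \<Rightarrow> 'a::metric_space set \<Rightarrow> ennreal" where
  "hausdorff_pre d \<delta> A =
     (INF U\<in>{U :: nat \<Rightarrow> 'a set. A \<subseteq> (\<Union>i. U i) \<and> (\<forall>i. bounded (U i) \<and> diameter (U i) \<le> \<delta>)}.
        \<Sum>i. hausdorff_weight d (U i))"

definition hausdorff_outer :: "nat \<Rightarrow> 'a::metric_space set \<Rightarrow> ennreal" where
  "hausdorff_outer d A = (SUP \<delta>\<in>{0<..}. hausdorff_pre d \<delta> A)"

lemma hausdorff_pre_antimono: "\<delta> \<le> \<epsilon> \<Longrightarrow> hausdorff_pre d \<epsilon> A \<le> hausdorff_pre d \<delta> A"
  unfolding hausdorff_pre_def by (rule INF_superset_mono) (auto intro: order_trans)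

lemma hausdorff_pre_le_outer: "\<delta> > 0 \<Longrightarrow> hausdorff_pre d \<delta> A \<le> hausdorff_outer d A"
  unfolding hausdorff_outer_def by (rule SUP_upper) simp

lemma hausdorff_outer_mono: "A \<subseteq> B \<Longrightarrow> hausdorff_outer d A \<le> hausdorff_outer d B"
  unfolding hausdorff_outer_def hausdorff_pre_def
  by (intro SUP_subset_mono INF_superset_mono) auto

lemma hausdorff_outer_empty [simp]: "hausdorff_outer d {} = 0"
proof -
  have "hausdorff_pre d \<delta> ({} :: 'a set) \<le> 0" if "\<delta> > 0" for \<delta>
    unfolding hausdorff_pre_def
    by (rule INF_lower2[where i = "\<lambda>_. {}"]) (use that in \<open>auto simp: hausdorff_weight_def\<close>)
  then show ?thesis
    unfolding hausdorff_outer_def by (auto intro!: antisym SUP_least)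
qed

lemma hausdorff_pre_countably_subadditive:
  fixes A :: "nat \<Rightarrow> 'a::metric_space set"
  shows "hausdorff_pre d \<delta> (\<Union>n. A n) \<le> (\<Sum>n. hausdorff_pre d \<delta> (A n))"
proof (rule ennreal_le_epsilon)
  fix e :: real assume e: "e > 0" and fin: "(\<Sum>n. hausdorff_pre d \<delta> (A n)) < top"
  have "\<exists>U. A n \<subseteq> (\<Union>i. U i) \<and> (\<forall>i. bounded (U i) \<and> diameter (U i) \<le> \<delta>) \<and>
          (\<Sum>i. hausdorff_weight d (U i)) < hausdorff_pre d \<delta> (A n) + ennreal (e * (1/2)^Suc n)" for n
  proof -
    have "hausdorff_pre d \<delta> (A n) \<noteq> top"
      using ennreal_suminf_lessD[OF fin] by (metis less_irrefl)
    then have "hausdorff_pre d \<delta> (A n) < hausdorff_pre d \<delta> (A n) + ennreal (e * (1/2)^Suc n)"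
      using e by (simp add: less_top ennreal_add_left_cancel_less[of _ 0, simplified])
    then show ?thesis
      unfolding hausdorff_pre_def Inf_less_iff by (auto simp: INF_less_iff)
  qed
  then obtain U where U: "\<And>n. A n \<subseteq> (\<Union>i. U n i)"
    "\<And>n i. bounded (U n i)" "\<And>n i. diameter (U n i) \<le> \<delta>"
    "\<And>n. (\<Sum>i. hausdorff_weight d (U n i)) < hausdorff_pre d \<delta> (A n) + ennreal (e * (1/2)^Suc n)"
    by metis
  define V where "V k = (case prod_decode k of (n, i) \<Rightarrow> U n i)" for k
  have "x \<in> (\<Union>k. V k)" if x: "x \<in> (\<Union>n. A n)" for x
  proof -
    obtain n i where "x \<in> U n i" using x U(1) by blast
    then have "x \<in> V (prod_encode (n, i))" by (simp add: V_def)
    then show ?thesis by blast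
  qed
  then have "(\<Union>n. A n) \<subseteq> (\<Union>k. V k)" by (rule subsetI)
  moreover have "bounded (V k) \<and> diameter (V k) \<le> \<delta>" for k
    using U(2,3) by (simp add: V_def split: prod.split)
  ultimately have "hausdorff_pre d \<delta> (\<Union>n. A n) \<le> (\<Sum>k. hausdorff_weight d (V k))"
    unfolding hausdorff_pre_def by (intro INF_lower) simp
  also have "\<dots> = (\<Sum>n. \<Sum>i. hausdorff_weight d (U n i))"
    using suminf_ennreal_2dimen[of "\<lambda>n. \<Sum>i. hausdorff_weight d (U n i)"
            "\<lambda>(n, i). hausdorff_weight d (U n i)"]
    by (simp add: V_def split_def)
  also have "\<dots> \<le> (\<Sum>n. hausdorff_pre d \<delta> (A n) + ennreal (e * (1/2)^Suc n))"
    using U(4) by (intro suminf_le) (auto intro: less_imp_le)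
  also have "\<dots> = (\<Sum>n. hausdorff_pre d \<delta> (A n)) + (\<Sum>n. ennreal (e * (1/2)^Suc n))"
    by (rule suminf_add[symmetric]) auto
  also have "(\<Sum>n. ennreal (e * (1/2)^Suc n)) = ennreal e"
    using sums_mult[OF power_half_series, of e] e
    by (intro suminf_ennreal_eq) auto
  finally show "hausdorff_pre d \<delta> (\<Union>n. A n) \<le> (\<Sum>n. hausdorff_pre d \<delta> (A n)) + ennreal e" .
qed

lemma hausdorff_outer_countably_subadditive:
  "hausdorff_outer d (\<Union>n::nat. A n) \<le> (\<Sum>n. hausdorff_outer d (A n))"
  unfolding hausdorff_outer_def[of d "\<Union>n. A n"]
proof (rule SUP_least)
  fix \<delta> :: real assume "\<delta> \<in> {0<..}"
  then show "hausdorff_pre d \<delta> (\<Union>n. A n) \<le> (\<Sum>n. hausdorff_outer d (A n))"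
    by (intro order_trans[OF hausdorff_pre_countably_subadditive] suminf_le)
       (auto intro: hausdorff_pre_le_outer)
qed

lemma hausdorff_outer_subadditive:
  "hausdorff_outer d (A \<union> B) \<le> hausdorff_outer d A + hausdorff_outer d B"
proof -
  have "hausdorff_outer d (\<Union>n::nat. binaryset A B n) \<le> (\<Sum>n. hausdorff_outer d (binaryset A B n))"
    by (rule hausdorff_outer_countably_subadditive)
  then show ?thesis
    by (simp add: UN_binaryset_eq suminf_binaryset_eq)
qed

lemma hausdorff_outer_metric_additive:
  fixes A B :: "'a::metric_space set"
  assumes r: "r > 0" and sep: "\<And>x y. x \<in> A \<Longrightarrow> y \<in> B \<Longrightarrow> r \<le> dist x y"
  shows "hausdorff_outer d A + hausdorff_outer d B \<le> hausdorff_outer d (A \<union> B)"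
proof -
  have pre: "hausdorff_pre d \<delta> A + hausdorff_pre d \<delta> B \<le> hausdorff_outer d (A \<union> B)"
    if \<delta>: "0 < \<delta>" "\<delta> < r" for \<delta>
  proof -
    have "hausdorff_pre d \<delta> A + hausdorff_pre d \<delta> B \<le> (\<Sum>i. hausdorff_weight d (U i))"
      if U: "A \<union> B \<subseteq> (\<Union>i. U i)" "\<forall>i. bounded (U i) \<and> diameter (U i) \<le> \<delta>" for U :: "nat \<Rightarrow> 'a set"
    proof -
      define V where "V S i = (if U i \<inter> S = {} then {} else U i)" for S i
      have V: "hausdorff_pre d \<delta> S \<le> (\<Sum>i. hausdorff_weight d (V S i))" if "S \<subseteq> A \<union> B" for S
        unfolding hausdorff_pre_def
      proof (rule INF_lower)
        show "V S \<in> {U. S \<subseteq> (\<Union>i. U i) \<and> (\<forall>i. bounded (U i) \<and> diameter (U i) \<le> \<delta>)}"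
          using that U \<delta> by (fastforce simp: V_def)
      qed
      have disj: "V A i = {} \<or> V B i = {}" for i
      proof (rule ccontr)
        assume "\<not> ?thesis"
        then obtain x y where "x \<in> A" "x \<in> U i" "y \<in> B" "y \<in> U i"
          by (auto simp: V_def split: if_splits)
        then show False
          using sep[of x y] diameter_bounded_bound[of "U i" x y] U(2)[rule_format, of i] \<delta> by linarith
      qed
      have "hausdorff_pre d \<delta> A + hausdorff_pre d \<delta> B \<le>
              (\<Sum>i. hausdorff_weight d (V A i)) + (\<Sum>i. hausdorff_weight d (V B i))"
        by (intro add_mono V) auto
      also have "\<dots> = (\<Sum>i. hausdorff_weight d (V A i) + hausdorff_weight d (V B i))"
        by (rule suminf_add) auto
      also have "\<dots> \<le> (\<Sum>i. hausdorff_weight d (U i))"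
      proof (intro suminf_le)
        fix i show "hausdorff_weight d (V A i) + hausdorff_weight d (V B i) \<le> hausdorff_weight d (U i)"
          using disj[of i] by (cases "U i \<inter> A = {}"; cases "U i \<inter> B = {}") (auto simp: V_def hausdorff_weight_def)
      qed auto
      finally show ?thesis .
    qed
    then have "hausdorff_pre d \<delta> A + hausdorff_pre d \<delta> B \<le> hausdorff_pre d \<delta> (A \<union> B)"
      unfolding hausdorff_pre_def[of d \<delta> "A \<union> B"] by (intro INF_greatest) auto
    also have "\<dots> \<le> hausdorff_outer d (A \<union> B)"
      using \<delta> by (intro hausdorff_pre_le_outer) auto
    finally show ?thesis .
  qed
  have "hausdorff_outer d A + hausdorff_outer d B =
          (SUP \<delta>\<in>{0<..}. hausdorff_pre d \<delta> A + hausdorff_pre d \<delta> B)"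
    unfolding hausdorff_outer_def
  proof (rule SUP_add_directed_ennreal[symmetric])
    fix x y :: real assume "x \<in> {0<..}" "y \<in> {0<..}"
    then show "\<exists>k\<in>{0<..}. hausdorff_pre d x A + hausdorff_pre d y B
                 \<le> hausdorff_pre d k A + hausdorff_pre d k B"
      by (intro bexI[of _ "min x y"] add_mono hausdorff_pre_antimono) auto
  qed
  also have "\<dots> \<le> hausdorff_outer d (A \<union> B)"
  proof (rule SUP_least)
    fix \<delta> :: real assume "\<delta> \<in> {0<..}"
    then have "hausdorff_pre d (min \<delta> (r/2)) A + hausdorff_pre d (min \<delta> (r/2)) B \<le> hausdorff_outer d (A \<union> B)"
      using r by (intro pre) auto
    then show "hausdorff_pre d \<delta> A + hausdorff_pre d \<delta> B \<le> hausdorff_outer d (A \<union> B)"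
      by (rule order_trans[rotated]) (intro add_mono hausdorff_pre_antimono; simp)
  qed
  finally show ?thesis .
qed

lemma hausdorff_outer_separated_sum:
  fixes R :: "nat \<Rightarrow> 'a::metric_space set"
  assumes sep: "\<And>i j. i < j \<Longrightarrow> \<exists>r>0. \<forall>m\<ge>j. \<forall>x\<in>R i. \<forall>y\<in>R m. r \<le> dist x y"
  shows "(\<Sum>i. hausdorff_outer d (R i)) \<le> hausdorff_outer d (\<Union>i. R i)"
proof (rule suminf_le_const)
  fix n
  have "(\<Sum>i<n. hausdorff_outer d (R (k+i))) \<le> hausdorff_outer d (\<Union>i. R (k+i))" for k
  proof (induction n arbitrary: k)
    case (Suc n)
    obtain r where r: "r > 0" "\<And>m x y. m \<ge> Suc k \<Longrightarrow> x \<in> R k \<Longrightarrow> y \<in> R m \<Longrightarrow> r \<le> dist x y"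
      using sep[of k "Suc k"] by auto
    have "(\<Sum>i<Suc n. hausdorff_outer d (R (k+i))) =
            hausdorff_outer d (R k) + (\<Sum>i<n. hausdorff_outer d (R (Suc k+i)))"
      by (subst sum.lessThan_Suc_shift) simp
    also have "\<dots> \<le> hausdorff_outer d (R k) + hausdorff_outer d (\<Union>i. R (Suc k+i))"
      by (intro add_left_mono Suc)
    also have "\<dots> \<le> hausdorff_outer d (R k \<union> (\<Union>i. R (Suc k+i)))"
      by (rule hausdorff_outer_metric_additive[OF r(1)]) (use r(2) le_add1 in blast)
    also have "\<dots> \<le> hausdorff_outer d (\<Union>i. R (k+i))"
    proof (rule hausdorff_outer_mono, rule Un_least)
      show "R k \<subseteq> (\<Union>i. R (k+i))" by (rule order_trans[OF _ UN_upper[of 0]]) auto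
      show "(\<Union>i. R (Suc k+i)) \<subseteq> (\<Union>i. R (k+i))"
        by (rule UN_least, rule order_trans[OF _ UN_upper[of "Suc _"]]) auto
    qed
    finally show ?case .
  qed auto
  from this[of 0] show "(\<Sum>i<n. hausdorff_outer d (R i)) \<le> hausdorff_outer d (\<Union>i. R i)" by simp
qed auto

lemma hausdorff_outer_closed_split:
  fixes C A :: "'a::metric_space set"
  assumes "closed C"
  shows "hausdorff_outer d (A \<inter> C) + hausdorff_outer d (A - C) \<le> hausdorff_outer d A"
proof (cases "C = {} \<or> hausdorff_outer d A = top")
  case True then show ?thesis by auto
next
  case False
  then have C: "C \<noteq> {}" and fin: "hausdorff_outer d A < top" by (auto simp: less_top)
  let ?h = "hausdorff_outer d :: 'a set \<Rightarrow> ennreal"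
  define D where "D x = infdist x C" for x
  define F where "F n = {x\<in>A. D x \<ge> 1 / real (Suc n)}" for n
  define R where "R n = {x\<in>A. D x \<ge> 1 / real (Suc (Suc n)) \<and> D x < 1 / real (Suc n)}" for n
  have Dlip: "D x \<le> D y + dist x y" for x y unfolding D_def by (rule infdist_triangle)
  have Dpos: "D x > 0" if "x \<notin> C" for x
    using that assms C in_closed_iff_infdist_zero[of C x] infdist_nonneg[of x C] by (auto simp: D_def)
  have sepR: "\<exists>r>0. \<forall>m\<ge>j. \<forall>x\<in>R i. \<forall>y\<in>R m. r \<le> dist x y" if "Suc i < j" for i j
  proof (intro exI conjI allI impI ballI)
    show "0 < 1 / real (Suc (Suc i)) - 1 / real (Suc j)"
      using that by (simp add: frac_less2)
    fix m x y assume "j \<le> m" and x: "x \<in> R i" and y: "y \<in> R m"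
    have "1 / real (Suc m) \<le> 1 / real (Suc j)" using \<open>j \<le> m\<close> by (simp add: field_simps)
    then show "1 / real (Suc (Suc i)) - 1 / real (Suc j) \<le> dist x y"
      using x y Dlip[of x y] by (auto simp: R_def)
  qed
  have even: "(\<Sum>i. ?h (R (2*i + c))) \<le> ?h A" for c
  proof -
    have "(\<Sum>i. ?h (R (2*i + c))) \<le> ?h (\<Union>i. R (2*i+c))"
    proof (rule hausdorff_outer_separated_sum)
      fix i j :: nat assume "i < j"
      then obtain r where r: "r > 0" "\<forall>m\<ge>2*j+c. \<forall>x\<in>R (2*i+c). \<forall>y\<in>R m. r \<le> dist x y"
        using sepR[of "2*i+c" "2*j+c"] by auto
      have "r \<le> dist x y" if "m \<ge> j" "x \<in> R (2*i+c)" "y \<in> R (2*m+c)" for m x y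
        using r(2)[rule_format, of "2*m+c"] that by simp
      with r(1) show "\<exists>r>0. \<forall>m\<ge>j. \<forall>x\<in>R (2*i+c). \<forall>y\<in>R (2*m+c). r \<le> dist x y" by blast
    qed
    also have "\<dots> \<le> ?h A" by (rule hausdorff_outer_mono) (auto simp: R_def)
    finally show ?thesis .
  qed
  have "(\<Sum>i. ?h (R i)) \<le> ?h A + ?h A"
  proof (rule suminf_le_const)
    fix n
    have "(\<Sum>i<n. ?h (R i)) \<le> (\<Sum>i<2*n. ?h (R i))" by (rule sum_mono2) auto
    also have "\<dots> = (\<Sum>i<n. ?h (R (2*i+0))) + (\<Sum>i<n. ?h (R (2*i+1)))"
      by (induction n) (auto simp: algebra_simps)
    also have "\<dots> \<le> (\<Sum>i. ?h (R (2*i+0))) + (\<Sum>i. ?h (R (2*i+1)))"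
      by (intro add_mono sum_le_suminf) auto
    also have "\<dots> \<le> ?h A + ?h A" by (intro add_mono even)
    finally show "(\<Sum>i<n. ?h (R i)) \<le> ?h A + ?h A" .
  qed auto
  also have "\<dots> < top" using fin by (simp add: less_top)
  finally have finR: "(\<Sum>i. ?h (R i)) < top" .
  have tail: "(\<lambda>n. \<Sum>i. ?h (R (i + n))) \<longlonglongrightarrow> 0"
  proof -
    have fin: "?h (R i) < top" for i using ennreal_suminf_lessD[OF finR] .
    define r where "r i = enn2real (?h (R i))" for i
    have r: "?h (R i) = ennreal (r i)" "r i \<ge> 0" for i
      using fin[of i] by (auto simp: r_def)
    have sm: "summable r"
      using finR r by (intro summable_suminf_not_top) (auto simp: less_top)
    have eq: "(\<Sum>i. ?h (R (i + n))) = ennreal (suminf r - (\<Sum>i<n. r i))" for n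
      using suminf_minus_initial_segment[OF sm, of n] r sm
      by (simp add: suminf_ennreal2 summable_ignore_initial_segment)
    have "(\<lambda>n. suminf r - (\<Sum>i<n. r i)) \<longlonglongrightarrow> suminf r - suminf r"
      by (intro tendsto_diff tendsto_const summable_LIMSEQ sm)
    then show ?thesis unfolding eq by (metis diff_self ennreal_0 tendsto_ennrealI)
  qed
  have "?h (A \<inter> C) + ?h (A - C) \<le> ?h A + (\<Sum>i. ?h (R (i + n)))" for n
  proof -
    have sub: "A - C \<subseteq> F n \<union> (\<Union>i. R (i+n))"
    proof
      fix x assume x: "x \<in> A - C"
      show "x \<in> F n \<union> (\<Union>i. R (i+n))"
      proof (cases "x \<in> F n")
        case False
        then have lt: "D x < 1 / real (Suc n)" using x by (auto simp: F_def)
        define k where "k = (LEAST k. 1 / real (Suc k) \<le> D x)"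
        have ex: "\<exists>k. 1 / real (Suc k) \<le> D x"
          using reals_Archimedean[OF Dpos[of x]] x by (auto simp: inverse_eq_divide intro: less_imp_le)
        have k1: "1 / real (Suc k) \<le> D x" unfolding k_def using ex by (rule LeastI_ex)
        have k2: "D x < 1 / real (Suc j)" if "j < k" for j
          using not_less_Least[OF that[unfolded k_def]] by simp
        have "n < k"
        proof (rule ccontr)
          assume "\<not> n < k"
          then have "1 / real (Suc n) \<le> 1 / real (Suc k)" by (simp add: field_simps)
          with k1 lt show False by simp
        qed
        then obtain i where i: "k = Suc (i + n)" by (metis add.commute less_iff_Suc_add)
        then have "x \<in> R (i+n)" using k1 k2[of "i+n"] x by (auto simp: R_def)
        then show ?thesis by blast
      qed auto
    qed
    have "?h (A - C) \<le> ?h (F n) + (\<Sum>i. ?h (R (i+n)))"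
      by (intro order_trans[OF hausdorff_outer_mono[OF sub]] order_trans[OF hausdorff_outer_subadditive]
            add_left_mono hausdorff_outer_countably_subadditive)
    then have "?h (A \<inter> C) + ?h (A - C) \<le> (?h (A \<inter> C) + ?h (F n)) + (\<Sum>i. ?h (R (i+n)))"
      by (simp add: add.assoc add_left_mono)
    also have "?h (A \<inter> C) + ?h (F n) \<le> ?h (A \<inter> C \<union> F n)"
    proof (rule hausdorff_outer_metric_additive)
      show "1 / real (Suc n) > 0" by simp
      fix x y assume "x \<in> A \<inter> C" "y \<in> F n"
      then show "1 / real (Suc n) \<le> dist x y"
        using Dlip[of y x] by (auto simp: F_def D_def dist_commute)
    qed
    also have "?h (A \<inter> C \<union> F n) \<le> ?h A" by (rule hausdorff_outer_mono) (auto simp: F_def)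
    finally show ?thesis by (simp add: add_right_mono)
  qed
  then have "?h (A \<inter> C) + ?h (A - C) \<le> ?h A + 0"
    using tail by (intro LIMSEQ_le_const[OF tendsto_add[OF tendsto_const tail]]) auto
  then show ?thesis by simp
qed

lemma measure_space_hausdorff:
  "measure_space UNIV (sets (borel :: 'a::metric_space measure)) (hausdorff_outer d)"
proof -
  interpret sigma_algebra "UNIV :: 'a set" "Pow UNIV" by (rule sigma_algebra_Pow)
  let ?L = "lambda_system (UNIV :: 'a set) (Pow UNIV) (hausdorff_outer d)"
  have "outer_measure_space (Pow UNIV) (hausdorff_outer d :: 'a set \<Rightarrow> ennreal)"
    by (auto simp: outer_measure_space_def positive_def increasing_def countably_subadditive_def
        intro: hausdorff_outer_mono hausdorff_outer_countably_subadditive)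
  then have L: "measure_space UNIV ?L (hausdorff_outer d)" by (rule caratheodory_lemma)
  then interpret L: sigma_algebra UNIV ?L by (simp add: measure_space_def)
  have "C \<in> ?L" if "closed C" for C :: "'a set"
    unfolding lambda_system_eq
  proof (clarsimp, rule antisym)
    fix A :: "'a set"
    show "hausdorff_outer d (A \<inter> C) + hausdorff_outer d (A - C) \<le> hausdorff_outer d A"
      using that by (rule hausdorff_outer_closed_split)
    show "hausdorff_outer d A \<le> hausdorff_outer d (A \<inter> C) + hausdorff_outer d (A - C)"
      using hausdorff_outer_subadditive[of d "A \<inter> C" "A - C"] by (simp add: Int_Diff_Un)
  qed
  then have "sigma_sets UNIV (Collect closed) \<subseteq> ?L" by (intro L.sigma_sets_subset) auto
  then have sub: "sets (borel :: 'a measure) \<subseteq> ?L"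
    by (simp add: borel_eq_closed)
  show ?thesis
    by (rule measure_down[OF L _ sub]) (metis sets.sigma_algebra_axioms space_borel)
qed

definition hausdorff_measure :: "nat \<Rightarrow> 'a::metric_space measure" where
  "hausdorff_measure d = measure_of UNIV (sets borel) (hausdorff_outer d)"

lemma sets_hausdorff_measure [simp]:
  "sets (hausdorff_measure d :: 'a::metric_space measure) = sets borel"
  unfolding hausdorff_measure_def
  using sets.sigma_sets_eq[of "borel :: 'a measure"] by simp

lemma emeasure_hausdorff_measure:
  "A \<in> sets borel \<Longrightarrow> emeasure (hausdorff_measure d) A = hausdorff_outer d A"
  using measure_space_hausdorff[where 'a='a, of d]
  by (intro emeasure_measure_of[OF hausdorff_measure_def]) (auto simp: measure_space_def)

definition surface_measure :: "'a::euclidean_space set \<Rightarrow> 'a measure" where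
  "surface_measure \<Omega> = restrict_space (hausdorff_measure (DIM('a) - 1)) (frontier \<Omega>)"


section \<open>Lipschitz boundary\<close>

text \<open>
  Near each boundary point, in coordinates with last axis \<open>e\<close>, the set is the region strictly
  above the graph of a Lipschitz function on the hyperplane orthogonal to \<open>e\<close>.
\<close>

definition lipschitz_boundary :: "'a::euclidean_space set \<Rightarrow> bool" where
  "lipschitz_boundary \<Omega> \<longleftrightarrow>
     (\<forall>x\<in>frontier \<Omega>. \<exists>r>0. \<exists>e. norm e = 1 \<and>
        (\<exists>C \<gamma>. C-lipschitz_on {z. z \<bullet> e = 0} \<gamma> \<and>
           \<Omega> \<inter> ball x r = {y \<in> ball x r. \<gamma> (y - (y \<bullet> e) *\<^sub>R e) < y \<bullet> e}))"


section \<open>Sobolev functions\<close>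

definition square_integrable :: "'a measure \<Rightarrow> ('a \<Rightarrow> 'b::euclidean_space) \<Rightarrow> bool" where
  "square_integrable M f \<longleftrightarrow> f \<in> borel_measurable M \<and> integrable M (\<lambda>x. (norm (f x))\<^sup>2)"

definition L2_tendsto ::
  "'a measure \<Rightarrow> (nat \<Rightarrow> 'a \<Rightarrow> 'b::euclidean_space) \<Rightarrow> ('a \<Rightarrow> 'b) \<Rightarrow> bool" where
  "L2_tendsto M f g \<longleftrightarrow>
     ((\<lambda>k. \<integral>\<^sup>+ x. ennreal ((norm (f k x - g x))\<^sup>2) \<partial>M) \<longlonglongrightarrow> 0)"

definition C1_with_gradient :: "('a::euclidean_space \<Rightarrow> real) \<Rightarrow> ('a \<Rightarrow> 'a) \<Rightarrow> bool" where
  "C1_with_gradient \<phi> D\<phi> \<longleftrightarrow> (\<forall>x. GDERIV \<phi> x :> D\<phi> x) \<and> continuous_on UNIV D\<phi>"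

definition compact_support_in :: "'a::euclidean_space set \<Rightarrow> ('a \<Rightarrow> real) \<Rightarrow> bool" where
  "compact_support_in \<Omega> \<phi> \<longleftrightarrow> compact (closure {x. \<phi> x \<noteq> 0}) \<and> closure {x. \<phi> x \<noteq> 0} \<subseteq> \<Omega>"

text \<open>
  The test functions are the compactly supported \<open>C\<^sup>1\<close> functions; by mollification this is the
  same notion as with \<open>C\<^sup>\<infinity>\<close> test functions. The identity is between vectors.
\<close>

definition has_weak_gradient ::
  "'a::euclidean_space set \<Rightarrow> ('a \<Rightarrow> real) \<Rightarrow> ('a \<Rightarrow> 'a) \<Rightarrow> bool" where
  "has_weak_gradient \<Omega> u G \<longleftrightarrow>
     square_integrable (lebesgue_on \<Omega>) u \<and> square_integrable (lebesgue_on \<Omega>) G \<and>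
     (\<forall>\<phi> D\<phi>. C1_with_gradient \<phi> D\<phi> \<and> compact_support_in \<Omega> \<phi> \<longrightarrow>
        (\<integral>x. u x *\<^sub>R D\<phi> x \<partial>lebesgue_on \<Omega>) = - (\<integral>x. \<phi> x *\<^sub>R G x \<partial>lebesgue_on \<Omega>))"

definition H1 :: "'a::euclidean_space set \<Rightarrow> ('a \<Rightarrow> real) set" where
  "H1 \<Omega> = {u. \<exists>G. has_weak_gradient \<Omega> u G}"

text \<open>Determined almost everywhere in \<open>\<Omega>\<close> for \<open>u \<in> H1 \<Omega>\<close>.\<close>

definition weak_gradient :: "'a::euclidean_space set \<Rightarrow> ('a \<Rightarrow> real) \<Rightarrow> 'a \<Rightarrow> 'a" where
  "weak_gradient \<Omega> u = (SOME G. has_weak_gradient \<Omega> u G)"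

text \<open>
  The trace operator is the continuous extension to \<open>H1 \<Omega>\<close> of the restriction to the boundary of
  functions that are \<open>C\<^sup>1\<close> up to the boundary. Its graph is spelled out here: \<open>g\<close> is the trace of
  \<open>u\<close> if some \<open>C\<^sup>1\<close> functions converge to \<open>u\<close> in \<open>H1 \<Omega>\<close> while their boundary values converge to
  \<open>g\<close> in \<open>L\<^sup>2\<close> of the boundary. For bounded \<open>\<Omega>\<close> with Lipschitz boundary every \<open>u \<in> H1 \<Omega>\<close> has such
  a \<open>g\<close>, square integrable and unique up to surface null sets.
\<close>

definition has_trace :: "'a::euclidean_space set \<Rightarrow> ('a \<Rightarrow> real) \<Rightarrow> ('a \<Rightarrow> real) \<Rightarrow> bool" where
  "has_trace \<Omega> u g \<longleftrightarrow>
     g \<in> borel_measurable (surface_measure \<Omega>) \<and>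
     (\<exists>G \<phi> D\<phi>. has_weak_gradient \<Omega> u G \<and> (\<forall>k. C1_with_gradient (\<phi> k) (D\<phi> k)) \<and>
        L2_tendsto (lebesgue_on \<Omega>) \<phi> u \<and>
        L2_tendsto (lebesgue_on \<Omega>) D\<phi> G \<and>
        L2_tendsto (surface_measure \<Omega>) \<phi> g)"

definition trace_eq_on ::
  "'a::euclidean_space set \<Rightarrow> 'a set \<Rightarrow> ('a \<Rightarrow> real) \<Rightarrow> ('a \<Rightarrow> real) \<Rightarrow> bool" where
  "trace_eq_on \<Omega> \<Gamma> u w \<longleftrightarrow>
     (\<exists>g. has_trace \<Omega> u g \<and> (AE x in surface_measure \<Omega>. x \<in> \<Gamma> \<longrightarrow> g x = w x))"


lemma integral_C1_compact_support_gradient: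
  fixes \<phi> :: "'a::euclidean_space \<Rightarrow> real"
  assumes C1: "C1_with_gradient \<phi> D\<phi>" and supp: "compact (closure {x. \<phi> x \<noteq> 0})"
  shows "integrable lborel D\<phi>" "(\<integral>x. D\<phi> x \<partial>lborel) = 0"
    and "\<And>x. x \<notin> closure {x. \<phi> x \<noteq> 0} \<Longrightarrow> D\<phi> x = 0"
proof -
  define S where "S = closure {x. \<phi> x \<noteq> 0}"
  have S: "compact S" "\<And>x. \<phi> x \<noteq> 0 \<Longrightarrow> x \<in> S"
    using supp closure_subset[of "{x. \<phi> x \<noteq> 0}"] by (auto simp: S_def)
  have der: "(\<phi> has_derivative (\<lambda>h. h \<bullet> D\<phi> x)) (at x)" for x
    using C1 by (simp add: C1_with_gradient_def gderiv_def)
  have contD: "continuous_on UNIV D\<phi>" using C1 by (simp add: C1_with_gradient_def)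
  have cont: "continuous_on UNIV \<phi>"
    by (intro continuous_at_imp_continuous_on ballI has_derivative_continuous[OF der])
  have \<phi>0: "\<phi> x = 0" if "x \<notin> S" for x using that S(2) by blast
  have D0: "D\<phi> x = 0" if "x \<notin> S" for x
  proof -
    have "(\<phi> has_derivative (\<lambda>h. 0)) (at x)"
      by (rule has_derivative_transform_within_open[where s = "- S" and f = "\<lambda>_. 0"])
         (use that \<phi>0 compact_imp_closed[OF S(1)] in auto)
    then have "(\<lambda>h. h \<bullet> D\<phi> x) = (\<lambda>h. 0)" by (rule has_derivative_unique[OF der])
    then have "D\<phi> x \<bullet> D\<phi> x = 0" by (rule fun_cong)
    then show ?thesis by simp
  qed
  then show "\<And>x. x \<notin> closure {x. \<phi> x \<noteq> 0} \<Longrightarrow> D\<phi> x = 0" by (simp add: S_def)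
  obtain R where R: "R > 0" "S \<subseteq> ball 0 R"
    using bounded_subset_ballD[OF compact_imp_bounded[OF S(1)], of 0] by auto
  have "bounded (D\<phi> ` S)"
    by (intro compact_imp_bounded compact_continuous_image continuous_on_subset[OF contD] S(1)) auto
  then obtain M where "M > 0" "\<And>x. x \<in> S \<Longrightarrow> norm (D\<phi> x) \<le> M"
    by (auto simp: bounded_pos)
  then have M: "M > 0" "\<And>x. norm (D\<phi> x) \<le> M"
    using D0 by (simp, metis less_imp_le norm_zero)
  let ?w = "\<lambda>x::'a. M * indicator (ball 0 (R+1)) x :: real"
  have w: "integrable lborel ?w"
    using emeasure_bounded_finite[OF bounded_ball, of "0::'a" "R+1"]
    by (intro integrable_mult_right integrable_real_indicator) simp_all
  have measD: "D\<phi> \<in> borel_measurable borel" by (rule borel_measurable_continuous_onI[OF contD])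
  have meas\<phi>: "\<phi> \<in> borel_measurable borel" by (rule borel_measurable_continuous_onI[OF cont])
  show intD: "integrable lborel D\<phi>"
  proof (rule Bochner_Integration.integrable_bound[OF w])
    have "norm (D\<phi> x) \<le> norm (?w x)" for x
    proof (cases "x \<in> S")
      case True
      then have "x \<in> ball 0 (R+1)" using R(2) by auto
      then show ?thesis using M(2)[of x] M(1) by simp
    qed (use D0 M(1) in simp)
    then show "AE x in lborel. norm (D\<phi> x) \<le> norm (?w x)" by simp
  qed (use measD in simp)
  have int\<phi>: "integrable lborel \<phi>"
  proof -
    have "integrable lborel (\<lambda>x. indicator S x *\<^sub>R \<phi> x)"
      by (rule borel_integrable_compact[OF S(1) continuous_on_subset[OF cont]]) simp
    moreover have "(\<lambda>x. indicator S x *\<^sub>R \<phi> x) = \<phi>"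
      using \<phi>0 by (force simp: indicator_def fun_eq_iff)
    ultimately show ?thesis by simp
  qed
  have comp: "(\<integral>x. b \<bullet> D\<phi> x \<partial>lborel) = 0" if b: "b \<in> Basis" for b
  proof -
    let ?q = "\<lambda>n x. (\<phi> (x + (1 / real (Suc n)) *\<^sub>R b) - \<phi> x) * real (Suc n)"
    have 0: "(\<integral>x. ?q n x \<partial>lborel) = 0" for n
    proof -
      let ?t = "(1 / real (Suc n)) *\<^sub>R b"
      have d: "distr lborel borel ((+) ?t) = (lborel :: 'a measure)" by (rule lborel_distr_plus)
      have i: "integrable lborel (\<lambda>x. \<phi> (?t + x))"
        using int\<phi> meas\<phi> integrable_distr_eq[of "(+) ?t" lborel borel \<phi>] unfolding d by simp
      have "(\<integral>x. \<phi> (?t + x) \<partial>lborel) = (\<integral>x. \<phi> x \<partial>lborel)"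
        using meas\<phi> integral_distr[of "(+) ?t" lborel borel \<phi>] unfolding d by simp
      then show ?thesis using i int\<phi> by (simp add: add.commute)
    qed
    have "(\<lambda>n. \<integral>x. ?q n x \<partial>lborel) \<longlonglongrightarrow> (\<integral>x. b \<bullet> D\<phi> x \<partial>lborel)"
    proof (rule integral_dominated_convergence[where w = ?w])
      show "AE x in lborel. (\<lambda>n. ?q n x) \<longlonglongrightarrow> b \<bullet> D\<phi> x"
      proof (rule AE_I2)
        fix x
        have "((\<lambda>s. \<phi> (x + s *\<^sub>R b)) has_derivative (\<lambda>s. (s *\<^sub>R b) \<bullet> D\<phi> (x + 0 *\<^sub>R b))) (at 0)"
          by (rule has_derivative_compose[where g = \<phi> and f = "\<lambda>s. x + s *\<^sub>R b", OF _ der])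
             (auto intro!: derivative_eq_intros)
        then have "((\<lambda>s. \<phi> (x + s *\<^sub>R b)) has_real_derivative (b \<bullet> D\<phi> x)) (at 0)"
          by (simp add: has_field_derivative_def mult_commute_abs)
        then have "((\<lambda>h. (\<phi> (x + h *\<^sub>R b) - \<phi> x) / h) \<longlongrightarrow> b \<bullet> D\<phi> x) (at 0)"
          by (simp add: DERIV_def)
        moreover have "filterlim (\<lambda>n. 1 / real (Suc n)) (at 0) sequentially"
          by (intro filterlim_atI lim_1_over_n[THEN LIMSEQ_Suc]) auto
        ultimately show "(\<lambda>n. ?q n x) \<longlonglongrightarrow> b \<bullet> D\<phi> x"
          by (drule_tac filterlim_compose) (auto simp: o_def)
      qed
      show "AE x in lborel. norm (?q n x) \<le> ?w x" for n
      proof (rule AE_I2)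
        fix x
        let ?t = "(1 / real (Suc n)) *\<^sub>R b"
        have nt: "norm ?t = 1 / real (Suc n)" using b by simp
        have "norm (\<phi> (x + ?t) - \<phi> x) \<le> M * norm ((x + ?t) - x)"
        proof (rule differentiable_bound[where S = UNIV and f' = "\<lambda>y h. h \<bullet> D\<phi> y"])
          fix y show "onorm (\<lambda>h. h \<bullet> D\<phi> y) \<le> M"
          proof (rule onorm_le)
            fix h
            have "norm (h \<bullet> D\<phi> y) \<le> norm h * norm (D\<phi> y)" by (simp add: Cauchy_Schwarz_ineq2)
            also have "\<dots> \<le> norm h * M" by (intro mult_left_mono M(2)) simp
            finally show "norm (h \<bullet> D\<phi> y) \<le> M * norm h" by (simp add: mult.commute)
          qed
        qed (auto intro: der has_derivative_at_withinI)
        then have "norm (\<phi> (x + ?t) - \<phi> x) \<le> M / real (Suc n)" by (simp add: nt b)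
        then have bd: "norm (?q n x) \<le> M"
          by (simp add: abs_mult pos_le_divide_eq)
        have z: "?q n x = 0" if "x \<notin> ball 0 (R+1)"
        proof -
          have "R + 1 \<le> norm x" using that by simp
          moreover have "norm x \<le> norm (x + ?t) + norm ?t"
            using norm_triangle_ineq4[of "x + ?t" ?t] by simp
          moreover have "norm ?t \<le> 1" unfolding nt by simp
          ultimately have "R \<le> norm (x + ?t)" "R \<le> norm x" by linarith+
          then have "x + ?t \<notin> ball 0 R" "x \<notin> ball 0 R" by simp_all
          then have "x + ?t \<notin> S" "x \<notin> S" using R(2) by blast+
          then show ?thesis by (simp add: \<phi>0)
        qed
        show "norm (?q n x) \<le> ?w x" using bd z by (cases "x \<in> ball 0 (R+1)") auto
      qed
    qed (use w measD meas\<phi> in \<open>auto intro!: borel_measurable_inner borel_measurable_diff borel_measurable_times measurable_compose[OF _ meas\<phi>]\<close>)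
    then show ?thesis using 0 LIMSEQ_unique[OF _ tendsto_const] by simp
  qed
  show "(\<integral>x. D\<phi> x \<partial>lborel) = 0"
  proof (rule euclidean_eqI)
    fix b :: 'a assume b: "b \<in> Basis"
    have "(\<integral>x. D\<phi> x \<partial>lborel) \<bullet> b = (\<integral>x. D\<phi> x \<bullet> b \<partial>lborel)"
      using intD by simp
    then show "(\<integral>x. D\<phi> x \<partial>lborel) \<bullet> b = 0 \<bullet> b" using comp[OF b] by (simp add: inner_commute)
  qed
qed

lemma has_weak_gradient_const:
  fixes \<Omega> :: "'a::euclidean_space set"
  assumes "bounded \<Omega>" "open \<Omega>"
  shows "has_weak_gradient \<Omega> (\<lambda>_. c) (\<lambda>_. 0)"
proof -
  have "finite_measure (lebesgue_on \<Omega>)"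
    using assms by (intro finite_measure_lebesgue_on bounded_set_imp_lmeasurable) auto
  then have "square_integrable (lebesgue_on \<Omega>) (\<lambda>_. c)"
    by (simp add: square_integrable_def finite_measure.integrable_const)
  moreover have "(\<integral>x. c *\<^sub>R D\<phi> x \<partial>lebesgue_on \<Omega>) = - (\<integral>x. \<phi> x *\<^sub>R (0::'a) \<partial>lebesgue_on \<Omega>)"
    if C1: "C1_with_gradient \<phi> D\<phi>" and s: "compact_support_in \<Omega> \<phi>" for \<phi> :: "'a \<Rightarrow> real" and D\<phi>
  proof -
    have K: "compact (closure {x. \<phi> x \<noteq> 0})" using s by (simp add: compact_support_in_def)
    note D = integral_C1_compact_support_gradient[OF C1 K]
    have "(\<integral>x. D\<phi> x \<partial>lebesgue_on \<Omega>) = (\<integral>x. indicator \<Omega> x *\<^sub>R D\<phi> x \<partial>lebesgue)"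
      using assms by (intro integral_restrict_space) auto
    also have "(\<lambda>x. indicator \<Omega> x *\<^sub>R D\<phi> x) = D\<phi>"
      using D(3) s by (force simp: compact_support_in_def indicator_def)
    also have "(\<integral>x. D\<phi> x \<partial>lebesgue) = (\<integral>x. D\<phi> x \<partial>lborel)"
      using D(1) by (intro integral_completion) (simp add: borel_measurable_integrable)
    finally show ?thesis using D(2) by simp
  qed
  moreover have "square_integrable (lebesgue_on \<Omega>) (\<lambda>_. 0 :: 'a)"
    by (simp add: square_integrable_def)
  ultimately show ?thesis
    unfolding has_weak_gradient_def by blast
qed

text \<open>Constant functions are admissible boundary data on every part of the boundary.\<close>

lemma trace_eq_on_const:
  assumes "bounded \<Omega>" "open \<Omega>"
  shows "(\<lambda>_. c) \<in> H1 \<Omega>" and "trace_eq_on \<Omega> \<Gamma> (\<lambda>_. c) (\<lambda>_. c)"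
proof -
  have c: "has_weak_gradient \<Omega> (\<lambda>_. c) (\<lambda>_. 0)"
    by (rule has_weak_gradient_const[OF assms])
  then show "(\<lambda>_. c) \<in> H1 \<Omega>" by (auto simp: H1_def)
  have "has_trace \<Omega> (\<lambda>_. c) (\<lambda>_. c)"
    unfolding has_trace_def
  proof (intro conjI exI)
    show "\<forall>k::nat. C1_with_gradient (\<lambda>_. c) (\<lambda>_. 0)"
      by (simp add: C1_with_gradient_def GDERIV_const)
  qed (use c in \<open>auto simp: L2_tendsto_def\<close>)
  then show "trace_eq_on \<Omega> \<Gamma> (\<lambda>_. c) (\<lambda>_. c)" by (auto simp: trace_eq_on_def)
qed


section \<open>The variational problem\<close>

text \<open>
  The two species are indexed by the type \<open>2\<close>, and a pair of concentrations is a function with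
  values in \<open>real ^ 2\<close>. The matrix \<open>K\<close> collects the constants: \<open>K $ i $ j\<close> is \<open>k\<^sub>i\<^sub>j\<close>.
\<close>

definition designs :: "'a::euclidean_space set \<Rightarrow> ('a \<Rightarrow> real) set" where
  "designs \<Omega> = {\<rho>. square_integrable (lebesgue_on \<Omega>) \<rho> \<and>
                  (AE x in lebesgue_on \<Omega>. 0 \<le> \<rho> x \<and> \<rho> x \<le> 1)}"

definition conductivity :: "real ^ 2 ^ 2 \<Rightarrow> ('a \<Rightarrow> real) \<Rightarrow> 2 \<Rightarrow> 'a \<Rightarrow> real" where
  "conductivity K \<rho> i x = K $ i $ 1 * \<rho> x + K $ i $ 2 * (1 - \<rho> x)"

definition exchange_matrix :: "real \<Rightarrow> real ^ 2 ^ 2" where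
  "exchange_matrix ks = ks *\<^sub>R vector [vector [1, -1], vector [-1, 1]]"

definition L_functional ::
  "'a::euclidean_space set \<Rightarrow> real ^ 2 ^ 2 \<Rightarrow> real \<Rightarrow> real \<Rightarrow> ('a \<Rightarrow> real ^ 2) \<Rightarrow> ('a \<Rightarrow> real) \<Rightarrow> real"
  where
  "L_functional \<Omega> K ks lam u \<rho> =
     (\<integral>x. (1/2 * (\<Sum>i\<in>UNIV. conductivity K \<rho> i x *
                            (norm (weak_gradient \<Omega> (\<lambda>y. u y $ i) x))\<^sup>2)
           + 1/2 * \<rho> x * (1 - \<rho> x) * (u x \<bullet> (exchange_matrix ks *v u x))
           - lam * \<rho> x) \<partial>lebesgue_on \<Omega>)"

definition admissible ::
  "'a::euclidean_space set \<Rightarrow> (2 \<Rightarrow> 'a set) \<Rightarrow> (2 \<Rightarrow> 'a \<Rightarrow> real) \<Rightarrow> ('a \<Rightarrow> real ^ 2) set" where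
  "admissible \<Omega> \<Gamma> w =
     {v. \<forall>i. (\<lambda>x. v x $ i) \<in> H1 \<Omega> \<and> trace_eq_on \<Omega> (\<Gamma> i) (\<lambda>x. v x $ i) (w i)}"

definition euler_lagrange_form ::
  "'a::euclidean_space set \<Rightarrow> real ^ 2 ^ 2 \<Rightarrow> real \<Rightarrow> ('a \<Rightarrow> real) \<Rightarrow>
     ('a \<Rightarrow> real ^ 2) \<Rightarrow> ('a \<Rightarrow> real ^ 2) \<Rightarrow> real" where
  "euler_lagrange_form \<Omega> K ks \<rho> u \<phi> =
     (\<integral>x. ((\<Sum>i\<in>UNIV. conductivity K \<rho> i x *
                 (weak_gradient \<Omega> (\<lambda>y. u y $ i) x \<bullet> weak_gradient \<Omega> (\<lambda>y. \<phi> y $ i) x))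
           + \<rho> x * (1 - \<rho> x) * (\<phi> x \<bullet> (exchange_matrix ks *v u x))) \<partial>lebesgue_on \<Omega>)"

end

theory Submission
  imports Defs
begin

text \<open>
  Traces are defined through \<open>C\<^sup>1\<close> functions on the whole space, so every inequality on \<open>H1 \<Omega>\<close> only has
  to be shown for such functions. For these, \<open>\<phi> x - \<phi> y\<close> is estimated by integrating the gradient along
  segments: inside balls, along short vertical shifts from a Lipschitz boundary patch into a ball, and
  from boundary points along vertical tubes, whose parametrisation by surface measure and height is
  dominated by Lebesgue measure. Chaining balls through the connected set \<open>\<Omega>\<close> and using compactness of
  its closure gives \<open>\<integral>\<integral> |\<phi> x - \<phi> y|\<^sup>2 \<le> C \<integral> |D\<phi>|\<^sup>2\<close>, where \<open>y\<close> runs over \<open>\<Omega>\<close> and \<open>x\<close> over \<open>\<Omega>\<close> or over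
  its boundary. This contains both the trace inequality and the Poincare inequality for functions that
  vanish on a boundary part of positive measure.

  The Poincare inequality makes the quadratic form coercive on the increments of admissible functions.
  By the parallelogram identity a minimising sequence is then Cauchy in \<open>H1 \<Omega>\<close>, and by the trace
  inequality its limit keeps the boundary values. Uniqueness and the Euler--Lagrange equation follow
  from expanding the quadratic form.
\<close>


section \<open>Surface measure of Lipschitz graphs\<close>

text \<open>Two obstacles shape the argument. Surface measure is defined by coverings, which makes
  exact formulas for graphs expensive; but it is needed only from above. A patch lying over a ball
  of radius \<open>r\<close> in the hyperplane has measure at most \<open>c * r ^ (n - 1)\<close>,
  so surface measure times height, pushed into space, gives each ball a mass of order
  \<open>r ^ n\<close>. That growth already forces domination by Lebesgue measure, and no Jacobian
  occurs. The other obstacle is a Poincare inequality with boundary terms but without compact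
  embeddings. Mean squared differences obey a triangle inequality through any third measure of
  positive mass, so they can be carried from patch to patch with finite constants; positivity of a
  boundary part enters as a mass to divide by. The exchange coefficient
  \<open>\<rho> x * (1 - \<rho> x)\<close> may vanish everywhere, so each component has to be
  controlled from its own boundary part. Moreover admissibility includes the existence of a trace,
  so a limit of admissible functions must be supplied with boundary values, not only with a weak
  gradient.\<close>

text \<open>Stacking \<open>k\<close> disjoint balls of radius \<open>r / (2 k)\<close> in direction \<open>e\<close> over each point of \<open>F\<close>
  gives a packing of a ball of radius \<open>3 r\<close>; comparing volumes yields the exponent \<open>n - 1\<close> without
  any \<open>(n - 1)\<close>-dimensional Lebesgue measure.\<close>

lemma card_separated_le:
  fixes F :: "'a::euclidean_space set"
  assumes e: "norm e = 1" and F: "finite F" "\<And>f. f \<in> F \<Longrightarrow> f \<bullet> e = 0" "F \<subseteq> cball p r"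
    and r: "r > 0" and k: "k \<ge> (1::nat)"
    and sep: "\<And>f g. f \<in> F \<Longrightarrow> g \<in> F \<Longrightarrow> f \<noteq> g \<Longrightarrow> r / k \<le> dist f g"
  shows "card F \<le> 6 ^ DIM('a) * k ^ (DIM('a) - 1)"
proof -
  define h where "h = r / k"
  have h: "h > 0" "real k * h = r" using r k by (auto simp: h_def)
  have ee: "e \<bullet> e = 1" using e by (simp add: norm_eq_1)
  define c where "c = (\<lambda>(f, j::nat). f + (real j * h) *\<^sub>R e)"
  define I where "I = F \<times> {..<k}"
  have I: "finite I" "card I = card F * k" using F by (auto simp: I_def card_cartesian_product)
  \<comment> \<open>Centres over the same point differ by a multiple of \<open>h\<close> along
    \<open>e\<close>; centres over different points differ by at least \<open>h\<close> orthogonally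
    to \<open>e\<close>. Pythagoras covers both cases.\<close>
  have far: "h \<le> dist (c i) (c i')" if "i \<in> I" "i' \<in> I" "i \<noteq> i'" for i i'
  proof -
    obtain f j f' j' where i: "i = (f, j)" "i' = (f', j')" by fastforce
    have f: "f \<in> F" "f' \<in> F" using that i by (auto simp: I_def)
    have eq: "c i - c i' = (f - f') + ((real j - real j') * h) *\<^sub>R e"
      by (simp add: c_def i algebra_simps)
    have orth: "(f - f') \<bullet> e = 0" using f F(2) by (simp add: inner_diff_left)
    have "(dist (c i) (c i'))\<^sup>2 = (norm (f - f'))\<^sup>2 + ((real j - real j') * h)\<^sup>2"
      unfolding dist_norm eq using orth e
      by (subst norm_add_Pythagorean) (auto simp: orthogonal_def power_mult_distrib)
    moreover have "h\<^sup>2 \<le> (norm (f - f'))\<^sup>2 + ((real j - real j') * h)\<^sup>2"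
    proof (cases "f = f'")
      case True
      then have "j \<noteq> j'" using that i by auto
      then have "1 \<le> \<bar>real j - real j'\<bar>" by linarith
      then have "1 \<le> (real j - real j')\<^sup>2" using power_mono[of 1 "\<bar>real j - real j'\<bar>" 2] by simp
      then show ?thesis using True by (simp add: power_mult_distrib mult_le_cancel_right1)
    next
      case False
      then have "h \<le> norm (f - f')" using sep[OF f False] by (simp add: h_def dist_norm)
      then have "h\<^sup>2 \<le> (norm (f - f'))\<^sup>2" using h by (intro power_mono) auto
      then show ?thesis by (simp add: add_increasing2)
    qed
    ultimately have "h\<^sup>2 \<le> (dist (c i) (c i'))\<^sup>2" by simp
    then show ?thesis by (rule power2_le_imp_le) simp
  qed
  have disj: "pairwise (\<lambda>i i'. disjnt (ball (c i) (h/2)) (ball (c i') (h/2))) I"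
  proof (rule pairwiseI)
    fix i i' assume "i \<in> I" "i' \<in> I" "i \<noteq> i'"
    then have "h \<le> dist (c i) (c i')" by (rule far)
    then show "disjnt (ball (c i) (h/2)) (ball (c i') (h/2))"
      unfolding disjnt_iff mem_ball
    proof safe
      fix y assume "dist (c i) y < h/2" "dist (c i') y < h/2"
      then show False using \<open>h \<le> dist (c i) (c i')\<close> dist_triangle2[of "c i" "c i'" y] by linarith
    qed
  qed
  \<comment> \<open>The three contributions, each at most \<open>r\<close>: the distance of
    \<open>f\<close> from \<open>p\<close>, the height of the stack, and the small radius.\<close>
  have sub: "(\<Union>i\<in>I. ball (c i) (h/2)) \<subseteq> ball p (3 * r)"
  proof (clarsimp simp: I_def)
    fix f j x assume fj: "f \<in> F" "j < k" and x: "dist (c (f, j)) x * 2 < h"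
    have 1: "dist p f \<le> r" using fj F(3) by auto
    have 2: "dist f (c (f, j)) = real j * h" using e h by (simp add: c_def dist_norm)
    have 3: "real j * h \<le> r" using fj h(1) unfolding h(2)[symmetric] by (intro mult_right_mono) auto
    have 4: "h \<le> r" using mult_right_mono[of 1 "real k" h] h k by simp
    have "dist p x \<le> dist p f + dist f (c (f,j)) + dist (c (f,j)) x"
      using dist_triangle[of p x f] dist_triangle[of f x "c (f,j)"] by linarith
    then show "dist p x < 3 * r" using 1 2 3 4 x r by linarith
  qed
  let ?V = "measure lborel (ball (0::'a) 1)"
  let ?n = "DIM('a)"
  have V: "?V > 0" by simp
  have bm: "ball x s \<in> fmeasurable lborel" for x :: 'a and s
    using emeasure_bounded_finite[OF bounded_ball] by (intro fmeasurableI) auto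
  have cb: "measure lborel (ball (c i) (h/2)) = (h/2) ^ ?n * ?V" for i
    using h by (intro content_ball_conv_unit_ball) simp
  have "card I * ((h/2) ^ ?n * ?V) = (\<Sum>i\<in>I. measure lborel (ball (c i) (h/2)))"
    using cb by simp
  also have "\<dots> = measure lborel (\<Union>i\<in>I. ball (c i) (h/2))"
    by (rule measure_UNION'[symmetric]) (use I(1) disj bm in \<open>simp_all\<close>)
  also have "\<dots> \<le> measure lborel (ball p (3 * r))"
    by (rule measure_mono_fmeasurable[OF sub]) (simp_all add: bm sets.finite_UN[OF I(1)])
  also have "\<dots> = (3 * r) ^ ?n * ?V" using r by (intro content_ball_conv_unit_ball) simp
  finally have "card I * (h/2) ^ ?n \<le> (3 * r) ^ ?n" using V by (simp add: mult.assoc[symmetric])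
  \<comment> \<open>Since \<open>r = k * h\<close>, the large radius is \<open>6 * k\<close> small
    radii, whence the factor 6. Each point of \<open>F\<close> carries \<open>k\<close> balls, and
    dividing by \<open>k\<close> lowers the exponent to \<open>n - 1\<close>.\<close>
  also have "(3 * r) ^ ?n = 6 ^ ?n * real k ^ ?n * (h/2) ^ ?n"
    unfolding power_mult_distrib[symmetric] h(2)[symmetric] by (simp add: mult.commute)
  finally have "real (card I) \<le> 6 ^ ?n * real k ^ ?n" using h by simp
  also have "real k ^ ?n = real k ^ (?n - 1) * k" by (simp add: power_eq_if)
  finally have "real (card F) * k \<le> (6 ^ ?n * real k ^ (?n - 1)) * k"
    unfolding I(2) of_nat_mult mult.assoc .
  then have "real (card F) \<le> 6 ^ ?n * real k ^ (?n - 1)"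
    using k by (subst (asm) mult_le_cancel_right) auto
  then have "real (card F) \<le> real (6 ^ ?n * k ^ (?n - 1))" by simp
  then show ?thesis by linarith
qed

text \<open>For a unit vector \<open>e\<close> this is the orthogonal projection onto the hyperplane
  normal to \<open>e\<close>; \<open>lipschitz_boundary\<close> spells it out in the argument of the
  graph function.\<close>

definition hproj :: "'a::real_inner \<Rightarrow> 'a \<Rightarrow> 'a" where
  "hproj e x = x - (x \<bullet> e) *\<^sub>R e"

lemma hproj_orthogonal: "norm e = 1 \<Longrightarrow> hproj e a \<bullet> e = 0"
  by (simp add: hproj_def inner_diff_left norm_eq_1)

lemma hproj_shift: "norm e = 1 \<Longrightarrow> hproj e (a + t *\<^sub>R e) = hproj e a"
  by (simp add: hproj_def norm_eq_1 algebra_simps)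

lemma dist_hproj_le:
  assumes e: "norm e = 1"
  shows "dist (hproj e x) (hproj e y) \<le> dist x y"
proof -
  have "hproj e x - hproj e y = (x - y) - ((x - y) \<bullet> e) *\<^sub>R e" by (simp add: hproj_def algebra_simps)
  moreover have "(norm ((x - y) - ((x - y) \<bullet> e) *\<^sub>R e))\<^sup>2 = (norm (x - y))\<^sup>2 - ((x - y) \<bullet> e)\<^sup>2"
    using e unfolding power2_norm_eq_inner norm_eq_1 by (simp add: inner_commute algebra_simps power2_eq_square)
  ultimately have "(dist (hproj e x) (hproj e y))\<^sup>2 \<le> (dist x y)\<^sup>2" by (simp add: dist_norm)
  then show ?thesis by (rule power2_le_imp_le) simp
qed

text \<open>A maximal \<open>r / k\<close>-separated set in the projection has at most
  \<open>6 ^ n * k ^ (n - 1)\<close> points, and the part of \<open>A\<close> over a ball around one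
  of them has diameter at most \<open>2 * L * r / k\<close>. In the product of number and weight the
  powers of \<open>k\<close> cancel, so the bound survives arbitrarily fine coverings.\<close>

lemma hausdorff_outer_lipschitz_graph_le:
  fixes A :: "'a::euclidean_space set"
  assumes e: "norm e = 1" and L: "L > 0"
    and lip: "\<And>a b. a \<in> A \<Longrightarrow> b \<in> A \<Longrightarrow> dist a b \<le> L * dist (hproj e a) (hproj e b)"
    and A: "\<And>a. a \<in> A \<Longrightarrow> dist p (hproj e a) \<le> r" and r: "r > 0"
  shows "hausdorff_outer (DIM('a) - 1) A
    \<le> ennreal (unit_ball_vol (DIM('a) - 1) * 6 ^ DIM('a) * (L * r) ^ (DIM('a) - 1))"
proof -
  let ?n = "DIM('a)" let ?\<pi> = "hproj e"
  let ?B = "ennreal (unit_ball_vol (DIM('a) - 1) * 6 ^ DIM('a) * (L * r) ^ (DIM('a) - 1))"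
  have orth: "?\<pi> a \<bullet> e = 0" for a by (rule hproj_orthogonal[OF e])
  have "hausdorff_pre (?n - 1) \<delta> A \<le> ?B" if \<delta>: "\<delta> > 0" for \<delta>
  proof -
    \<comment> \<open>Chosen so that the diameters \<open>2 * L * (r / k)\<close> of the covering
      pieces stay below \<open>\<delta>\<close>.\<close>
    obtain k :: nat where k: "k \<ge> 1" "2 * L * r \<le> \<delta> * k"
    proof -
      obtain m :: nat where "2 * L * r / \<delta> \<le> m" using real_arch_simple by blast
      then have "2 * L * r \<le> \<delta> * m" using \<delta> by (simp add: field_simps)
      also have "\<dots> \<le> \<delta> * max 1 m" using \<delta> by (intro mult_left_mono) auto
      finally have "2 * L * r \<le> \<delta> * max 1 m" .
      then show ?thesis by (intro that[of "max 1 m"]) auto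
    qed
    define h where "h = r / k"
    have h: "h > 0" using r k by (simp add: h_def)
    define S where "S F \<longleftrightarrow> finite F \<and> F \<subseteq> ?\<pi> ` A \<and> (\<forall>f\<in>F. \<forall>g\<in>F. f \<noteq> g \<longrightarrow> h \<le> dist f g)" for F
    have card: "card F \<le> 6 ^ ?n * k ^ (?n - 1)" if "S F" for F
    proof (rule card_separated_le[OF e _ _ _ r k(1)])
      show "F \<subseteq> cball p r" using that A by (auto simp: S_def)
    qed (use that orth in \<open>auto simp: S_def h_def\<close>)
    have "S {}" by (simp add: S_def)
    then obtain F where F: "S F" "\<And>G. S G \<Longrightarrow> card G \<le> card F"
      using ex_has_greatest_nat[of S "{}" card "Suc (6 ^ ?n * k ^ (?n - 1))"] card le_imp_less_Suc by blast
    have cover: "\<exists>f\<in>F. dist (?\<pi> a) f < h" if "a \<in> A" for a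
    proof (rule ccontr)
      assume "\<not> ?thesis"
      then have far: "\<And>f. f \<in> F \<Longrightarrow> h \<le> dist (?\<pi> a) f" by force
      then have "?\<pi> a \<notin> F" using h by fastforce
      moreover have "S (insert (?\<pi> a) F)"
        using F(1) far that by (auto simp: S_def dist_commute)
      ultimately show False using F(2)[of "insert (?\<pi> a) F"] F(1) by (simp add: S_def)
    qed
    define N where "N = card F"
    obtain g where g: "bij_betw g {..<N} F"
      using F(1) ex_bij_betw_nat_finite[of F] by (auto simp: S_def N_def atLeast0LessThan)
    \<comment> \<open>The covering must be a sequence; the empty sets from index \<open>N\<close> on
      have weight 0.\<close>
    define U where "U i = (if i < N then {a\<in>A. dist (?\<pi> a) (g i) < h} else {})" for i
    have dU: "dist a b \<le> 2 * L * h" if "a \<in> U i" "b \<in> U i" for a b i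
    proof -
      have "dist (?\<pi> a) (?\<pi> b) \<le> 2 * h"
        using that dist_triangle2[of "?\<pi> a" "?\<pi> b" "g i"] by (auto simp: U_def split: if_splits)
      then have "L * dist (?\<pi> a) (?\<pi> b) \<le> L * (2 * h)" using L by simp
      then show ?thesis using lip[of a b] that by (auto simp: U_def split: if_splits)
    qed
    have bU: "bounded (U i)" for i
      using dU by (force simp: bounded_two_points)
    have diam: "diameter (U i) \<le> 2 * L * h" for i
      using dU L h by (intro diameter_le) (auto simp: dist_norm)
    have "2 * L * h \<le> \<delta>" using k by (simp add: h_def field_simps)
    then have "hausdorff_pre (?n - 1) \<delta> A \<le> (\<Sum>i. hausdorff_weight (?n - 1) (U i))"
      unfolding hausdorff_pre_def
    proof (intro INF_lower, safe)
      fix a assume "a \<in> A"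
      then obtain f where f: "f \<in> F" "dist (?\<pi> a) f < h" using cover by blast
      then obtain i where "i < N" "f = g i" using g by (auto simp: bij_betw_def)
      then have "a \<in> U i" using f \<open>a \<in> A\<close> by (simp add: U_def)
      then show "a \<in> (\<Union>i. U i)" by blast
    qed (use bU diam in \<open>auto intro: order_trans\<close>)
    also have "\<dots> = (\<Sum>i<N. hausdorff_weight (?n - 1) (U i))"
      by (rule suminf_finite) (auto simp: U_def hausdorff_weight_def)
    also have "\<dots> \<le> (\<Sum>i<N. ennreal (unit_ball_vol (?n - 1) * (L * h) ^ (?n - 1)))"
    proof (rule sum_mono)
      fix i
      have "(diameter (U i) / 2) ^ (?n - 1) \<le> (L * h) ^ (?n - 1)"
        using diam[of i] diameter_ge_0[OF bU] by (intro power_mono) (auto simp: field_simps)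
      then show "hausdorff_weight (?n - 1) (U i) \<le> ennreal (unit_ball_vol (?n - 1) * (L * h) ^ (?n - 1))"
        by (auto simp: hausdorff_weight_def intro!: ennreal_leI mult_left_mono)
    qed
    also have "\<dots> = ennreal (N * (unit_ball_vol (?n - 1) * (L * h) ^ (?n - 1)))"
      using L h by (simp add: ennreal_of_nat_eq_real_of_nat ennreal_mult)
    also have "\<dots> \<le> ?B"
    proof (rule ennreal_leI)
      \<comment> \<open>The count grows like \<open>k ^ (n - 1)\<close> and the weight
        \<open>(L * r / k) ^ (n - 1)\<close> shrinks at the same rate.\<close>
      have "real N \<le> 6 ^ ?n * real k ^ (?n - 1)"
        using of_nat_mono[OF card[OF F(1)], where 'a=real] unfolding N_def by simp
      then have "real N * (unit_ball_vol (?n - 1) * (L * h) ^ (?n - 1))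
        \<le> (6 ^ ?n * real k ^ (?n - 1)) * (unit_ball_vol (?n - 1) * (L * h) ^ (?n - 1))"
        using L h by (intro mult_right_mono) auto
      also have "\<dots> = unit_ball_vol (?n - 1) * 6 ^ ?n * (L * r) ^ (?n - 1)"
        using k by (simp add: h_def power_mult_distrib power_divide)
      finally show "real N * (unit_ball_vol (?n - 1) * (L * h) ^ (?n - 1))
        \<le> unit_ball_vol (?n - 1) * 6 ^ ?n * (L * r) ^ (?n - 1)" .
    qed
    finally show ?thesis .
  qed
  then show ?thesis unfolding hausdorff_outer_def by (intro SUP_least) auto
qed


section \<open>Measures dominated by Lebesgue measure\<close>

text \<open>Ball growth controls cubes, and non-overlapping cubes inside an open set only slightly
  larger than \<open>S\<close> add up to almost the Lebesgue measure of \<open>S\<close>. A cube of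
  side \<open>l\<close> lies in a ball of radius \<open>n * l\<close>, which produces the factor
  \<open>n ^ n\<close>.\<close>

lemma emeasure_le_lborel_if_cball_le:
  fixes \<nu> :: "'a::euclidean_space measure"
  assumes sets: "sets \<nu> = sets borel" and C: "C \<ge> 0"
    and cball: "\<And>q r. r > 0 \<Longrightarrow> emeasure \<nu> (cball q r) \<le> ennreal (C * r ^ DIM('a))"
    and A: "A \<in> sets borel"
  shows "emeasure \<nu> A \<le> ennreal (C * DIM('a) ^ DIM('a)) * emeasure lborel A"
proof -
  let ?n = "DIM('a)" let ?C = "ennreal (C * ?n ^ ?n)"
  have bounded: "emeasure \<nu> S \<le> ?C * emeasure lborel S" if S: "S \<in> sets borel" "bounded S" for S
  proof -
    obtain r where r: "r > 0" "S \<subseteq> cbox (- (r *\<^sub>R One)) (r *\<^sub>R One)"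
    proof -
      obtain r where r: "r > 0" "\<And>x. x \<in> S \<Longrightarrow> norm x \<le> r" using S(2) by (auto simp: bounded_pos)
      have "x \<in> cbox (- (r *\<^sub>R One)) (r *\<^sub>R One)" if "x \<in> S" for x
        unfolding mem_box
      proof (intro ballI)
        fix i :: 'a assume i: "i \<in> Basis"
        have "\<bar>x \<bullet> i\<bar> \<le> r" using Basis_le_norm[OF i, of x] r(2)[OF that] by linarith
        then show "- (r *\<^sub>R One) \<bullet> i \<le> x \<bullet> i \<and> x \<bullet> i \<le> (r *\<^sub>R One) \<bullet> i"
          using i by (simp add: inner_sum_Basis abs_le_iff minus_le_iff)
      qed
      then show ?thesis using r(1) that by blast
    qed
    have ne: "box (- (r *\<^sub>R One)) (r *\<^sub>R One :: 'a) \<noteq> {}"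
      using r(1) by (simp add: box_ne_empty inner_sum_Basis)
    have "emeasure \<nu> S \<le> ?C * emeasure lborel S + ?C * ennreal \<epsilon>" if \<epsilon>: "\<epsilon> > 0" for \<epsilon>
    proof -
      obtain T where T: "open T" "S \<subseteq> T" "emeasure lebesgue (T - S) < ennreal \<epsilon>"
        using sets_lebesgue_outer_open[OF _ \<epsilon>, of S] S(1) by (metis sets_completionI_sets sets_lborel)
      have "\<exists>s>0. ball x s \<subseteq> T" if "x \<in> S" for x
        using T that by (meson open_contains_ball subsetD)
      then obtain s where s: "\<And>x. x \<in> S \<Longrightarrow> s x > 0" "\<And>x. x \<in> S \<Longrightarrow> ball x (s x) \<subseteq> T"
        by metis
      \<comment> \<open>The gauge forces every cube of the covering into \<open>T\<close>; its value
        off \<open>S\<close> is irrelevant to the cubes.\<close>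
      define g where "g x = (if x \<in> S then ball x (s x) else ball x 1)" for x
      have g: "gauge g" using s by (auto simp: g_def gauge_def)
      obtain \<D> where \<D>: "countable \<D>"
        "\<And>K. K \<in> \<D> \<Longrightarrow> interior K \<noteq> {} \<and> (\<exists>c d. K = cbox c d)"
        "pairwise (\<lambda>A B. interior A \<inter> interior B = {}) \<D>"
        "\<And>K. K \<in> \<D> \<Longrightarrow> \<exists>x \<in> S \<inter> K. K \<subseteq> g x"
        "\<And>u v. cbox u v \<in> \<D> \<Longrightarrow> \<exists>n. \<forall>i \<in> Basis. v \<bullet> i - u \<bullet> i = ((r *\<^sub>R One) \<bullet> i - (- (r *\<^sub>R One)) \<bullet> i) / 2^n"
        "S \<subseteq> \<Union>\<D>"
        using covering_lemma[OF r(2) ne g] by metis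
      have KT: "K \<subseteq> T" if "K \<in> \<D>" for K
        using \<D>(4)[OF that] s(2) by (fastforce simp: g_def)
      have cube: "emeasure \<nu> K \<le> ?C * emeasure lborel (interior K)" if K: "K \<in> \<D>" for K
      proof -
        obtain u v where uv: "K = cbox u v" using \<D>(2)[OF K] by auto
        obtain m where m: "\<And>i. i \<in> Basis \<Longrightarrow> v \<bullet> i - u \<bullet> i = 2 * r / 2^m"
          using \<D>(5)[of u v] K uv by (auto simp: inner_sum_Basis)
        define l where "l = 2 * r / 2^m"
        have l: "l > 0" using r by (simp add: l_def)
        have sub: "K \<subseteq> cball u (?n * l)"
        proof
          fix y assume y: "y \<in> K"
          have "norm (y - u) \<le> (\<Sum>i\<in>Basis. \<bar>(y - u) \<bullet> i\<bar>)" by (rule norm_le_l1)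
          also have "\<dots> \<le> (\<Sum>i\<in>(Basis::'a set). l)"
          proof (rule sum_mono)
            fix i :: 'a assume i: "i \<in> Basis"
            then have "u \<bullet> i \<le> y \<bullet> i" "y \<bullet> i \<le> v \<bullet> i" using y by (auto simp: uv mem_box)
            then show "\<bar>(y - u) \<bullet> i\<bar> \<le> l" using m[OF i] by (simp add: l_def inner_diff_left)
          qed
          finally show "y \<in> cball u (?n * l)" by (simp add: dist_norm norm_minus_commute)
        qed
        have "emeasure \<nu> K \<le> emeasure \<nu> (cball u (?n * l))"
          using sub by (intro emeasure_mono) (auto simp: sets)
        also have "\<dots> \<le> ennreal (C * (?n * l) ^ ?n)"
          using l by (intro cball) auto
        also have "\<dots> = ?C * ennreal (l ^ ?n)"
          using C l by (simp add: ennreal_mult power_mult_distrib mult.assoc)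
        \<comment> \<open>Closed cubes may share faces. Passing to the interior costs nothing for
          Lebesgue measure and makes the pieces disjoint, while on the side of \<open>\<nu>\<close>
          the whole cube is kept, as faces could carry mass there.\<close>
        also have "ennreal (l ^ ?n) = emeasure lborel (interior K)"
        proof -
          have "u \<bullet> i \<le> v \<bullet> i" if "i \<in> Basis" for i using m[OF that] l by (simp add: l_def)
          moreover have "(\<Prod>i\<in>Basis. (v - u) \<bullet> i) = l ^ ?n"
            using m by (simp add: inner_diff_left l_def)
          ultimately show ?thesis unfolding uv interior_cbox by (subst emeasure_lborel_box) auto
        qed
        finally show ?thesis .
      qed
      define X where "X m = (if m \<in> to_nat_on \<D> ` \<D> then from_nat_into \<D> m else {})" for m
      have X: "X m = {} \<or> X m \<in> \<D>" for m
        using \<D>(1) by (auto simp: X_def)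
      have UX: "(\<Union>m. X m) = \<Union>\<D>"
      proof -
        have "K \<subseteq> (\<Union>m. X m)" if "K \<in> \<D>" for K
        proof -
          have "X (to_nat_on \<D> K) = K" using that \<D>(1) by (simp add: X_def)
          then show ?thesis by blast
        qed
        moreover have "X m \<subseteq> \<Union>\<D>" for m using X[of m] by auto
        ultimately show ?thesis by (intro subset_antisym Sup_least UN_least)
      qed
      have Xm: "X m \<in> sets borel" for m using X[of m] \<D>(2) by (auto dest!: \<D>(2))
      have dis: "disjoint_family (\<lambda>m. interior (X m))"
        unfolding disjoint_family_on_def
      proof (intro ballI impI)
        fix m m' :: nat assume ne: "m \<noteq> m'"
        show "interior (X m) \<inter> interior (X m') = {}"
        proof (cases "X m = {} \<or> X m' = {}")
          case False
          then have mm: "m \<in> to_nat_on \<D> ` \<D>" "m' \<in> to_nat_on \<D> ` \<D>" unfolding X_def by presburger+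
          then have "X m \<noteq> X m'" using ne \<D>(1) by (auto simp: X_def)
          moreover have "X m \<in> \<D>" "X m' \<in> \<D>" using False X[of m] X[of m'] by blast+
          ultimately show ?thesis using \<D>(3) by (simp add: pairwise_def)
        qed auto
      qed
      have "emeasure \<nu> S \<le> emeasure \<nu> (\<Union>m. X m)"
        using \<D>(6) Xm by (intro emeasure_mono) (simp_all only: UX[symmetric] sets sets.countable_UN image_subset_iff ball_simps, auto)
      also have "\<dots> \<le> (\<Sum>m. emeasure \<nu> (X m))"
        using Xm by (intro emeasure_subadditive_countably) (auto simp: sets)
      also have "\<dots> \<le> (\<Sum>m. ?C * emeasure lborel (interior (X m)))"
      proof (rule suminf_le)
        show "emeasure \<nu> (X m) \<le> ?C * emeasure lborel (interior (X m))" for m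
          using X[of m] cube[of "X m"] by auto
      qed auto
      also have "\<dots> = ?C * (\<Sum>m. emeasure lborel (interior (X m)))"
        by (rule ennreal_suminf_cmult)
      also have "(\<Sum>m. emeasure lborel (interior (X m))) = emeasure lborel (\<Union>m. interior (X m))"
        by (rule suminf_emeasure) (use dis in auto)
      also have "\<dots> \<le> emeasure lborel T"
      proof (rule emeasure_mono)
        show "(\<Union>m. interior (X m)) \<subseteq> T"
        proof (rule UN_least)
          fix m
          have "X m \<subseteq> T" using X[of m] KT[of "X m"] by auto
          then show "interior (X m) \<subseteq> T" using interior_subset by (rule order_trans[rotated])
        qed
      qed (use T in auto)
      also have "emeasure lborel T = emeasure lborel (S \<union> (T - S))"
        using T by (simp add: Un_absorb1)
      also have "\<dots> \<le> emeasure lborel S + emeasure lborel (T - S)"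
        using S T by (intro emeasure_subadditive) auto
      also have "emeasure lborel (T - S) \<le> ennreal \<epsilon>"
        using T S by (simp add: borel_open)
      finally show ?thesis by (simp add: distrib_left mult_left_mono)
    qed
    note 1 = this
    show ?thesis
    proof (rule ennreal_le_epsilon)
      fix \<epsilon> :: real assume \<epsilon>: "\<epsilon> > 0"
      \<comment> \<open>The summand 1 keeps the denominator of the rescaled error positive when
        \<open>C = 0\<close>.\<close>
      have pos: "C * ?n ^ ?n + 1 > 0" using C by (simp add: add_nonneg_pos)
      have "?C * ennreal (\<epsilon> / (C * ?n ^ ?n + 1)) = ennreal (C * ?n ^ ?n * (\<epsilon> / (C * ?n ^ ?n + 1)))"
        using C by (intro ennreal_mult'[symmetric]) auto
      also have "\<dots> \<le> ennreal \<epsilon>"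
        using pos \<epsilon> C by (intro ennreal_leI) (auto simp: field_simps)
      finally show "emeasure \<nu> S \<le> ?C * emeasure lborel S + ennreal \<epsilon>"
        using 1[of "\<epsilon> / (C * ?n ^ ?n + 1)"] \<epsilon> pos by (meson add_left_mono order_trans divide_pos_pos)
    qed
  qed
  \<comment> \<open>Unbounded sets are exhausted by bounded ones, since the cube covering needs a
    bounding box.\<close>
  define B where "B m = A \<inter> ball 0 (real m)" for m
  have B: "B m \<in> sets borel" "bounded (B m)" for m using A by (auto simp: B_def intro: bounded_subset)
  have "incseq B" by (auto simp: incseq_def B_def)
  moreover have "(\<Union>m. B m) = A" by (auto simp: B_def) (metis reals_Archimedean2)
  ultimately have "emeasure \<nu> A = (SUP m. emeasure \<nu> (B m))"
    using SUP_emeasure_incseq[of B \<nu>] B by (simp add: sets image_subset_iff)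
  also have "\<dots> \<le> ?C * emeasure lborel A"
  proof (rule SUP_least)
    fix m
    have "emeasure \<nu> (B m) \<le> ?C * emeasure lborel (B m)" by (rule bounded[OF B])
    also have "\<dots> \<le> ?C * emeasure lborel A"
      using A by (intro mult_left_mono emeasure_mono) (auto simp: B_def)
    finally show "emeasure \<nu> (B m) \<le> ?C * emeasure lborel A" .
  qed
  finally show ?thesis .
qed

lemma nn_integral_le_lborel_if_cball_le:
  fixes \<nu> :: "'a::euclidean_space measure"
  assumes sets: "sets \<nu> = sets borel" and C: "C \<ge> 0"
    and cball: "\<And>q r. r > 0 \<Longrightarrow> emeasure \<nu> (cball q r) \<le> ennreal (C * r ^ DIM('a))"
    and f: "f \<in> borel_measurable borel"
  shows "(\<integral>\<^sup>+x. f x \<partial>\<nu>) \<le> ennreal (C * DIM('a) ^ DIM('a)) * (\<integral>\<^sup>+x. f x \<partial>lborel)"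
proof -
  let ?C = "ennreal (C * DIM('a) ^ DIM('a))"
  have "emeasure \<nu> A \<le> emeasure (scale_measure ?C lborel) A" for A
  proof (cases "A \<in> sets borel")
    case True
    then show ?thesis using emeasure_le_lborel_if_cball_le[OF sets C cball True] by simp
  qed (use sets in \<open>simp add: emeasure_notin_sets\<close>)
  then have "\<nu> \<le> scale_measure ?C lborel"
    using sets by (subst le_measure) (auto simp: le_fun_def)
  then have "(\<integral>\<^sup>+x. f x \<partial>\<nu>) \<le> (\<integral>\<^sup>+x. f x \<partial>scale_measure ?C lborel)"
    by (intro nn_integral_mono_measure) (simp_all add: sets)
  also have "\<dots> = ?C * (\<integral>\<^sup>+x. f x \<partial>lborel)"
    using f by (intro nn_integral_scale_measure) simp
  finally show ?thesis .
qed


text \<open>Takes the place of the area formula: an integral over the vertical segments of length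
  \<open>h\<close> above the patch costs at most a constant times the volume integral. Monotone use
  of \<open>emeasure_le_lborel_if_cball_le\<close> extends the comparison from balls to all
  nonnegative Borel functions.\<close>

lemma nn_integral_tube_le:
  fixes A :: "'a::euclidean_space set"
  assumes e: "norm e = 1" and L: "L > 0" and h: "h > 0"
    and lip: "\<And>a b. a \<in> A \<Longrightarrow> b \<in> A \<Longrightarrow> dist a b \<le> L * dist (hproj e a) (hproj e b)"
    and A: "A \<in> sets borel" "bounded A"
  defines "\<sigma> \<equiv> restrict_space (hausdorff_measure (DIM('a) - 1)) A"
  shows "finite_measure \<sigma>"
    and "\<exists>C::real. \<forall>f\<in>borel_measurable borel.
      (\<integral>\<^sup>+a. (\<integral>\<^sup>+t. f (a + t *\<^sub>R e) \<partial>restrict_space lborel {0<..h}) \<partial>\<sigma>) \<le> ennreal C * (\<integral>\<^sup>+x. f x \<partial>lborel)"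
proof -
  let ?n = "DIM('a)" let ?H = "hausdorff_measure (?n - 1) :: 'a measure"
  let ?\<pi> = "hproj e"
  define c where "c = unit_ball_vol (?n - 1) * 6 ^ ?n * L ^ (?n - 1)"
  have c: "c \<ge> 0" using L by (simp add: c_def)
  have H: "emeasure ?H S \<le> ennreal (c * r ^ (?n - 1))"
    if S: "S \<subseteq> A" "S \<in> sets borel" and r: "r > 0" "\<And>a. a \<in> S \<Longrightarrow> dist p (?\<pi> a) \<le> r" for S p r
  proof -
    have "hausdorff_outer (?n - 1) S \<le> ennreal (unit_ball_vol (?n - 1) * 6 ^ ?n * (L * r) ^ (?n - 1))"
    proof (rule hausdorff_outer_lipschitz_graph_le[OF e L])
      show "dist a b \<le> L * dist (?\<pi> a) (?\<pi> b)" if "a \<in> S" "b \<in> S" for a b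
        using lip[of a b] that S(1) by auto
    qed (use r in auto)
    then show ?thesis
      using S(2) by (simp add: emeasure_hausdorff_measure c_def power_mult_distrib mult.assoc)
  qed
  have space: "space \<sigma> = A" by (simp add: \<sigma>_def space_restrict_space hausdorff_measure_def)
  note \<pi>dist = dist_hproj_le[OF e] and \<pi>shift = hproj_shift[OF e]
  obtain R where R: "R > 0" "\<And>a. a \<in> A \<Longrightarrow> norm a \<le> R" using A(2) by (auto simp: bounded_pos)
  have "emeasure ?H A \<le> ennreal (c * R ^ (?n - 1))"
  proof (rule H[where p = "?\<pi> 0"])
    show "dist (?\<pi> 0) (?\<pi> a) \<le> R" if "a \<in> A" for a
      using \<pi>dist[of 0 a] R(2)[OF that] by simp
  qed (use A R in auto)
  then have "emeasure ?H A < \<infinity>" by (simp add: le_less_trans)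
  then show fin: "finite_measure \<sigma>"
    unfolding \<sigma>_def using A(1)
    by (intro finite_measure_restrict_space finite_measureI) (auto simp: emeasure_restrict_space space_restrict_space)
  interpret \<sigma>: finite_measure \<sigma> by (rule fin)
  define T where "T = restrict_space lborel {0<..h}"
  have "finite_measure T" unfolding T_def using h by (intro finite_measureI) (simp add: emeasure_restrict_space space_restrict_space)
  then interpret T: finite_measure T .
  interpret pair_sigma_finite \<sigma> T ..
  have id\<sigma>: "(\<lambda>x. x) \<in> borel_measurable \<sigma>" unfolding \<sigma>_def
    by (intro measurable_restrict_space1) (simp add: measurable_ident_sets)
  have idT: "(\<lambda>x. x) \<in> borel_measurable T" unfolding T_def
    by (intro measurable_restrict_space1) simp
  define s where "s = (\<lambda>(a, t::real). a + t *\<^sub>R e)"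
  have s: "s \<in> borel_measurable (\<sigma> \<Otimes>\<^sub>M T)"
    unfolding s_def case_prod_unfold
    using measurable_compose[OF measurable_fst id\<sigma>] measurable_compose[OF measurable_snd idT]
    by (intro borel_measurable_add borel_measurable_scaleR) auto
  \<comment> \<open>\<open>\<nu>\<close> is dominated by Lebesgue measure because its mass in a ball of radius \<open>r\<close> is at most a
     vertical length of order \<open>r\<close> times a surface area of order \<open>r ^ (n - 1)\<close>.\<close>
  define \<nu> where "\<nu> = distr (\<sigma> \<Otimes>\<^sub>M T) borel s"
  have \<nu>int: "(\<integral>\<^sup>+x. f x \<partial>\<nu>) = (\<integral>\<^sup>+a. (\<integral>\<^sup>+t. f (a + t *\<^sub>R e) \<partial>T) \<partial>\<sigma>)"
    if f: "f \<in> borel_measurable borel" for f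
  proof -
    have "(\<integral>\<^sup>+x. f x \<partial>\<nu>) = (\<integral>\<^sup>+z. f (s z) \<partial>(\<sigma> \<Otimes>\<^sub>M T))"
      unfolding \<nu>_def by (rule nn_integral_distr[OF s]) (simp add: f)
    also have "\<dots> = (\<integral>\<^sup>+a. (\<integral>\<^sup>+t. f (s (a, t)) \<partial>T) \<partial>\<sigma>)"
      by (rule T.nn_integral_fst[symmetric]) (rule measurable_compose[OF s f])
    finally show ?thesis by (simp add: s_def)
  qed
  have ball: "emeasure \<nu> (cball q r) \<le> ennreal (2 * c * r ^ ?n)" if r: "r > 0" for q r
  proof -
    \<comment> \<open>Moving along \<open>e\<close> does not change the projection, so over points
      of \<open>A\<close> outside \<open>S\<close> the whole vertical line misses the ball.\<close>
    define S where "S = A \<inter> {a. dist (?\<pi> q) (?\<pi> a) \<le> r}"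
    have S: "S \<in> sets borel" "S \<subseteq> A"
    proof -
      have "closed {a. dist (?\<pi> q) (?\<pi> a) \<le> r}"
        by (intro closed_Collect_le) (auto simp: hproj_def intro!: continuous_intros)
      then show "S \<in> sets borel" "S \<subseteq> A" using A(1) by (auto simp: S_def)
    qed
    have "emeasure \<nu> (cball q r) = (\<integral>\<^sup>+x. indicator (cball q r) x \<partial>\<nu>)"
      by (simp add: \<nu>_def)
    also have "\<dots> = (\<integral>\<^sup>+a. (\<integral>\<^sup>+t. indicator (cball q r) (a + t *\<^sub>R e) \<partial>T) \<partial>\<sigma>)"
      by (rule \<nu>int) (rule borel_measurable_indicator, simp)
    also have "\<dots> \<le> (\<integral>\<^sup>+a. ennreal (2 * r) * indicator S a \<partial>\<sigma>)"
    proof (rule nn_integral_mono)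
      fix a assume "a \<in> space \<sigma>"
      then have a: "a \<in> A" by (simp add: space)
      show "(\<integral>\<^sup>+t. indicator (cball q r) (a + t *\<^sub>R e) \<partial>T) \<le> ennreal (2 * r) * indicator S a"
      proof (cases "a \<in> S")
        case True
        \<comment> \<open>The height of the centre relative to \<open>a\<close>: the vertical line
          through \<open>a\<close> is inside the ball only at heights within \<open>r\<close> of it,
          hence on a length of at most \<open>2 * r\<close>.\<close>
        let ?t = "(q - a) \<bullet> e"
        have "(\<integral>\<^sup>+t. indicator (cball q r) (a + t *\<^sub>R e) \<partial>T) \<le> (\<integral>\<^sup>+t. indicator (cball q r) (a + t *\<^sub>R e) \<partial>lborel)"
          unfolding T_def by (subst nn_integral_restrict_space) (auto intro!: nn_integral_mono simp: indicator_def)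
        also have "\<dots> \<le> (\<integral>\<^sup>+t. indicator {?t - r..?t + r} t \<partial>lborel)"
        proof (intro nn_integral_mono)
          fix t
          have "\<bar>t - ?t\<bar> \<le> dist q (a + t *\<^sub>R e)"
          proof -
            have "t - ?t = (a + t *\<^sub>R e - q) \<bullet> e" using e by (simp add: norm_eq_1 algebra_simps)
            also have "\<bar>\<dots>\<bar> \<le> norm (a + t *\<^sub>R e - q) * norm e" by (rule Cauchy_Schwarz_ineq2)
            finally show ?thesis using e by (simp add: dist_norm norm_minus_commute)
          qed
          then show "indicator (cball q r) (a + t *\<^sub>R e) \<le> (indicator {?t - r..?t + r} t :: ennreal)"
            by (auto simp: indicator_def)
        qed
        also have "\<dots> = ennreal (2 * r)" using r by simp
        finally show ?thesis using True by simp
      next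
        case False
        have "a + t *\<^sub>R e \<notin> cball q r" for t
          using \<pi>dist[of q "a + t *\<^sub>R e"] False a unfolding \<pi>shift by (auto simp: S_def)
        then show ?thesis by simp
      qed
    qed
    also have "\<dots> = ennreal (2 * r) * emeasure \<sigma> S"
      using S A(1) by (intro nn_integral_cmult_indicator) (auto simp: \<sigma>_def sets_restrict_space_iff)
    also have "emeasure \<sigma> S = emeasure ?H S"
      using S A(1) unfolding \<sigma>_def by (intro emeasure_restrict_space) auto
    also have "\<dots> \<le> ennreal (c * r ^ (?n - 1))"
      by (rule H[OF S(2,1) r, where p = "?\<pi> q"]) (simp add: S_def)
    also have "ennreal (2 * r) * ennreal (c * r ^ (?n - 1)) = ennreal (2 * c * r ^ ?n)"
    proof -
      have "r ^ ?n = r * r ^ (?n - 1)" by (simp add: power_eq_if)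
      then show ?thesis using r c by (simp add: ennreal_mult'[symmetric] mult_ac)
    qed
    finally show ?thesis by (simp add: mult_left_mono)
  qed
  show "\<exists>C::real. \<forall>f\<in>borel_measurable borel.
      (\<integral>\<^sup>+a. (\<integral>\<^sup>+t. f (a + t *\<^sub>R e) \<partial>restrict_space lborel {0<..h}) \<partial>\<sigma>) \<le> ennreal C * (\<integral>\<^sup>+x. f x \<partial>lborel)"
  proof (intro exI ballI)
    fix f :: "'a \<Rightarrow> ennreal" assume f: "f \<in> borel_measurable borel"
    have "(\<integral>\<^sup>+x. f x \<partial>\<nu>) \<le> ennreal (2 * c * ?n ^ ?n) * (\<integral>\<^sup>+x. f x \<partial>lborel)"
      by (rule nn_integral_le_lborel_if_cball_le[OF _ _ ball f]) (use c in \<open>simp_all add: \<nu>_def\<close>)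
    then show "(\<integral>\<^sup>+a. (\<integral>\<^sup>+t. f (a + t *\<^sub>R e) \<partial>restrict_space lborel {0<..h}) \<partial>\<sigma>)
      \<le> ennreal (2 * c * ?n ^ ?n) * (\<integral>\<^sup>+x. f x \<partial>lborel)"
      unfolding \<nu>int[OF f] T_def .
  qed
qed


section \<open>Energy estimates along segments\<close>

lemma ennreal_norm_add_squared_le:
  "ennreal ((norm (x + y))\<^sup>2) \<le> 2 * ennreal ((norm x)\<^sup>2) + 2 * ennreal ((norm y)\<^sup>2)"
proof -
  have "(norm (x + y))\<^sup>2 \<le> (norm x + norm y)\<^sup>2"
    by (intro power_mono norm_triangle_ineq) simp
  also have "\<dots> \<le> 2 * (norm x)\<^sup>2 + 2 * (norm y)\<^sup>2"
    using sum_squares_bound[of "norm x" "norm y"] by (simp add: power2_sum)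
  finally have "ennreal ((norm (x + y))\<^sup>2) \<le> ennreal (2 * (norm x)\<^sup>2 + 2 * (norm y)\<^sup>2)"
    by (rule ennreal_leI)
  also have "\<dots> = 2 * ennreal ((norm x)\<^sup>2) + 2 * ennreal ((norm y)\<^sup>2)"
    by (subst ennreal_plus) (auto simp: ennreal_mult')
  finally show ?thesis .
qed

lemma ennreal_diff_squared_le:
  fixes a b c :: real
  shows "ennreal ((a - b)\<^sup>2) \<le> 2 * ennreal ((a - c)\<^sup>2) + 2 * ennreal ((b - c)\<^sup>2)"
  using ennreal_norm_add_squared_le[of "a - c" "c - b"] by (simp add: power2_commute)

lemma C1_with_gradientD:
  assumes "C1_with_gradient \<phi> D\<phi>"
  shows "\<phi> \<in> borel_measurable borel" "D\<phi> \<in> borel_measurable borel"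
    "continuous_on UNIV \<phi>" "continuous_on UNIV D\<phi>"
    "(\<phi> has_derivative (\<lambda>h. h \<bullet> D\<phi> x)) (at x)"
proof -
  show D: "(\<phi> has_derivative (\<lambda>h. h \<bullet> D\<phi> x)) (at x)" for x
    using assms by (simp add: C1_with_gradient_def gderiv_def)
  show c: "continuous_on UNIV D\<phi>" using assms by (simp add: C1_with_gradient_def)
  show "continuous_on UNIV \<phi>"
    by (intro continuous_at_imp_continuous_on ballI has_derivative_continuous[OF D])
  then show "\<phi> \<in> borel_measurable borel" "D\<phi> \<in> borel_measurable borel"
    using c by (auto intro: borel_measurable_continuous_onI)
qed

text \<open>The increment is the integral of the directional derivative along the segment, and
  Cauchy-Schwarz bounds its square. The starting point is left out of the integral because later it
  will lie on the boundary, outside the open set carrying the energy.\<close>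

lemma C1_line_squared_le:
  fixes \<phi> :: "'a::euclidean_space \<Rightarrow> real"
  assumes C1: "C1_with_gradient \<phi> D\<phi>" and t: "t > 0"
  shows "ennreal ((\<phi> (x + t *\<^sub>R z) - \<phi> x)\<^sup>2)
    \<le> ennreal (t * (norm z)\<^sup>2) * (\<integral>\<^sup>+s. ennreal ((norm (D\<phi> (x + s *\<^sub>R z)))\<^sup>2) * indicator {0<..t} s \<partial>lborel)"
proof -
  note C = C1_with_gradientD[OF C1]
  define g where "g s = z \<bullet> D\<phi> (x + s *\<^sub>R z)" for s
  define m where "m = \<phi> (x + t *\<^sub>R z) - \<phi> x"
  have cont: "continuous_on S (\<lambda>s. D\<phi> (x + s *\<^sub>R z))" for S :: "real set"
    by (rule continuous_on_compose2[OF C(4)]) (auto intro!: continuous_intros)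
  have "((\<lambda>s. \<phi> (x + s *\<^sub>R z)) has_vector_derivative g s) (at s within {0..t})" for s
  proof -
    have "((\<lambda>s. x + s *\<^sub>R z) has_derivative (\<lambda>h. h *\<^sub>R z)) (at s within {0..t})"
      by (auto intro!: derivative_eq_intros)
    from has_derivative_compose[OF this C(5)]
    have "((\<lambda>s. \<phi> (x + s *\<^sub>R z)) has_derivative (\<lambda>h. (h *\<^sub>R z) \<bullet> D\<phi> (x + s *\<^sub>R z))) (at s within {0..t})" .
    then show ?thesis by (simp add: has_vector_derivative_def g_def)
  qed
  then have "(g has_integral (\<phi> (x + t *\<^sub>R z) - \<phi> (x + 0 *\<^sub>R z))) {0..t}"
    using t by (intro fundamental_theorem_of_calculus) auto
  then have m: "(g has_integral m) {0..t}" by (simp add: m_def)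
  let ?N = "\<lambda>s. (norm (D\<phi> (x + s *\<^sub>R z)))\<^sup>2"
  have N: "(?N has_integral integral {0..t} ?N) {0..t}"
    by (intro integrable_integral integrable_continuous_interval continuous_intros cont)
  have g2: "((\<lambda>s. (g s)\<^sup>2) has_integral integral {0..t} (\<lambda>s. (g s)\<^sup>2)) {0..t}"
    unfolding g_def by (intro integrable_integral integrable_continuous_interval continuous_intros cont)
  \<comment> \<open>The mean of \<open>g\<close>. Integrating the nonnegative function
    \<open>(g s - v)\<^sup>2\<close> gives the Cauchy-Schwarz inequality for \<open>g\<close>
    against 1.\<close>
  define v where "v = m / t"
  have "((\<lambda>s. (g s)\<^sup>2 - (2 * v) * g s + v\<^sup>2) has_integral
     (integral {0..t} (\<lambda>s. (g s)\<^sup>2) - (2 * v) * m + (t - 0) *\<^sub>R v\<^sup>2)) {0..t}"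
    by (intro has_integral_add has_integral_diff g2 has_integral_mult_right m
      has_integral_const_real[of "v\<^sup>2" 0 t, unfolded content_real[OF less_imp_le[OF t]]])
  then have "0 \<le> integral {0..t} (\<lambda>s. (g s)\<^sup>2) - (2 * v) * m + (t - 0) *\<^sub>R v\<^sup>2"
  proof (rule has_integral_nonneg)
    show "0 \<le> (g s)\<^sup>2 - (2 * v) * g s + v\<^sup>2" for s
      using zero_le_power2[of "g s - v"] by (simp add: power2_diff mult_ac)
  qed
  then have 1: "m\<^sup>2 \<le> t * integral {0..t} (\<lambda>s. (g s)\<^sup>2)"
    using t by (simp add: v_def field_simps power2_eq_square)
  have "integral {0..t} (\<lambda>s. (g s)\<^sup>2) \<le> (norm z)\<^sup>2 * integral {0..t} ?N"
  proof (rule has_integral_le[OF g2 has_integral_mult_right[OF N]])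
    fix s
    have "\<bar>g s\<bar> \<le> norm z * norm (D\<phi> (x + s *\<^sub>R z))" unfolding g_def by (rule Cauchy_Schwarz_ineq2)
    then have "\<bar>g s\<bar>\<^sup>2 \<le> (norm z * norm (D\<phi> (x + s *\<^sub>R z)))\<^sup>2" by (intro power_mono) auto
    then show "(g s)\<^sup>2 \<le> (norm z)\<^sup>2 * ?N s" by (simp add: power_mult_distrib)
  qed
  then have "t * integral {0..t} (\<lambda>s. (g s)\<^sup>2) \<le> t * ((norm z)\<^sup>2 * integral {0..t} ?N)"
    using t by (intro mult_left_mono) auto
  then have "m\<^sup>2 \<le> (t * (norm z)\<^sup>2) * integral {0..t} ?N" using 1 by simp
  then have "ennreal (m\<^sup>2) \<le> ennreal ((t * (norm z)\<^sup>2) * integral {0..t} ?N)" by (rule ennreal_leI)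
  also have "\<dots> = ennreal (t * (norm z)\<^sup>2) * ennreal (integral {0..t} ?N)"
    using t by (intro ennreal_mult') auto
  also have "ennreal (integral {0..t} ?N) = (\<integral>\<^sup>+s. ennreal (?N s) * indicator {0..t} s \<partial>lborel)"
    by (rule nn_integral_has_integral_lebesgue'[symmetric, OF _ N]) simp
  also have "\<dots> = (\<integral>\<^sup>+s. ennreal (?N s) * indicator {0<..t} s \<partial>lborel)"
    by (rule nn_integral_cong_AE, use AE_lborel_singleton[of 0] in eventually_elim)
       (auto simp: indicator_def)
  finally show ?thesis by (simp add: m_def)
qed

lemma nn_integral_lborel_shift:
  fixes f :: "'a::euclidean_space \<Rightarrow> ennreal"
  assumes "f \<in> borel_measurable borel"
  shows "(\<integral>\<^sup>+x. f (x + z) \<partial>lborel) = (\<integral>\<^sup>+x. f x \<partial>lborel)"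
proof -
  have "(\<integral>\<^sup>+x. f x \<partial>lborel) = (\<integral>\<^sup>+x. f x \<partial>distr lborel borel ((+) z))"
    by (simp add: lborel_distr_plus)
  also have "\<dots> = (\<integral>\<^sup>+x. f (z + x) \<partial>lborel)"
    using assms by (intro nn_integral_distr) auto
  finally show ?thesis by (simp add: add.commute)
qed

text \<open>After exchanging the integrals, each \<open>t\<close> contributes a translate of the
  energy density cut off to \<open>\<Omega>\<close>, and translations preserve Lebesgue measure; so
  every \<open>t\<close> costs at most the full energy.\<close>

lemma C1_shift_squared_le:
  fixes \<phi> :: "'a::euclidean_space \<Rightarrow> real"
  assumes C1: "C1_with_gradient \<phi> D\<phi>" and U: "U \<in> sets borel" and \<Omega>: "open \<Omega>"
    and sub: "\<And>x t. x \<in> U \<Longrightarrow> 0 < t \<Longrightarrow> t \<le> 1 \<Longrightarrow> x + t *\<^sub>R z \<in> \<Omega>"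
  shows "(\<integral>\<^sup>+x. ennreal ((\<phi> (x + z) - \<phi> x)\<^sup>2) * indicator U x \<partial>lborel)
    \<le> ennreal ((norm z)\<^sup>2) * (\<integral>\<^sup>+x. ennreal ((norm (D\<phi> x))\<^sup>2) * indicator \<Omega> x \<partial>lborel)"
proof -
  note C = C1_with_gradientD[OF C1]
  let ?N = "\<lambda>x. ennreal ((norm (D\<phi> x))\<^sup>2) * indicator \<Omega> x"
  have N: "?N \<in> borel_measurable borel" using C(2) \<Omega> by (auto intro!: borel_measurable_times_ennreal)
  let ?F = "\<lambda>x t. indicator {0<..1} t * ?N (x + t *\<^sub>R z)"
  have F: "(\<lambda>(x, t). ?F x t) \<in> borel_measurable (lborel \<Otimes>\<^sub>M lborel)"
  proof -
    have b: "(\<lambda>p. ?N (fst p + snd p *\<^sub>R z)) \<in> borel_measurable (lborel \<Otimes>\<^sub>M lborel)"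
      by (rule measurable_compose[OF _ N]) simp
    have a: "(\<lambda>p. indicator {0<..1} (snd p) :: ennreal) \<in> borel_measurable (lborel \<Otimes>\<^sub>M (lborel :: real measure))"
      by (rule measurable_compose[OF measurable_snd]) simp
    show ?thesis unfolding case_prod_unfold by (rule borel_measurable_times_ennreal[OF a b])
  qed
  have "(\<integral>\<^sup>+x. ennreal ((\<phi> (x + z) - \<phi> x)\<^sup>2) * indicator U x \<partial>lborel)
    \<le> (\<integral>\<^sup>+x. ennreal ((norm z)\<^sup>2) * (\<integral>\<^sup>+t. ?F x t \<partial>lborel) \<partial>lborel)"
  proof (rule nn_integral_mono)
    fix x
    show "ennreal ((\<phi> (x + z) - \<phi> x)\<^sup>2) * indicator U x \<le> ennreal ((norm z)\<^sup>2) * (\<integral>\<^sup>+t. ?F x t \<partial>lborel)"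
    proof (cases "x \<in> U")
      case True
      have "(\<integral>\<^sup>+t. ennreal ((norm (D\<phi> (x + t *\<^sub>R z)))\<^sup>2) * indicator {0<..1} t \<partial>lborel) = (\<integral>\<^sup>+t. ?F x t \<partial>lborel)"
        using sub[OF True] by (intro nn_integral_cong) (auto simp: indicator_def)
      then show ?thesis using C1_line_squared_le[OF C1, of 1 x z] True by simp
    qed simp
  qed
  also have "\<dots> = ennreal ((norm z)\<^sup>2) * (\<integral>\<^sup>+x. (\<integral>\<^sup>+t. ?F x t \<partial>lborel) \<partial>lborel)"
    by (rule nn_integral_cmult) (use lborel.borel_measurable_nn_integral_fst[OF F] in simp)
  also have "(\<integral>\<^sup>+x. (\<integral>\<^sup>+t. ?F x t \<partial>lborel) \<partial>lborel) = (\<integral>\<^sup>+t. (\<integral>\<^sup>+x. ?F x t \<partial>lborel) \<partial>lborel)"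
    by (rule lborel_pair.Fubini'[symmetric, OF F])
  also have "\<dots> = (\<integral>\<^sup>+t. indicator {0<..1} t * (\<integral>\<^sup>+x. ?N x \<partial>lborel) \<partial>(lborel :: real measure))"
  proof (rule nn_integral_cong)
    fix t :: real
    have "(\<integral>\<^sup>+x. ?F x t \<partial>lborel) = indicator {0<..1} t * (\<integral>\<^sup>+x. ?N (x + t *\<^sub>R z) \<partial>lborel)"
      by (rule nn_integral_cmult) (rule measurable_compose[OF _ N], simp)
    then show "(\<integral>\<^sup>+x. ?F x t \<partial>lborel) = indicator {0<..1} t * (\<integral>\<^sup>+x. ?N x \<partial>lborel)"
      using nn_integral_lborel_shift[OF N] by simp
  qed
  also have "\<dots> = (\<integral>\<^sup>+x. ?N x \<partial>lborel)"
    by (subst nn_integral_multc) auto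
  finally show ?thesis .
qed


section \<open>Chains of linked measures\<close>

text \<open>Stated through the identity map so that it covers restrictions of \<open>borel\<close> measures to subsets.\<close>

definition embedded_finite_measure :: "'a::euclidean_space measure \<Rightarrow> bool" where
  "embedded_finite_measure \<mu> \<longleftrightarrow> finite_measure \<mu> \<and> (\<lambda>x. x) \<in> borel_measurable \<mu>"

definition dirichlet :: "'a::euclidean_space set \<Rightarrow> ('a \<Rightarrow> 'a) \<Rightarrow> ennreal" where
  "dirichlet \<Omega> G = (\<integral>\<^sup>+x. ennreal ((norm (G x))\<^sup>2) * indicator \<Omega> x \<partial>lborel)"

definition mean_gap :: "'a measure \<Rightarrow> ('a \<Rightarrow> real) \<Rightarrow> 'a \<Rightarrow> ennreal" where
  "mean_gap \<nu> \<phi> x = (\<integral>\<^sup>+y. ennreal ((\<phi> x - \<phi> y)\<^sup>2) \<partial>\<nu>)"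

text \<open>Two measures are linked if the mean squared difference of a \<open>C\<^sup>1\<close> function between them is
  controlled by its Dirichlet energy on \<open>\<Omega>\<close>. Links compose along chains of measures, and this holds
  for volume and surface measures alike. The constant may be negative, when \<open>ennreal C = 0\<close>.\<close>

definition linked :: "'a::euclidean_space set \<Rightarrow> 'a measure \<Rightarrow> 'a measure \<Rightarrow> bool" where
  "linked \<Omega> \<mu> \<nu> \<longleftrightarrow> (\<exists>C::real. \<forall>\<phi> D\<phi>. C1_with_gradient \<phi> D\<phi> \<longrightarrow>
     (\<integral>\<^sup>+x. mean_gap \<nu> \<phi> x \<partial>\<mu>)
       \<le> ennreal C * dirichlet \<Omega> D\<phi>)"

abbreviation leb :: "'a::euclidean_space set \<Rightarrow> 'a measure" where
  "leb U \<equiv> restrict_space lborel U"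

text \<open>The estimates yield constants in \<open>ennreal\<close>, built from masses of measures;
  finiteness turns them into the real constant stored in \<open>linked\<close>.\<close>

lemma linkedI:
  assumes "\<And>\<phi> D\<phi>. C1_with_gradient \<phi> D\<phi> \<Longrightarrow>
     (\<integral>\<^sup>+x. mean_gap \<nu> \<phi> x \<partial>\<mu>)
       \<le> C * dirichlet \<Omega> D\<phi>"
    and "C < \<infinity>"
  shows "linked \<Omega> \<mu> \<nu>"
  unfolding linked_def using assms by (intro exI[of _ "enn2real C"]) simp

lemma linkedE:
  assumes "linked \<Omega> \<mu> \<nu>"
  obtains C where "C < \<infinity>" "\<And>\<phi> D\<phi>. C1_with_gradient \<phi> D\<phi> \<Longrightarrow>
     (\<integral>\<^sup>+x. mean_gap \<nu> \<phi> x \<partial>\<mu>)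
       \<le> C * dirichlet \<Omega> D\<phi>"
proof -
  obtain C :: real where "\<And>\<phi> D\<phi>. C1_with_gradient \<phi> D\<phi> \<Longrightarrow>
     (\<integral>\<^sup>+x. mean_gap \<nu> \<phi> x \<partial>\<mu>) \<le> ennreal C * dirichlet \<Omega> D\<phi>"
    using assms unfolding linked_def by blast
  then show ?thesis by (intro that[of "ennreal C"]) simp_all
qed

lemma embedded_finite_measure_leb:
  assumes "U \<in> sets borel" "bounded U"
  shows "embedded_finite_measure (leb U)"
  unfolding embedded_finite_measure_def
proof
  show "finite_measure (leb U)"
    using assms emeasure_bounded_finite[of U]
    by (intro finite_measureI) (simp add: emeasure_restrict_space space_restrict_space less_top)
  show "(\<lambda>x. x) \<in> borel_measurable (leb U)" by (intro measurable_restrict_space1) simp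
qed

lemma borel_measurable_embedded:
  "embedded_finite_measure \<mu> \<Longrightarrow> f \<in> borel_measurable borel \<Longrightarrow> f \<in> borel_measurable \<mu>"
  unfolding embedded_finite_measure_def by (auto dest: measurable_compose)

lemma nn_integral_leb:
  "U \<in> sets borel \<Longrightarrow> (\<integral>\<^sup>+x. f x \<partial>leb U) = (\<integral>\<^sup>+x. f x * indicator U x \<partial>lborel)"
  by (rule nn_integral_restrict_space) simp

lemma borel_measurable_mean_squared_diff:
  fixes \<phi> :: "'a::euclidean_space \<Rightarrow> real"
  assumes \<rho>: "embedded_finite_measure \<rho>" and \<phi>: "\<phi> \<in> borel_measurable borel"
  shows "mean_gap \<rho> \<phi> \<in> borel_measurable borel"
proof -
  interpret finite_measure \<rho> using \<rho> by (simp add: embedded_finite_measure_def)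
  note [measurable] = \<phi> borel_measurable_embedded[OF \<rho> \<phi>]
  show ?thesis unfolding mean_gap_def by measurable
qed

text \<open>Every \<open>y\<close> serves as an intermediate value between \<open>x\<close> and
  \<open>z\<close>; integrating over \<open>y\<close> puts the mass of \<open>\<rho>\<close> on the
  left.\<close>

lemma squared_diff_le_mean:
  fixes \<phi> :: "'a::euclidean_space \<Rightarrow> real"
  assumes \<rho>: "embedded_finite_measure \<rho>" and \<phi>: "\<phi> \<in> borel_measurable borel"
  shows "emeasure \<rho> (space \<rho>) * ennreal ((\<phi> x - \<phi> z)\<^sup>2)
    \<le> 2 * mean_gap \<rho> \<phi> x + 2 * mean_gap \<rho> \<phi> z"
proof -
  note [measurable] = borel_measurable_embedded[OF \<rho> \<phi>]
  have "emeasure \<rho> (space \<rho>) * ennreal ((\<phi> x - \<phi> z)\<^sup>2) = (\<integral>\<^sup>+y. ennreal ((\<phi> x - \<phi> z)\<^sup>2) \<partial>\<rho>)"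
    by (simp add: mult.commute)
  also have "\<dots> \<le> (\<integral>\<^sup>+y. 2 * ennreal ((\<phi> x - \<phi> y)\<^sup>2) + 2 * ennreal ((\<phi> z - \<phi> y)\<^sup>2) \<partial>\<rho>)"
    by (intro nn_integral_mono ennreal_diff_squared_le)
  also have "\<dots> = 2 * (\<integral>\<^sup>+y. ennreal ((\<phi> x - \<phi> y)\<^sup>2) \<partial>\<rho>) + 2 * (\<integral>\<^sup>+y. ennreal ((\<phi> z - \<phi> y)\<^sup>2) \<partial>\<rho>)"
    by (simp add: nn_integral_add nn_integral_cmult)
  finally show ?thesis by (simp only: mean_gap_def)
qed

text \<open>The triangle inequality for links. Integrating \<open>squared_diff_le_mean\<close> over
  both measures leaves the mass of \<open>\<rho>\<close> as a factor on the left, and dividing by it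
  is where a middle measure of positive mass is essential.\<close>

lemma linked_common:
  fixes \<Omega> :: "'a::euclidean_space set"
  assumes \<mu>: "embedded_finite_measure \<mu>" and \<nu>: "embedded_finite_measure \<nu>"
    and \<rho>: "embedded_finite_measure \<rho>" "emeasure \<rho> (space \<rho>) > 0"
    and l: "linked \<Omega> \<mu> \<rho>" "linked \<Omega> \<nu> \<rho>"
  shows "linked \<Omega> \<mu> \<nu>"
proof -
  interpret \<mu>: finite_measure \<mu> using \<mu> by (simp add: embedded_finite_measure_def)
  interpret \<nu>: finite_measure \<nu> using \<nu> by (simp add: embedded_finite_measure_def)
  interpret \<rho>: finite_measure \<rho> using \<rho> by (simp add: embedded_finite_measure_def)
  let ?m = "emeasure \<mu> (space \<mu>)" let ?n = "emeasure \<nu> (space \<nu>)" let ?r = "emeasure \<rho> (space \<rho>)"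
  from l obtain C D where C: "C < \<infinity>" "\<And>\<phi> D\<phi>. C1_with_gradient \<phi> D\<phi> \<Longrightarrow>
     (\<integral>\<^sup>+x. mean_gap \<rho> \<phi> x \<partial>\<mu>) \<le> C * dirichlet \<Omega> D\<phi>"
    and D: "D < \<infinity>" "\<And>\<phi> D\<phi>. C1_with_gradient \<phi> D\<phi> \<Longrightarrow>
     (\<integral>\<^sup>+x. mean_gap \<rho> \<phi> x \<partial>\<nu>) \<le> D * dirichlet \<Omega> D\<phi>"
    by (elim linkedE) blast
  \<comment> \<open>Cancellation in \<open>ennreal\<close> needs a mass that is neither 0 nor
    infinite.\<close>
  have r: "inverse ?r * ?r = 1"
    using \<rho>(2) \<rho>.emeasure_finite[of "space \<rho>"]
    by (metis ennreal_divide_self divide_ennreal_def less_irrefl mult.commute top.not_eq_extremum infinity_ennreal_def)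
  show ?thesis
  proof (rule linkedI)
    fix \<phi> :: "'a \<Rightarrow> real" and D\<phi> assume C1: "C1_with_gradient \<phi> D\<phi>"
    note \<phi> = C1_with_gradientD(1)[OF C1]
    define F where "F = mean_gap \<rho> \<phi>"
    define N where "N = dirichlet \<Omega> D\<phi>"
    have F: "F \<in> borel_measurable borel"
      unfolding F_def by (rule borel_measurable_mean_squared_diff[OF \<rho>(1) \<phi>])
    note [measurable] = borel_measurable_embedded[OF \<mu> F] borel_measurable_embedded[OF \<nu> F]
      borel_measurable_embedded[OF \<nu> \<phi>] borel_measurable_embedded[OF \<mu> \<phi>]
    have "?r * (\<integral>\<^sup>+x. mean_gap \<nu> \<phi> x \<partial>\<mu>) = (\<integral>\<^sup>+x. ?r * mean_gap \<nu> \<phi> x \<partial>\<mu>)"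
      using borel_measurable_embedded[OF \<mu> borel_measurable_mean_squared_diff[OF \<nu> \<phi>]]
      by (rule nn_integral_cmult[symmetric])
    also have "\<dots> = (\<integral>\<^sup>+x. (\<integral>\<^sup>+z. ?r * ennreal ((\<phi> x - \<phi> z)\<^sup>2) \<partial>\<nu>) \<partial>\<mu>)"
      unfolding mean_gap_def by (intro nn_integral_cong nn_integral_cmult[symmetric]) simp
    also have "\<dots> \<le> (\<integral>\<^sup>+x. (\<integral>\<^sup>+z. 2 * F x + 2 * F z \<partial>\<nu>) \<partial>\<mu>)"
      unfolding F_def by (intro nn_integral_mono squared_diff_le_mean \<rho>(1) \<phi>)
    also have "\<dots> = 2 * ?n * (\<integral>\<^sup>+x. F x \<partial>\<mu>) + 2 * ?m * (\<integral>\<^sup>+z. F z \<partial>\<nu>)"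
      by (simp add: nn_integral_add nn_integral_cmult nn_integral_multc mult_ac)
    also have "\<dots> \<le> 2 * ?n * (C * N) + 2 * ?m * (D * N)"
      using C(2)[OF C1] D(2)[OF C1] by (intro add_mono mult_left_mono) (simp_all add: F_def N_def)
    finally have "?r * (\<integral>\<^sup>+x. mean_gap \<nu> \<phi> x \<partial>\<mu>) \<le> (2 * ?n * C + 2 * ?m * D) * N"
      by (simp add: distrib_right mult.assoc)
    then have "inverse ?r * (?r * (\<integral>\<^sup>+x. mean_gap \<nu> \<phi> x \<partial>\<mu>))
      \<le> inverse ?r * ((2 * ?n * C + 2 * ?m * D) * N)" by (rule mult_left_mono) simp
    with r show "(\<integral>\<^sup>+x. mean_gap \<nu> \<phi> x \<partial>\<mu>) \<le> (inverse ?r * (2 * ?n * C + 2 * ?m * D)) * N"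
      by (simp add: mult.assoc[symmetric])
  next
    show "inverse ?r * (2 * ?n * C + 2 * ?m * D) < \<infinity>"
      using C(1) D(1) \<rho>(2) \<mu>.emeasure_finite \<nu>.emeasure_finite
      by (auto simp: ennreal_mult_eq_top_iff less_top[symmetric])
  qed
qed

text \<open>Instead of exchanging the two integrals, \<open>\<nu>\<close> itself is used as the
  middle measure; this is why it has to be linked to itself.\<close>

lemma linked_sym:
  assumes \<mu>: "embedded_finite_measure \<mu>" and \<nu>: "embedded_finite_measure \<nu>" "emeasure \<nu> (space \<nu>) > 0"
    and l: "linked \<Omega> \<mu> \<nu>" "linked \<Omega> \<nu> \<nu>"
  shows "linked \<Omega> \<nu> \<mu>"
  by (rule linked_common[OF \<nu>(1) \<mu> \<nu> l(2,1)])

text \<open>Overlaps only enlarge the right-hand side, so the constants of the pieces add up. The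
  measure \<open>M\<close> is left general because the lemma is applied both to Lebesgue measure and
  to Hausdorff measure.\<close>

lemma linked_cover:
  fixes \<Omega> :: "'a::euclidean_space set"
  assumes I: "finite I" and U: "\<And>i. i \<in> I \<Longrightarrow> U i \<in> sets borel" and W: "W \<in> sets borel" "W \<subseteq> (\<Union>i\<in>I. U i)"
    and M: "sets M = sets borel" and \<rho>: "embedded_finite_measure \<rho>"
    and l: "\<And>i. i \<in> I \<Longrightarrow> linked \<Omega> (restrict_space M (U i)) \<rho>"
  shows "linked \<Omega> (restrict_space M W) \<rho>"
proof -
  have "\<exists>C. C < \<infinity> \<and> (\<forall>\<phi> D\<phi>. C1_with_gradient \<phi> D\<phi> \<longrightarrow>
     (\<integral>\<^sup>+x. mean_gap \<rho> \<phi> x \<partial>restrict_space M (U i))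
       \<le> C * dirichlet \<Omega> D\<phi>)" if "i \<in> I" for i
    using l[OF that] by (elim linkedE) blast
  then obtain C where C: "\<And>i. i \<in> I \<Longrightarrow> C i < \<infinity>" "\<And>i \<phi> D\<phi>. i \<in> I \<Longrightarrow> C1_with_gradient \<phi> D\<phi> \<Longrightarrow>
     (\<integral>\<^sup>+x. mean_gap \<rho> \<phi> x \<partial>restrict_space M (U i))
       \<le> C i * dirichlet \<Omega> D\<phi>" by metis
  have sp: "space M = UNIV" using sets_eq_imp_space_eq[OF M] by simp
  show ?thesis
  proof (rule linkedI)
    fix \<phi> :: "'a \<Rightarrow> real" and D\<phi> assume C1: "C1_with_gradient \<phi> D\<phi>"
    define F where "F = mean_gap \<rho> \<phi>"
    define N where "N = dirichlet \<Omega> D\<phi>"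
    have F: "F \<in> borel_measurable M"
      unfolding F_def using borel_measurable_mean_squared_diff[OF \<rho> C1_with_gradientD(1)[OF C1]]
      by (simp add: measurable_cong_sets[OF M refl])
    have "(\<integral>\<^sup>+x. F x \<partial>restrict_space M W) = (\<integral>\<^sup>+x. F x * indicator W x \<partial>M)"
      using W by (intro nn_integral_restrict_space) (simp add: M sp)
    also have "\<dots> \<le> (\<integral>\<^sup>+x. (\<Sum>i\<in>I. F x * indicator (U i) x) \<partial>M)"
    proof (rule nn_integral_mono)
      fix x
      show "F x * indicator W x \<le> (\<Sum>i\<in>I. F x * indicator (U i) x)"
      proof (cases "x \<in> W")
        case True
        then obtain i where "i \<in> I" "x \<in> U i" using W by auto
        then have "F x = F x * indicator (U i) x" by simp
        also have "\<dots> \<le> (\<Sum>i\<in>I. F x * indicator (U i) x)"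
          using I \<open>i \<in> I\<close> by (intro member_le_sum) auto
        finally show ?thesis using True by simp
      qed simp
    qed
    also have "\<dots> = (\<Sum>i\<in>I. (\<integral>\<^sup>+x. F x * indicator (U i) x \<partial>M))"
      using F U by (intro nn_integral_sum borel_measurable_times_ennreal borel_measurable_indicator) (auto simp: M)
    also have "\<dots> = (\<Sum>i\<in>I. (\<integral>\<^sup>+x. F x \<partial>restrict_space M (U i)))"
      using U by (intro sum.cong nn_integral_restrict_space[symmetric]) (auto simp: M sp)
    also have "\<dots> \<le> (\<Sum>i\<in>I. C i * N)"
      using C(2)[OF _ C1] by (intro sum_mono) (auto simp: F_def N_def)
    finally show "(\<integral>\<^sup>+x. F x \<partial>restrict_space M W) \<le> (\<Sum>i\<in>I. C i) * N"
      by (simp add: sum_distrib_right)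
  next
    show "(\<Sum>i\<in>I. C i) < \<infinity>" using C(1) I by (simp add: less_top[symmetric])
  qed
qed


text \<open>Moves the base point from \<open>x\<close> to \<open>w\<close> at the price of one
  squared increment, which the segment estimates control.\<close>

lemma mean_gap_le:
  fixes \<phi> :: "'a::euclidean_space \<Rightarrow> real"
  assumes \<rho>: "embedded_finite_measure \<rho>" and \<phi>: "\<phi> \<in> borel_measurable borel"
  shows "mean_gap \<rho> \<phi> x
    \<le> 2 * emeasure \<rho> (space \<rho>) * ennreal ((\<phi> w - \<phi> x)\<^sup>2) + 2 * mean_gap \<rho> \<phi> w"
proof -
  note [measurable] = borel_measurable_embedded[OF \<rho> \<phi>]
  have "mean_gap \<rho> \<phi> x \<le> (\<integral>\<^sup>+y. 2 * ennreal ((\<phi> w - \<phi> x)\<^sup>2) + 2 * ennreal ((\<phi> w - \<phi> y)\<^sup>2) \<partial>\<rho>)"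
    unfolding mean_gap_def
  proof (rule nn_integral_mono)
    show "ennreal ((\<phi> x - \<phi> y)\<^sup>2) \<le> 2 * ennreal ((\<phi> w - \<phi> x)\<^sup>2) + 2 * ennreal ((\<phi> w - \<phi> y)\<^sup>2)" for y
      using ennreal_diff_squared_le[of "\<phi> x" "\<phi> y" "\<phi> w"] by (simp add: power2_commute)
  qed
  also have "\<dots> = 2 * emeasure \<rho> (space \<rho>) * ennreal ((\<phi> w - \<phi> x)\<^sup>2) + 2 * mean_gap \<rho> \<phi> w"
    unfolding mean_gap_def by (simp add: nn_integral_add nn_integral_cmult mult_ac)
  finally show ?thesis .
qed

text \<open>The gap at \<open>x\<close> is compared with the gap at \<open>x + z\<close>, and the
  increment between them is paid for by energy along segments inside \<open>\<Omega>\<close>. This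
  lets a patch at the boundary inherit the link of a set in the interior.\<close>

lemma linked_shift:
  fixes \<Omega> :: "'a::euclidean_space set"
  assumes \<Omega>: "open \<Omega>" and U: "U \<in> sets borel" and V: "V \<in> sets borel"
    and sub: "\<And>x t. x \<in> U \<Longrightarrow> 0 < t \<Longrightarrow> t \<le> 1 \<Longrightarrow> x + t *\<^sub>R z \<in> \<Omega>"
    and UV: "\<And>x. x \<in> U \<Longrightarrow> x + z \<in> V"
    and \<rho>: "embedded_finite_measure \<rho>" and l: "linked \<Omega> (leb V) \<rho>"
  shows "linked \<Omega> (leb U) \<rho>"
proof -
  interpret \<rho>: finite_measure \<rho> using \<rho> by (simp add: embedded_finite_measure_def)
  let ?r = "emeasure \<rho> (space \<rho>)"
  from l obtain C where C: "C < \<infinity>" "\<And>\<phi> D\<phi>. C1_with_gradient \<phi> D\<phi> \<Longrightarrow>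
     (\<integral>\<^sup>+x. mean_gap \<rho> \<phi> x \<partial>leb V) \<le> C * dirichlet \<Omega> D\<phi>" by (elim linkedE) blast
  show ?thesis
  proof (rule linkedI)
    fix \<phi> :: "'a \<Rightarrow> real" and D\<phi> assume C1: "C1_with_gradient \<phi> D\<phi>"
    note \<phi> = C1_with_gradientD(1)[OF C1]
    note F = borel_measurable_mean_squared_diff[OF \<rho> \<phi>]
    note [measurable] = \<phi> F U V
    have "(\<integral>\<^sup>+x. mean_gap \<rho> \<phi> x \<partial>leb U) = (\<integral>\<^sup>+x. mean_gap \<rho> \<phi> x * indicator U x \<partial>lborel)"
      by (rule nn_integral_leb[OF U])
    also have "\<dots> \<le> (\<integral>\<^sup>+x. 2 * ?r * (ennreal ((\<phi> (x + z) - \<phi> x)\<^sup>2) * indicator U x)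
        + 2 * (mean_gap \<rho> \<phi> (x + z) * indicator V (x + z)) \<partial>lborel)"
      using mean_gap_le[OF \<rho> \<phi>] UV by (intro nn_integral_mono) (auto simp: indicator_def)
    also have "\<dots> = 2 * ?r * (\<integral>\<^sup>+x. ennreal ((\<phi> (x + z) - \<phi> x)\<^sup>2) * indicator U x \<partial>lborel)
        + 2 * (\<integral>\<^sup>+x. mean_gap \<rho> \<phi> (x + z) * indicator V (x + z) \<partial>lborel)"
      by (subst nn_integral_add) (simp_all add: nn_integral_cmult)
    also have "(\<integral>\<^sup>+x. mean_gap \<rho> \<phi> (x + z) * indicator V (x + z) \<partial>lborel)
        = (\<integral>\<^sup>+x. mean_gap \<rho> \<phi> x * indicator V x \<partial>lborel)"
      by (rule nn_integral_lborel_shift[of "\<lambda>x. mean_gap \<rho> \<phi> x * indicator V x"]) measurable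
    also have "\<dots> = (\<integral>\<^sup>+x. mean_gap \<rho> \<phi> x \<partial>leb V)" by (rule nn_integral_leb[OF V, symmetric])
    also have "2 * ?r * (\<integral>\<^sup>+x. ennreal ((\<phi> (x + z) - \<phi> x)\<^sup>2) * indicator U x \<partial>lborel) + 2 * \<dots>
      \<le> 2 * ?r * (ennreal ((norm z)\<^sup>2) * dirichlet \<Omega> D\<phi>) + 2 * (C * dirichlet \<Omega> D\<phi>)"
      unfolding dirichlet_def
      by (intro add_mono mult_left_mono C1_shift_squared_le[OF C1 U \<Omega> sub] C(2)[OF C1, unfolded dirichlet_def]) auto
    finally show "(\<integral>\<^sup>+x. mean_gap \<rho> \<phi> x \<partial>leb U) \<le> (2 * ?r * ennreal ((norm z)\<^sup>2) + 2 * C) * dirichlet \<Omega> D\<phi>"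
      by (simp add: distrib_right mult.assoc)
  qed (use C(1) \<rho>.emeasure_finite in \<open>auto simp: ennreal_mult_eq_top_iff less_top[symmetric]\<close>)
qed

text \<open>By convexity the segment between two points of the ball stays in it, so
  \<open>C1_shift_squared_le\<close> applies to each difference vector \<open>z\<close>. Only
  \<open>norm z < 2 * r\<close> occurs, which gives the constant.\<close>

lemma linked_ball:
  fixes \<Omega> :: "'a::euclidean_space set"
  assumes \<Omega>: "open \<Omega>" and B: "ball c r \<subseteq> \<Omega>"
  shows "linked \<Omega> (leb (ball c r)) (leb (ball c r))"
proof (rule linkedI)
  let ?B = "ball c r" let ?Z = "ball (0::'a) (2 * r)"
  fix \<phi> :: "'a \<Rightarrow> real" and D\<phi> assume C1: "C1_with_gradient \<phi> D\<phi>"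
  have "?B \<in> sets borel" by simp
  note [measurable] = C1_with_gradientD(1)[OF C1] this
  let ?F = "\<lambda>x z. ennreal ((\<phi> (x + z) - \<phi> x)\<^sup>2) * (indicator ?B x * indicator ?B (x + z))"
  \<comment> \<open>The substitution \<open>y = x + z\<close> reduces the double integral to shifts by a fixed \<open>z\<close>.\<close>
  have gap: "mean_gap (leb ?B) \<phi> x * indicator ?B x = (\<integral>\<^sup>+z. ?F x z \<partial>lborel)" for x
  proof -
    have "mean_gap (leb ?B) \<phi> x * indicator ?B x = (\<integral>\<^sup>+y. ennreal ((\<phi> x - \<phi> y)\<^sup>2) * indicator ?B y \<partial>lborel) * indicator ?B x"
      by (simp add: mean_gap_def nn_integral_leb)
    also have "(\<integral>\<^sup>+y. ennreal ((\<phi> x - \<phi> y)\<^sup>2) * indicator ?B y \<partial>lborel)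
      = (\<integral>\<^sup>+z. ennreal ((\<phi> x - \<phi> (z + x))\<^sup>2) * indicator ?B (z + x) \<partial>lborel)"
      by (rule nn_integral_lborel_shift[symmetric]) measurable
    also have "\<dots> * indicator ?B x = (\<integral>\<^sup>+z. ?F x z \<partial>lborel)"
      by (subst nn_integral_multc[symmetric]) (auto simp: power2_commute add.commute mult_ac intro!: nn_integral_cong)
    finally show ?thesis .
  qed
  have F: "(\<lambda>(x, z). ?F x z) \<in> borel_measurable (lborel \<Otimes>\<^sub>M lborel)"
    by measurable
  have "(\<integral>\<^sup>+x. mean_gap (leb ?B) \<phi> x \<partial>leb ?B) = (\<integral>\<^sup>+x. (\<integral>\<^sup>+z. ?F x z \<partial>lborel) \<partial>lborel)"
    by (simp add: nn_integral_leb gap)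
  also have "\<dots> = (\<integral>\<^sup>+z. (\<integral>\<^sup>+x. ?F x z \<partial>lborel) \<partial>lborel)"
    by (rule lborel_pair.Fubini'[symmetric, OF F])
  also have "\<dots> \<le> (\<integral>\<^sup>+z. (ennreal ((2 * r)\<^sup>2) * dirichlet \<Omega> D\<phi>) * indicator ?Z z \<partial>lborel)"
  proof (rule nn_integral_mono)
    fix z
    define U where "U = {x \<in> ?B. x + z \<in> ?B}"
    have U: "U \<in> sets borel" unfolding U_def by measurable
    have "(\<integral>\<^sup>+x. ?F x z \<partial>lborel) = (\<integral>\<^sup>+x. ennreal ((\<phi> (x + z) - \<phi> x)\<^sup>2) * indicator U x \<partial>lborel)"
      by (intro nn_integral_cong) (auto simp: U_def indicator_def)
    also have "\<dots> \<le> (ennreal ((2 * r)\<^sup>2) * dirichlet \<Omega> D\<phi>) * indicator ?Z z"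
    proof (cases "U = {}")
      case False
      then obtain x where x: "x \<in> ?B" "x + z \<in> ?B" by (auto simp: U_def)
      have z: "norm z < 2 * r" using x norm_triangle_ineq4[of "c - x" "c - (x + z)"]
        by (simp add: dist_norm)
      have "(\<integral>\<^sup>+x. ennreal ((\<phi> (x + z) - \<phi> x)\<^sup>2) * indicator U x \<partial>lborel)
        \<le> ennreal ((norm z)\<^sup>2) * dirichlet \<Omega> D\<phi>"
        unfolding dirichlet_def
      proof (rule C1_shift_squared_le[OF C1 U \<Omega>])
        fix x and t :: real assume "x \<in> U" "0 < t" "t \<le> 1"
        then have "(1 - t) *\<^sub>R x + t *\<^sub>R (x + z) \<in> ?B"
          by (intro convexD_alt[OF convex_ball]) (auto simp: U_def)
        then show "x + t *\<^sub>R z \<in> \<Omega>" using B by (auto simp: algebra_simps)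
      qed
      also have "\<dots> \<le> ennreal ((2 * r)\<^sup>2) * dirichlet \<Omega> D\<phi>"
        using z by (intro mult_right_mono ennreal_leI power_mono) auto
      finally show ?thesis using z by simp
    qed simp
    finally show "(\<integral>\<^sup>+x. ?F x z \<partial>lborel) \<le> (ennreal ((2 * r)\<^sup>2) * dirichlet \<Omega> D\<phi>) * indicator ?Z z" .
  qed
  also have "\<dots> = (ennreal ((2 * r)\<^sup>2) * dirichlet \<Omega> D\<phi>) * emeasure lborel ?Z"
    by (rule nn_integral_cmult_indicator) simp
  finally show "(\<integral>\<^sup>+x. mean_gap (leb ?B) \<phi> x \<partial>leb ?B) \<le> (ennreal ((2 * r)\<^sup>2) * emeasure lborel ?Z) * dirichlet \<Omega> D\<phi>"
    by (simp add: mult_ac)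
next
  show "ennreal ((2 * r)\<^sup>2) * emeasure lborel (ball (0::'a) (2 * r)) < \<infinity>"
    using emeasure_bounded_finite[OF bounded_ball, of "0::'a" "2 * r"] by (simp add: ennreal_mult_less_top)
qed

text \<open>From a boundary point \<open>a\<close> one climbs to \<open>a + t e\<close>: the gap
  there and the energy along the way bound the gap at \<open>a\<close>. Averaging over the height
  \<open>t\<close> spreads a surface quantity over a tube, where \<open>nn_integral_tube_le\<close>
  compares it with volume integrals.\<close>

lemma linked_tube:
  fixes A :: "'a::euclidean_space set"
  assumes \<Omega>: "open \<Omega>" and e: "norm e = 1" and L: "L > 0" and h: "h > 0"
    and lip: "\<And>a b. a \<in> A \<Longrightarrow> b \<in> A \<Longrightarrow> dist a b \<le> L * dist (hproj e a) (hproj e b)"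
    and A: "A \<in> sets borel" "bounded A"
    and sub: "\<And>a t. a \<in> A \<Longrightarrow> 0 < t \<Longrightarrow> t \<le> h \<Longrightarrow> a + t *\<^sub>R e \<in> \<Omega>"
    and \<rho>: "embedded_finite_measure \<rho>" and l: "linked \<Omega> (leb \<Omega>) \<rho>"
  defines "\<sigma> \<equiv> restrict_space (hausdorff_measure (DIM('a) - 1)) A"
  shows "embedded_finite_measure \<sigma>" "linked \<Omega> \<sigma> \<rho>"
proof -
  show \<sigma>: "embedded_finite_measure \<sigma>"
    unfolding embedded_finite_measure_def
  proof
    show "finite_measure \<sigma>" unfolding \<sigma>_def by (rule nn_integral_tube_le(1)[OF e L h lip A])
    show "(\<lambda>x. x) \<in> borel_measurable \<sigma>" unfolding \<sigma>_def
      by (intro measurable_restrict_space1) (simp add: measurable_ident_sets)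
  qed
  interpret \<rho>: finite_measure \<rho> using \<rho> by (simp add: embedded_finite_measure_def)
  let ?r = "emeasure \<rho> (space \<rho>)"
  define T where "T = leb {0<..h}"
  have T: "embedded_finite_measure T" unfolding T_def by (intro embedded_finite_measure_leb) auto
  then interpret T: finite_measure T by (simp add: embedded_finite_measure_def)
  have T1: "emeasure T (space T) = ennreal h"
    using h by (simp add: T_def emeasure_restrict_space space_restrict_space)
  obtain K :: real where K: "\<And>f. f \<in> borel_measurable borel \<Longrightarrow>
      (\<integral>\<^sup>+a. (\<integral>\<^sup>+t. f (a + t *\<^sub>R e) \<partial>T) \<partial>\<sigma>) \<le> ennreal K * (\<integral>\<^sup>+x. f x \<partial>lborel)"
    using nn_integral_tube_le(2)[OF e L h lip A] unfolding \<sigma>_def T_def by blast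
  from l obtain C where C: "C < \<infinity>" "\<And>\<phi> D\<phi>. C1_with_gradient \<phi> D\<phi> \<Longrightarrow>
     (\<integral>\<^sup>+x. mean_gap \<rho> \<phi> x \<partial>leb \<Omega>) \<le> C * dirichlet \<Omega> D\<phi>" by (elim linkedE) blast
  have space: "space \<sigma> = A" by (simp add: \<sigma>_def space_restrict_space hausdorff_measure_def)
  have meas: "(\<lambda>a. (\<integral>\<^sup>+t. f (a + t *\<^sub>R e) \<partial>T)) \<in> borel_measurable \<sigma>"
    "\<And>a. (\<lambda>t. f (a + t *\<^sub>R e)) \<in> borel_measurable T"
    if f[measurable]: "f \<in> borel_measurable borel" for f :: "'a \<Rightarrow> ennreal"
  proof -
    have [measurable]: "(\<lambda>x. x) \<in> borel_measurable T" using T by (simp add: embedded_finite_measure_def)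
    have "(\<lambda>a. (\<integral>\<^sup>+t. f (a + t *\<^sub>R e) \<partial>T)) \<in> borel_measurable borel" by measurable
    then show "(\<lambda>a. (\<integral>\<^sup>+t. f (a + t *\<^sub>R e) \<partial>T)) \<in> borel_measurable \<sigma>"
      by (rule borel_measurable_embedded[OF \<sigma>])
    show "\<And>a. (\<lambda>t. f (a + t *\<^sub>R e)) \<in> borel_measurable T" by measurable
  qed
  show "linked \<Omega> \<sigma> \<rho>"
  proof (rule linkedI)
    fix \<phi> :: "'a \<Rightarrow> real" and D\<phi> assume C1: "C1_with_gradient \<phi> D\<phi>"
    note \<phi> = C1_with_gradientD(1,2)[OF C1]
    note F = borel_measurable_mean_squared_diff[OF \<rho> \<phi>(1)]
    define N where "N x = ennreal ((norm (D\<phi> x))\<^sup>2) * indicator \<Omega> x" for x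
    \<comment> \<open>Cut off to \<open>\<Omega>\<close> so that the tube estimate ends in exactly
      the integral that the link of \<open>leb \<Omega>\<close> controls; inside the tube the
      cut-off changes nothing.\<close>
    define G where "G x = mean_gap \<rho> \<phi> x * indicator \<Omega> x" for x
    have "\<Omega> \<in> sets borel" using \<Omega> by simp
    note [measurable] = \<phi> F this
    have N: "N \<in> borel_measurable borel" and G: "G \<in> borel_measurable borel"
      unfolding N_def G_def by measurable
    \<comment> \<open>The gap at \<open>a\<close> does not depend on the height, and
      \<open>T\<close> has mass \<open>h\<close>.\<close>
    have "ennreal h * (\<integral>\<^sup>+a. mean_gap \<rho> \<phi> a \<partial>\<sigma>) = (\<integral>\<^sup>+a. (\<integral>\<^sup>+t. mean_gap \<rho> \<phi> a \<partial>T) \<partial>\<sigma>)"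
      using borel_measurable_embedded[OF \<sigma> F] by (simp add: T1 nn_integral_multc nn_integral_cmult mult.commute)
    also have "\<dots> \<le> (\<integral>\<^sup>+a. (2 * ?r * ennreal h * ennreal h) * (\<integral>\<^sup>+s. N (a + s *\<^sub>R e) \<partial>T)
         + 2 * (\<integral>\<^sup>+t. G (a + t *\<^sub>R e) \<partial>T) \<partial>\<sigma>)"
    proof (rule nn_integral_mono)
      fix a assume "a \<in> space \<sigma>"
      then have a: "a \<in> A" by (simp add: space)
      have "(\<integral>\<^sup>+t. mean_gap \<rho> \<phi> a \<partial>T)
        \<le> (\<integral>\<^sup>+t. 2 * ?r * (ennreal h * (\<integral>\<^sup>+s. N (a + s *\<^sub>R e) \<partial>T)) + 2 * G (a + t *\<^sub>R e) \<partial>T)"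
      proof (rule nn_integral_mono)
        fix t assume "t \<in> space T"
        then have t: "0 < t" "t \<le> h" by (auto simp: T_def space_restrict_space)
        have "ennreal ((\<phi> (a + t *\<^sub>R e) - \<phi> a)\<^sup>2) \<le> ennreal (t * (norm e)\<^sup>2) *
          (\<integral>\<^sup>+s. ennreal ((norm (D\<phi> (a + s *\<^sub>R e)))\<^sup>2) * indicator {0<..t} s \<partial>lborel)"
          by (rule C1_line_squared_le[OF C1 t(1)])
        \<comment> \<open>Extending the segment to full height makes the bound independent of
          \<open>t\<close>.\<close>
        also have "\<dots> \<le> ennreal h * (\<integral>\<^sup>+s. N (a + s *\<^sub>R e) * indicator {0<..h} s \<partial>lborel)"
        proof (rule mult_mono[OF ennreal_leI nn_integral_mono])
          fix s
          show "ennreal ((norm (D\<phi> (a + s *\<^sub>R e)))\<^sup>2) * indicator {0<..t} s \<le> N (a + s *\<^sub>R e) * indicator {0<..h} s"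
            using sub[OF a, of s] t by (cases "s \<in> {0<..t}") (auto simp: N_def)
        qed (use t e in auto)
        also have "(\<integral>\<^sup>+s. N (a + s *\<^sub>R e) * indicator {0<..h} s \<partial>lborel) = (\<integral>\<^sup>+s. N (a + s *\<^sub>R e) \<partial>T)"
          unfolding T_def by (rule nn_integral_leb[symmetric]) simp
        finally have 1: "ennreal ((\<phi> (a + t *\<^sub>R e) - \<phi> a)\<^sup>2) \<le> ennreal h * (\<integral>\<^sup>+s. N (a + s *\<^sub>R e) \<partial>T)" .
        have 2: "mean_gap \<rho> \<phi> (a + t *\<^sub>R e) = G (a + t *\<^sub>R e)" using sub[OF a t] by (simp add: G_def)
        show "mean_gap \<rho> \<phi> a \<le> 2 * ?r * (ennreal h * (\<integral>\<^sup>+s. N (a + s *\<^sub>R e) \<partial>T)) + 2 * G (a + t *\<^sub>R e)"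
          unfolding 2[symmetric]
          by (rule order_trans[OF mean_gap_le[OF \<rho> \<phi>(1), of a "a + t *\<^sub>R e"]])
             (intro add_mono mult_left_mono 1 order_refl, auto)
      qed
      also have "\<dots> = (2 * ?r * ennreal h * ennreal h) * (\<integral>\<^sup>+s. N (a + s *\<^sub>R e) \<partial>T) + 2 * (\<integral>\<^sup>+t. G (a + t *\<^sub>R e) \<partial>T)"
        using meas(2)[OF G] by (simp add: nn_integral_add nn_integral_cmult T1 mult_ac)
      finally show "(\<integral>\<^sup>+t. mean_gap \<rho> \<phi> a \<partial>T) \<le> (2 * ?r * ennreal h * ennreal h) * (\<integral>\<^sup>+s. N (a + s *\<^sub>R e) \<partial>T)
         + 2 * (\<integral>\<^sup>+t. G (a + t *\<^sub>R e) \<partial>T)" .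
    qed
    also have "\<dots> = (2 * ?r * ennreal h * ennreal h) * (\<integral>\<^sup>+a. (\<integral>\<^sup>+s. N (a + s *\<^sub>R e) \<partial>T) \<partial>\<sigma>)
         + 2 * (\<integral>\<^sup>+a. (\<integral>\<^sup>+t. G (a + t *\<^sub>R e) \<partial>T) \<partial>\<sigma>)"
      using meas(1)[OF N] meas(1)[OF G] by (simp add: nn_integral_add nn_integral_cmult)
    also have "\<dots> \<le> (2 * ?r * ennreal h * ennreal h) * (ennreal K * dirichlet \<Omega> D\<phi>)
         + 2 * (ennreal K * (C * dirichlet \<Omega> D\<phi>))"
    proof (intro add_mono mult_left_mono)
      show "(\<integral>\<^sup>+a. (\<integral>\<^sup>+s. N (a + s *\<^sub>R e) \<partial>T) \<partial>\<sigma>) \<le> ennreal K * dirichlet \<Omega> D\<phi>"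
        using K[OF N] by (simp add: N_def dirichlet_def)
      have "(\<integral>\<^sup>+x. G x \<partial>lborel) = (\<integral>\<^sup>+x. mean_gap \<rho> \<phi> x \<partial>leb \<Omega>)"
        unfolding G_def using \<Omega> by (intro nn_integral_leb[symmetric]) simp
      then show "(\<integral>\<^sup>+a. (\<integral>\<^sup>+t. G (a + t *\<^sub>R e) \<partial>T) \<partial>\<sigma>) \<le> ennreal K * (C * dirichlet \<Omega> D\<phi>)"
        using C(2)[OF C1] by (intro order_trans[OF K[OF G]] mult_left_mono) auto
    qed auto
    finally have "ennreal h * (\<integral>\<^sup>+a. mean_gap \<rho> \<phi> a \<partial>\<sigma>)
      \<le> (2 * ?r * ennreal h * ennreal h * ennreal K + 2 * ennreal K * C) * dirichlet \<Omega> D\<phi>"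
      by (simp add: distrib_right mult.assoc)
    then have "ennreal (1 / h) * (ennreal h * (\<integral>\<^sup>+a. mean_gap \<rho> \<phi> a \<partial>\<sigma>))
      \<le> ennreal (1 / h) * ((2 * ?r * ennreal h * ennreal h * ennreal K + 2 * ennreal K * C) * dirichlet \<Omega> D\<phi>)"
      by (rule mult_left_mono) simp
    moreover have "ennreal (1 / h) * ennreal h = 1" using h by (simp add: ennreal_mult'[symmetric])
    ultimately show "(\<integral>\<^sup>+a. mean_gap \<rho> \<phi> a \<partial>\<sigma>)
      \<le> (ennreal (1 / h) * (2 * ?r * ennreal h * ennreal h * ennreal K + 2 * ennreal K * C)) * dirichlet \<Omega> D\<phi>"
      by (simp add: mult.assoc[symmetric])
  qed (use C(1) \<rho>.emeasure_finite in \<open>auto simp: ennreal_mult_eq_top_iff less_top[symmetric]\<close>)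
qed


section \<open>Boundary charts and chains of balls\<close>

text \<open>Extracts from the graph description what the links use: short upward segments stay in
  the domain, a ball of the same radius \<open>d\<close> fits above the patch, and the boundary
  piece is controlled by its projection. Afterwards the graph function is no longer
  mentioned.\<close>

lemma lipschitz_boundary_chart:
  fixes \<Omega> :: "'a::euclidean_space set"
  assumes lip: "lipschitz_boundary \<Omega>" and \<Omega>: "open \<Omega>" and x: "x \<in> frontier \<Omega>"
  obtains e L d h where "norm e = 1" "L > 0" "d > 0" "h > (0::real)"
    "\<And>y t. y \<in> \<Omega> \<inter> ball x d \<Longrightarrow> 0 < t \<Longrightarrow> t \<le> h \<Longrightarrow> y + t *\<^sub>R e \<in> \<Omega>"
    "\<And>a t. a \<in> frontier \<Omega> \<inter> ball x d \<Longrightarrow> 0 < t \<Longrightarrow> t \<le> h \<Longrightarrow> a + t *\<^sub>R e \<in> \<Omega>"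
    "ball (x + h *\<^sub>R e) d \<subseteq> \<Omega>"
    "\<And>a b. a \<in> frontier \<Omega> \<inter> ball x d \<Longrightarrow> b \<in> frontier \<Omega> \<inter> ball x d \<Longrightarrow>
      dist a b \<le> L * dist (hproj e a) (hproj e b)"
proof -
  obtain r e C \<gamma> where r: "r > 0" and e: "norm e = 1" and \<gamma>: "C-lipschitz_on {z. z \<bullet> e = 0} \<gamma>"
    and graph: "\<Omega> \<inter> ball x r = {y \<in> ball x r. \<gamma> (y - (y \<bullet> e) *\<^sub>R e) < y \<bullet> e}"
    using lip x unfolding lipschitz_boundary_def by blast
  have C: "C \<ge> 0" using \<gamma> by (rule lipschitz_on_nonneg)
  have ee: "e \<bullet> e = 1" using e by (simp add: norm_eq_1)
  have inner: "\<bar>y \<bullet> e - z \<bullet> e\<bar> \<le> dist y z" for y z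
    using Cauchy_Schwarz_ineq2[of "y - z" e] e by (simp add: inner_diff_left dist_norm)
  have \<gamma>d: "\<bar>\<gamma> (hproj e y) - \<gamma> (hproj e z)\<bar> \<le> C * dist (hproj e y) (hproj e z)" for y z
    using lipschitz_onD[OF \<gamma>, of "hproj e y" "hproj e z"] hproj_orthogonal[OF e] by (simp add: dist_real_def)
  have \<gamma>d': "\<bar>\<gamma> (hproj e y) - \<gamma> (hproj e z)\<bar> \<le> C * dist y z" for y z
    using \<gamma>d[of y z] mult_left_mono[OF dist_hproj_le[OF e, of y z] C] by linarith
  have in\<Omega>: "y \<in> \<Omega> \<longleftrightarrow> \<gamma> (hproj e y) < y \<bullet> e" if "y \<in> ball x r" for y
    using graph that unfolding hproj_def by blast
  \<comment> \<open>A frontier point is a limit of points strictly above the graph, hence not below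
    it, and it is not in the open set \<open>\<Omega>\<close>, hence not strictly above it.\<close>
  have bd: "\<gamma> (hproj e a) = a \<bullet> e" if a: "a \<in> frontier \<Omega>" "a \<in> ball x r" for a
  proof (rule antisym)
    show "\<gamma> (hproj e a) \<le> a \<bullet> e"
    proof (rule field_le_epsilon)
      fix \<epsilon> :: real assume \<epsilon>: "\<epsilon> > 0"
      \<comment> \<open>The first bound keeps the approximating point in the chart. The second
        absorbs both changes: at most \<open>C\<close> times the distance for the graph and once the
        distance for the height.\<close>
      define s where "s = min (r - dist x a) (\<epsilon> / (C + 1))"
      have s: "s > 0" using a(2) \<epsilon> C by (simp add: s_def)
      have "a \<in> closure \<Omega>" using a(1) by (simp add: frontier_def)
      then obtain y where y: "y \<in> \<Omega>" "dist y a < s" using s by (auto simp: closure_approachable)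
      have "dist x y \<le> dist x a + dist y a" using dist_triangle2[of x y a] by (simp add: dist_commute)
      then have "y \<in> ball x r" using y(2) by (simp add: s_def)
      then have "\<gamma> (hproj e y) < y \<bullet> e" using in\<Omega> y(1) by blast
      moreover have "(C + 1) * dist y a \<le> \<epsilon>"
      proof -
        have "(C + 1) * dist y a \<le> (C + 1) * (\<epsilon> / (C + 1))"
          using y(2) C by (intro mult_left_mono) (auto simp: s_def)
        then show ?thesis using C by simp
      qed
      ultimately show "\<gamma> (hproj e a) \<le> a \<bullet> e + \<epsilon>"
        using \<gamma>d'[of y a] inner[of y a] by (simp add: distrib_right)
    qed
    have "a \<notin> \<Omega>" using a(1) \<Omega> by (simp add: frontier_def interior_open)
    then show "a \<bullet> e \<le> \<gamma> (hproj e a)" using in\<Omega>[OF a(2)] by simp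
  qed
  \<comment> \<open>The choice gives \<open>d + h = r\<close>, so segments starting in
    \<open>ball x d\<close> remain in the chart, and \<open>h - d = C * d\<close>, the largest rise
    of the graph over a distance \<open>d\<close>.\<close>
  define d where "d = r / (C + 2)" define h where "h = (C + 1) * d"
  have "(C + 2) * d = r" using C by (simp add: d_def)
  moreover have "d > 0" using r C by (simp add: d_def)
  ultimately have d: "d > 0" "h > 0" "d + h = r" using C by (simp_all add: h_def algebra_simps add_pos_nonneg)
  have near: "y + t *\<^sub>R e \<in> ball x r" if "y \<in> ball x d" "0 < t" "t \<le> h" for y t
  proof -
    have "dist x (y + t *\<^sub>R e) \<le> dist x y + dist y (y + t *\<^sub>R e)" by (rule dist_triangle)
    also have "dist y (y + t *\<^sub>R e) = t" using e that by (simp add: dist_norm)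
    finally show ?thesis using that d by simp
  qed
  have sub: "ball x d \<subseteq> ball x r" using d by auto
  show ?thesis
  proof (rule that[OF e _ d(1,2)])
    show "y + t *\<^sub>R e \<in> \<Omega>" if "y \<in> \<Omega> \<inter> ball x d" "0 < t" "t \<le> h" for y t
      using in\<Omega>[OF near[of y t]] in\<Omega>[of y] that sub ee by (auto simp: hproj_shift[OF e] inner_add_left)
    show "a + t *\<^sub>R e \<in> \<Omega>" if "a \<in> frontier \<Omega> \<inter> ball x d" "0 < t" "t \<le> h" for a t
      using in\<Omega>[OF near[of a t]] bd[of a] that sub ee by (auto simp: hproj_shift[OF e] inner_add_left)
    \<comment> \<open>A point \<open>w\<close> of the lifted ball is higher than \<open>x\<close> by
      more than \<open>h - d = C * d\<close>, while the graph below it has risen by at most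
      \<open>C * d\<close>.\<close>
    show "ball (x + h *\<^sub>R e) d \<subseteq> \<Omega>"
    proof
      fix w assume w: "w \<in> ball (x + h *\<^sub>R e) d"
      have "dist x w \<le> dist x (x + h *\<^sub>R e) + dist (x + h *\<^sub>R e) w" by (rule dist_triangle)
      then have wr: "w \<in> ball x r" using w e d by (simp add: dist_norm)
      have "dist (x + h *\<^sub>R e) w < d" using w by simp
      then have "\<gamma> (hproj e w) \<le> \<gamma> (hproj e x) + C * d"
        using \<gamma>d'[of "x + h *\<^sub>R e" w] mult_left_mono[of "dist (x + h *\<^sub>R e) w" d C] C
        by (simp add: hproj_shift[OF e])
      also have "\<gamma> (hproj e x) = x \<bullet> e" using bd[OF x] r by simp
      also have "x \<bullet> e + C * d < w \<bullet> e"
        using inner[of "x + h *\<^sub>R e" w] \<open>dist (x + h *\<^sub>R e) w < d\<close> ee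
        by (simp add: h_def inner_add_left distrib_right)
      finally show "w \<in> \<Omega>" using in\<Omega>[OF wr] by simp
    qed
    show "dist a b \<le> (C + 1) * dist (hproj e a) (hproj e b)"
      if "a \<in> frontier \<Omega> \<inter> ball x d" "b \<in> frontier \<Omega> \<inter> ball x d" for a b
    proof -
      have "a - b = (hproj e a - hproj e b) + (a \<bullet> e - b \<bullet> e) *\<^sub>R e" by (simp add: hproj_def algebra_simps)
      then have "dist a b \<le> dist (hproj e a) (hproj e b) + \<bar>a \<bullet> e - b \<bullet> e\<bar>"
        unfolding dist_norm using norm_triangle_ineq[of "hproj e a - hproj e b" "(a \<bullet> e - b \<bullet> e) *\<^sub>R e"] e by simp
      moreover have "\<bar>a \<bullet> e - b \<bullet> e\<bar> \<le> C * dist (hproj e a) (hproj e b)"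
      proof -
        have "\<gamma> (hproj e a) = a \<bullet> e" "\<gamma> (hproj e b) = b \<bullet> e" using bd that sub by blast+
        then show ?thesis using \<gamma>d[of a b] by simp
      qed
      ultimately show ?thesis by (simp add: distrib_right)
    qed
  qed (use C in auto)
qed

lemma linked_leb_mono:
  assumes "U \<in> sets borel" "V \<in> sets borel" "U \<subseteq> V" "embedded_finite_measure \<rho>" "linked \<Omega> (leb V) \<rho>"
  shows "linked \<Omega> (leb U) \<rho>"
  using linked_cover[of "{()}" "\<lambda>_. V" U lborel \<rho> \<Omega>] assms by simp

lemma emeasure_leb_ball_pos: "r > 0 \<Longrightarrow> emeasure (leb (ball c r)) (space (leb (ball c r))) > 0"
  using content_ball_pos[of r c]
  by (auto simp: emeasure_restrict_space space_restrict_space zero_less_iff_neq_zero measure_def)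

text \<open>Choosing one radius per point turns linkage of balls into an equivalence relation on the
  points of \<open>\<Omega>\<close>. Nearby points are equivalent, so connectedness makes all points
  equivalent.\<close>

lemma linked_balls:
  fixes \<Omega> :: "'a::euclidean_space set"
  assumes \<Omega>: "open \<Omega>" "connected \<Omega>"
    and a: "r > 0" "ball a r \<subseteq> \<Omega>" and b: "s > 0" "ball b s \<subseteq> \<Omega>"
  shows "linked \<Omega> (leb (ball a r)) (leb (ball b s))"
proof -
  have emb: "embedded_finite_measure (leb (ball x t))" for x :: 'a and t
    by (intro embedded_finite_measure_leb) auto
  have common: "linked \<Omega> (leb (ball x t)) (leb (ball y t'))"
    if "linked \<Omega> (leb (ball x t)) (leb (ball z t''))" "linked \<Omega> (leb (ball y t')) (leb (ball z t''))" "t'' > 0"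
    for x y z t t' t''
    by (rule linked_common[OF emb emb emb emeasure_leb_ball_pos[OF that(3)] that(1,2)])
  have sym: "linked \<Omega> (leb (ball x t)) (leb (ball y t'))"
    if "linked \<Omega> (leb (ball y t')) (leb (ball x t))" "t > 0" "ball x t \<subseteq> \<Omega>" for x y t t'
    by (rule common[OF linked_ball[OF \<Omega>(1) that(3)] that(1,2)])
  have sub: "linked \<Omega> (leb (ball x t)) (leb (ball y t'))"
    if "ball x t \<subseteq> ball y t'" "ball y t' \<subseteq> \<Omega>" for x y t t'
    by (rule linked_leb_mono[OF _ _ that(1) emb linked_ball[OF \<Omega>(1) that(2)]]) auto
  \<comment> \<open>A small ball around \<open>y\<close> inside both balls is linked to each of them
    and has positive mass, so it can act as the middle measure.\<close>
  have meet: "linked \<Omega> (leb (ball x t)) (leb (ball y t'))"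
    if xy: "y \<in> ball x t" and t: "t' > 0" "ball x t \<subseteq> \<Omega>" "ball y t' \<subseteq> \<Omega>" for x y t t'
  proof -
    have "open (ball x t \<inter> ball y t')" "y \<in> ball x t \<inter> ball y t'" using xy t by auto
    then obtain q where q: "q > 0" "ball y q \<subseteq> ball x t \<inter> ball y t'" using open_contains_ball by metis
    have yq: "ball y q \<subseteq> ball x t" "ball y q \<subseteq> ball y t'" using q(2) by auto
    have 1: "linked \<Omega> (leb (ball y q)) (leb (ball x t))" by (rule sub[OF yq(1) t(2)])
    have 2: "linked \<Omega> (leb (ball y q)) (leb (ball y t'))" by (rule sub[OF yq(2) t(3)])
    have "linked \<Omega> (leb (ball x t)) (leb (ball y q))"
      by (rule sym[OF 1]) (use xy t in \<open>auto intro: le_less_trans[OF zero_le_dist]\<close>)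
    moreover have "linked \<Omega> (leb (ball y t')) (leb (ball y q))" by (rule sym[OF 2 t(1,3)])
    ultimately show ?thesis using q(1) by (rule common)
  qed
  have "\<exists>t>0. ball x t \<subseteq> \<Omega>" if "x \<in> \<Omega>" for x
    using \<Omega>(1) that by (simp add: open_contains_ball)
  then obtain t where t: "\<And>x. x \<in> \<Omega> \<Longrightarrow> t x > 0" "\<And>x. x \<in> \<Omega> \<Longrightarrow> ball x (t x) \<subseteq> \<Omega>"
    by metis
  have ab: "a \<in> \<Omega>" "b \<in> \<Omega>" using a b by auto
  have tt: "linked \<Omega> (leb (ball a (t a))) (leb (ball b (t b)))"
  proof (rule connected_equivalence_relation[OF \<Omega>(2) ab, where R = "\<lambda>x y. linked \<Omega> (leb (ball x (t x))) (leb (ball y (t y)))"])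
    fix x y z assume xy: "linked \<Omega> (leb (ball x (t x))) (leb (ball y (t y)))" "x \<in> \<Omega>" "y \<in> \<Omega>"
    show yx: "linked \<Omega> (leb (ball y (t y))) (leb (ball x (t x)))" by (rule sym[OF xy(1) t[OF xy(3)]])
    assume yz: "linked \<Omega> (leb (ball y (t y))) (leb (ball z (t z)))" and z: "z \<in> \<Omega>"
    have "linked \<Omega> (leb (ball z (t z))) (leb (ball y (t y)))" by (rule sym[OF yz t[OF z]])
    then show "linked \<Omega> (leb (ball x (t x))) (leb (ball z (t z)))" using common[OF xy(1) _ t(1)[OF xy(3)]] by blast
  next
    fix x assume x: "x \<in> \<Omega>"
    show "\<exists>T. openin (top_of_set \<Omega>) T \<and> x \<in> T \<and> (\<forall>y\<in>T. linked \<Omega> (leb (ball x (t x))) (leb (ball y (t y))))"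
    proof (intro exI[of _ "ball x (t x)"] conjI ballI)
      show "openin (top_of_set \<Omega>) (ball x (t x))" using t(2)[OF x] by (simp add: openin_open_eq \<Omega>(1))
      fix y assume y: "y \<in> ball x (t x)"
      then have "y \<in> \<Omega>" using t(2)[OF x] by blast
      then show "linked \<Omega> (leb (ball x (t x))) (leb (ball y (t y)))" by (intro meet y t x)
    qed (use t x in simp)
  qed
  \<comment> \<open>Replaces the given radii by the chosen ones: the two balls around the same
    centre meet.\<close>
  have ar: "linked \<Omega> (leb (ball a r)) (leb (ball a (t a)))" and bs: "linked \<Omega> (leb (ball b s)) (leb (ball b (t b)))"
    using meet[of a a r "t a"] meet[of b b s "t b"] a b t ab by auto
  have "linked \<Omega> (leb (ball a r)) (leb (ball b (t b)))"
    by (rule common[OF ar sym[OF tt t[OF ab(2)]] t(1)[OF ab(1)]])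
  then show ?thesis by (rule common[OF _ bs t(1)[OF ab(2)]])
qed

text \<open>\<open>linked_cover\<close> requires all pieces to be linked to one measure, so a single
  reference ball is fixed for the volume part. Boundary patches can then use
  \<open>leb \<Omega>\<close> as their common target.\<close>

theorem linked_lipschitz_domain:
  fixes \<Omega> :: "'a::euclidean_space set"
  assumes bdd: "bounded \<Omega>" and con: "connected \<Omega>" and opn: "open \<Omega>" and lip: "lipschitz_boundary \<Omega>"
    and ne: "\<Omega> \<noteq> {}"
  shows "linked \<Omega> (leb \<Omega>) (leb \<Omega>)"
    and "embedded_finite_measure (surface_measure \<Omega>)"
    and "linked \<Omega> (surface_measure \<Omega>) (leb \<Omega>)"
proof -
  let ?H = "hausdorff_measure (DIM('a) - 1) :: 'a measure"
  have emb: "embedded_finite_measure (leb \<Omega>)" using bdd opn by (intro embedded_finite_measure_leb) auto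
  have embb: "embedded_finite_measure (leb (ball x t))" for x :: 'a and t
    by (intro embedded_finite_measure_leb) auto
  obtain p where "p \<in> \<Omega>" using ne by blast
  then obtain s where s: "s > 0" "ball p s \<subseteq> \<Omega>" using opn by (meson open_contains_ball)
  let ?\<rho> = "leb (ball p s)"
  have "\<forall>x\<in>closure \<Omega>. \<exists>d. d > 0 \<and> linked \<Omega> (leb (\<Omega> \<inter> ball x d)) ?\<rho>"
  proof
    fix x assume x: "x \<in> closure \<Omega>"
    show "\<exists>d. d > 0 \<and> linked \<Omega> (leb (\<Omega> \<inter> ball x d)) ?\<rho>"
    proof (cases "x \<in> \<Omega>")
      case True
      then obtain d where d: "d > 0" "ball x d \<subseteq> \<Omega>" using opn by (meson open_contains_ball)
      then show ?thesis using linked_balls[OF opn con d s] by (auto simp: inf.absorb2)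
    next
      case False
      then have "x \<in> frontier \<Omega>" using x opn by (simp add: frontier_def interior_open)
      then obtain e L d h where e: "norm e = 1" and d: "d > 0" and h: "h > (0::real)"
        and up: "\<And>y t. y \<in> \<Omega> \<inter> ball x d \<Longrightarrow> 0 < t \<Longrightarrow> t \<le> h \<Longrightarrow> y + t *\<^sub>R e \<in> \<Omega>"
        and B: "ball (x + h *\<^sub>R e) d \<subseteq> \<Omega>"
        using lipschitz_boundary_chart[OF lip opn, of x] by metis
      have "linked \<Omega> (leb (\<Omega> \<inter> ball x d)) ?\<rho>"
      \<comment> \<open>The shift by \<open>h e\<close> carries the boundary patch into the interior
        ball above it, which is chained to the reference ball.\<close>
      proof (rule linked_shift[OF opn _ _ _ _ embb linked_balls[OF opn con d B s]])
        fix y assume y: "y \<in> \<Omega> \<inter> ball x d"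
        show "y + t *\<^sub>R (h *\<^sub>R e) \<in> \<Omega>" if "0 < t" "t \<le> 1" for t
          using up[OF y, of "t * h"] that h by (simp add: mult_left_le_one_le)
        show "y + h *\<^sub>R e \<in> ball (x + h *\<^sub>R e) d" using y by (simp add: dist_norm)
      qed (use opn in auto)
      then show ?thesis using d by blast
    qed
  qed
  from bchoice[OF this] obtain d where d: "\<And>x. x \<in> closure \<Omega> \<Longrightarrow> d x > 0"
    "\<And>x. x \<in> closure \<Omega> \<Longrightarrow> linked \<Omega> (leb (\<Omega> \<inter> ball x (d x))) ?\<rho>" by blast
  have "compact (closure \<Omega>)" using bdd by simp
  then obtain I where I: "I \<subseteq> closure \<Omega>" "finite I" "closure \<Omega> \<subseteq> (\<Union>x\<in>I. ball x (d x))"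
    using d(1) by (elim compactE_image[where C = "closure \<Omega>" and f = "\<lambda>x. ball x (d x)"]) force+
  have 0: "linked \<Omega> (leb \<Omega>) ?\<rho>"
  proof (rule linked_cover[OF I(2), where U = "\<lambda>x. \<Omega> \<inter> ball x (d x)"])
    have "\<Omega> \<subseteq> (\<Union>x\<in>I. ball x (d x))" by (rule order_trans[OF closure_subset I(3)])
    then show "\<Omega> \<subseteq> (\<Union>x\<in>I. \<Omega> \<inter> ball x (d x))" by auto
  qed (use opn I d embb in auto)
  show 1: "linked \<Omega> (leb \<Omega>) (leb \<Omega>)"
    by (rule linked_common[OF emb emb embb emeasure_leb_ball_pos[OF s(1)] 0 0])
  have "\<forall>x\<in>frontier \<Omega>. \<exists>d. d > 0 \<and> embedded_finite_measure (restrict_space ?H (frontier \<Omega> \<inter> ball x d)) \<and>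
    linked \<Omega> (restrict_space ?H (frontier \<Omega> \<inter> ball x d)) (leb \<Omega>)"
  proof
    fix x assume x: "x \<in> frontier \<Omega>"
    obtain e L d h where e: "norm e = 1" and L: "L > 0" and d: "d > 0" and h: "h > (0::real)"
      and up: "\<And>a t. a \<in> frontier \<Omega> \<inter> ball x d \<Longrightarrow> 0 < t \<Longrightarrow> t \<le> h \<Longrightarrow> a + t *\<^sub>R e \<in> \<Omega>"
      and L': "\<And>a b. a \<in> frontier \<Omega> \<inter> ball x d \<Longrightarrow> b \<in> frontier \<Omega> \<inter> ball x d \<Longrightarrow>
        dist a b \<le> L * dist (hproj e a) (hproj e b)"
      using lipschitz_boundary_chart[OF lip opn x] by metis
    have A: "frontier \<Omega> \<inter> ball x d \<in> sets borel" "bounded (frontier \<Omega> \<inter> ball x d)"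
      by (auto intro: bounded_subset[OF bounded_ball])
    show "\<exists>d. d > 0 \<and> embedded_finite_measure (restrict_space ?H (frontier \<Omega> \<inter> ball x d)) \<and>
      linked \<Omega> (restrict_space ?H (frontier \<Omega> \<inter> ball x d)) (leb \<Omega>)"
      using d linked_tube[OF opn e L h L' A up emb 1] by blast
  qed
  from bchoice[OF this] obtain d where d: "\<And>x. x \<in> frontier \<Omega> \<Longrightarrow> d x > 0"
    "\<And>x. x \<in> frontier \<Omega> \<Longrightarrow> embedded_finite_measure (restrict_space ?H (frontier \<Omega> \<inter> ball x (d x)))"
    "\<And>x. x \<in> frontier \<Omega> \<Longrightarrow> linked \<Omega> (restrict_space ?H (frontier \<Omega> \<inter> ball x (d x))) (leb \<Omega>)" by blast
  have "compact (frontier \<Omega>)" using bdd by (rule compact_frontier_bounded)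
  then obtain I where I: "I \<subseteq> frontier \<Omega>" "finite I" "frontier \<Omega> \<subseteq> (\<Union>x\<in>I. ball x (d x))"
    using d(1) by (elim compactE_image[where C = "frontier \<Omega>" and f = "\<lambda>x. ball x (d x)"]) force+
  show "linked \<Omega> (surface_measure \<Omega>) (leb \<Omega>)"
    unfolding surface_measure_def
  proof (rule linked_cover[OF I(2), where U = "\<lambda>x. frontier \<Omega> \<inter> ball x (d x)"])
    show "frontier \<Omega> \<subseteq> (\<Union>x\<in>I. frontier \<Omega> \<inter> ball x (d x))" using I(3) by auto
  qed (use I d emb in auto)
  show "embedded_finite_measure (surface_measure \<Omega>)"
    unfolding embedded_finite_measure_def
  proof
    show "(\<lambda>x. x) \<in> borel_measurable (surface_measure \<Omega>)" unfolding surface_measure_def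
      by (intro measurable_restrict_space1) (simp add: measurable_ident_sets)
    have fin: "emeasure ?H (frontier \<Omega> \<inter> ball x (d x)) < \<infinity>" if "x \<in> frontier \<Omega>" for x
    proof -
      interpret finite_measure "restrict_space ?H (frontier \<Omega> \<inter> ball x (d x))"
        using d(2)[OF that] by (simp add: embedded_finite_measure_def)
      show ?thesis using emeasure_finite[of "frontier \<Omega> \<inter> ball x (d x)"]
        by (simp add: emeasure_restrict_space less_top)
    qed
    have "(\<Union>x\<in>I. frontier \<Omega> \<inter> ball x (d x)) \<in> sets borel"
      using I(2) by (intro sets.finite_UN) auto
    then have "emeasure ?H (frontier \<Omega>) \<le> emeasure ?H (\<Union>x\<in>I. frontier \<Omega> \<inter> ball x (d x))"
      using I(3) by (intro emeasure_mono) auto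
    also have "\<dots> \<le> (\<Sum>x\<in>I. emeasure ?H (frontier \<Omega> \<inter> ball x (d x)))"
      using I(2) by (intro emeasure_subadditive_finite) auto
    also have "\<dots> < \<infinity>" using fin I by (auto simp: less_top[symmetric])
    finally show "finite_measure (surface_measure \<Omega>)"
      unfolding surface_measure_def
      by (intro finite_measureI) (simp add: emeasure_restrict_space space_restrict_space hausdorff_measure_def less_top)
  qed
qed


section \<open>Square integrable functions\<close>

text \<open>The squared L2 norm, with values in \<open>ennreal\<close> so that estimates and limits
  make sense before integrability is known. Keeping the square avoids roots, at the cost of a factor
  2 in the triangle inequality.\<close>

definition sqnorm :: "'a measure \<Rightarrow> ('a \<Rightarrow> 'b::euclidean_space) \<Rightarrow> ennreal" where
  "sqnorm M f = (\<integral>\<^sup>+x. ennreal ((norm (f x))\<^sup>2) \<partial>M)"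

lemma square_integrable_iff_sqnorm:
  "square_integrable M f \<longleftrightarrow> f \<in> borel_measurable M \<and> sqnorm M f < \<infinity>"
  unfolding square_integrable_def sqnorm_def by (auto simp: integrable_iff_bounded)

lemma L2_tendsto_sqnorm: "L2_tendsto M f g \<longleftrightarrow> (\<lambda>k. sqnorm M (\<lambda>x. f k x - g x)) \<longlonglongrightarrow> 0"
  by (simp add: L2_tendsto_def sqnorm_def)

lemma sqnorm_eq_integral:
  "square_integrable M f \<Longrightarrow> sqnorm M f = ennreal (\<integral>x. (norm (f x))\<^sup>2 \<partial>M)"
  unfolding square_integrable_def sqnorm_def by (intro nn_integral_eq_integral) auto

lemma sqnorm_cong_AE: "AE x in M. f x = g x \<Longrightarrow> sqnorm M f = sqnorm M g"
  unfolding sqnorm_def by (rule nn_integral_cong_AE) auto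

lemma sqnorm_diff_commute: "sqnorm M (\<lambda>x. f x - g x) = sqnorm M (\<lambda>x. g x - f x)"
  by (simp add: sqnorm_def norm_minus_commute)

lemma sqnorm_scaleR: "f \<in> borel_measurable M \<Longrightarrow> sqnorm M (\<lambda>x. c *\<^sub>R f x) = ennreal (c\<^sup>2) * sqnorm M f"
  unfolding sqnorm_def by (simp add: power_mult_distrib ennreal_mult' nn_integral_cmult)

lemma sqnorm_add_le:
  assumes [measurable]: "f \<in> borel_measurable M" "g \<in> borel_measurable M"
  shows "sqnorm M (\<lambda>x. f x + g x) \<le> 2 * sqnorm M f + 2 * sqnorm M g"
proof -
  have "sqnorm M (\<lambda>x. f x + g x) \<le> (\<integral>\<^sup>+x. 2 * ennreal ((norm (f x))\<^sup>2) + 2 * ennreal ((norm (g x))\<^sup>2) \<partial>M)"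
    unfolding sqnorm_def by (intro nn_integral_mono ennreal_norm_add_squared_le)
  also have "\<dots> = 2 * sqnorm M f + 2 * sqnorm M g"
    unfolding sqnorm_def by (simp add: nn_integral_add nn_integral_cmult)
  finally show ?thesis .
qed

lemma sqnorm_triangle:
  assumes "f \<in> borel_measurable M" "g \<in> borel_measurable M" "h \<in> borel_measurable M"
  shows "sqnorm M (\<lambda>x. f x - h x) \<le> 2 * sqnorm M (\<lambda>x. f x - g x) + 2 * sqnorm M (\<lambda>x. g x - h x)"
  using sqnorm_add_le[of "\<lambda>x. f x - g x" M "\<lambda>x. g x - h x"] assms by simp

lemma square_integrable_lincomb:
  assumes "square_integrable M f" "square_integrable M g"
  shows "square_integrable M (\<lambda>x. a *\<^sub>R f x + b *\<^sub>R g x)"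
proof -
  have m [measurable]: "f \<in> borel_measurable M" "g \<in> borel_measurable M"
    and fin: "sqnorm M f < \<infinity>" "sqnorm M g < \<infinity>"
    using assms by (auto simp: square_integrable_iff_sqnorm)
  have "sqnorm M (\<lambda>x. a *\<^sub>R f x + b *\<^sub>R g x) \<le> 2 * (ennreal (a\<^sup>2) * sqnorm M f) + 2 * (ennreal (b\<^sup>2) * sqnorm M g)"
    using sqnorm_add_le[of "\<lambda>x. a *\<^sub>R f x" M "\<lambda>x. b *\<^sub>R g x"] by (simp add: sqnorm_scaleR)
  also have "\<dots> < \<infinity>" using fin by (auto simp: ennreal_mult_eq_top_iff less_top[symmetric])
  finally show ?thesis by (simp add: square_integrable_iff_sqnorm)
qed

lemma square_integrable_diff:
  "square_integrable M f \<Longrightarrow> square_integrable M g \<Longrightarrow> square_integrable M (\<lambda>x. f x - g x)"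
  using square_integrable_lincomb[of M f g 1 "-1"] by simp

lemma (in finite_measure) square_integrable_imp_integrable:
  assumes "square_integrable M f"
  shows "integrable M f"
proof (rule Bochner_Integration.integrable_bound)
  show "integrable M (\<lambda>x. 1 + (norm (f x))\<^sup>2)"
    using assms by (auto simp: square_integrable_def)
  have "norm (f x) \<le> 1 + (norm (f x))\<^sup>2" for x
    using sum_squares_bound[of 1 "norm (f x)"] norm_ge_zero[of "f x"]
    unfolding power_one mult_1_right by linarith
  then show "AE x in M. norm (f x) \<le> norm (1 + (norm (f x))\<^sup>2)" by simp
qed (use assms in \<open>simp add: square_integrable_def\<close>)

lemma integrable_norm_mult_square_integrable:
  assumes "square_integrable M f" "square_integrable M g"
  shows "integrable M (\<lambda>x. norm (f x) * norm (g x))"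
proof -
  have [measurable]: "f \<in> borel_measurable M" "g \<in> borel_measurable M"
    using assms by (auto simp: square_integrable_def)
  have i: "integrable M (\<lambda>x. (norm (f x))\<^sup>2 + (norm (g x))\<^sup>2)"
    using assms by (auto simp: square_integrable_def)
  have "norm (f x) * norm (g x) \<le> (norm (f x))\<^sup>2 + (norm (g x))\<^sup>2" for x
    using sum_squares_bound[of "norm (f x)" "norm (g x)"] mult_nonneg_nonneg[OF norm_ge_zero norm_ge_zero, of "f x" "g x"]
    unfolding mult.assoc by linarith
  then show ?thesis
    by (intro Bochner_Integration.integrable_bound[OF i]) (auto simp: abs_of_nonneg)
qed

lemma integrable_inner_square_integrable:
  assumes "square_integrable M f" "square_integrable M g"
  shows "integrable M (\<lambda>x. f x \<bullet> g x)"
  using assms by (intro Bochner_Integration.integrable_bound[OF integrable_norm_mult_square_integrable[OF assms]])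
    (auto simp: Cauchy_Schwarz_ineq2 square_integrable_def)

lemma integrable_scaleR_square_integrable:
  assumes "square_integrable M f" "square_integrable M g"
  shows "integrable M (\<lambda>x. f x *\<^sub>R g x)"
  using assms by (intro Bochner_Integration.integrable_bound[OF integrable_norm_mult_square_integrable[OF assms]])
    (auto simp: square_integrable_def)

lemma norm_integral_scaleR_squared_le:
  assumes "square_integrable M f" "square_integrable M g"
  shows "ennreal ((norm (\<integral>x. f x *\<^sub>R g x \<partial>M))\<^sup>2) \<le> sqnorm M f * sqnorm M g"
proof -
  have [measurable]: "f \<in> borel_measurable M" "g \<in> borel_measurable M"
    using assms by (auto simp: square_integrable_def)
  have "ennreal (norm (\<integral>x. f x *\<^sub>R g x \<partial>M)) \<le> (\<integral>\<^sup>+x. ennreal (norm (f x)) * ennreal (norm (g x)) \<partial>M)"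
    using integral_norm_bound_ennreal[OF integrable_scaleR_square_integrable[OF assms]]
    by (simp add: ennreal_mult')
  then have "(ennreal (norm (\<integral>x. f x *\<^sub>R g x \<partial>M)))\<^sup>2 \<le> (\<integral>\<^sup>+x. ennreal (norm (f x)) * ennreal (norm (g x)) \<partial>M)\<^sup>2"
    by (rule power_mono) simp
  also have "\<dots> \<le> (\<integral>\<^sup>+x. ennreal (norm (f x)) ^ 2 \<partial>M) * (\<integral>\<^sup>+x. ennreal (norm (g x)) ^ 2 \<partial>M)"
    by (rule Cauchy_Schwarz_nn_integral) measurable
  finally show ?thesis by (simp add: sqnorm_def ennreal_power)
qed

lemma tendsto_if_norm_squared_le:
  fixes X :: "nat \<Rightarrow> 'b::real_normed_vector"
  assumes le: "\<And>k. ennreal ((norm (X k - x))\<^sup>2) \<le> C * e k" and C: "C < \<infinity>" and e: "e \<longlonglongrightarrow> 0"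
  shows "X \<longlonglongrightarrow> x"
proof (rule LIMSEQ_I)
  fix r :: real assume r: "r > 0"
  have "(\<lambda>k. C * e k) \<longlonglongrightarrow> 0" using ennreal_tendsto_cmult[OF _ e, of C] C by simp
  then have "\<forall>\<^sub>F k in sequentially. C * e k < ennreal (r\<^sup>2)"
    using r by (intro order_tendstoD) auto
  then obtain N where N: "\<And>k. k \<ge> N \<Longrightarrow> C * e k < ennreal (r\<^sup>2)" by (auto simp: eventually_sequentially)
  have "norm (X k - x) < r" if "k \<ge> N" for k
  proof -
    have "ennreal ((norm (X k - x))\<^sup>2) < ennreal (r\<^sup>2)" using le[of k] N[OF that] by (rule le_less_trans)
    then have "(norm (X k - x))\<^sup>2 < r\<^sup>2" by (simp add: ennreal_less_iff)
    then show ?thesis using r by (simp add: power2_less_imp_less)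
  qed
  then show "\<exists>N. \<forall>k\<ge>N. norm (X k - x) < r" by blast
qed

text \<open>In the identity defining weak gradients the varying function is the scalar factor on one
  side and the vector factor on the other; hence this version and its mirror image.\<close>

lemma L2_tendsto_integral_scaleR:
  assumes f: "\<And>k. square_integrable M (f k)" "square_integrable M g" and h: "square_integrable M h"
    and lim: "L2_tendsto M f g"
  shows "(\<lambda>k. \<integral>x. f k x *\<^sub>R h x \<partial>M) \<longlonglongrightarrow> (\<integral>x. g x *\<^sub>R h x \<partial>M)"
proof (rule tendsto_if_norm_squared_le)
  show "ennreal ((norm ((\<integral>x. f k x *\<^sub>R h x \<partial>M) - (\<integral>x. g x *\<^sub>R h x \<partial>M)))\<^sup>2)
    \<le> sqnorm M h * sqnorm M (\<lambda>x. f k x - g x)" for k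
  proof -
    have "(\<integral>x. f k x *\<^sub>R h x \<partial>M) - (\<integral>x. g x *\<^sub>R h x \<partial>M) = (\<integral>x. (f k x - g x) *\<^sub>R h x \<partial>M)"
      unfolding scaleR_diff_left
      by (intro Bochner_Integration.integral_diff[symmetric] integrable_scaleR_square_integrable f h)
    then show ?thesis
      using norm_integral_scaleR_squared_le[OF square_integrable_diff[OF f(1)[of k] f(2)] h]
      by (simp add: mult.commute)
  qed
qed (use h lim in \<open>auto simp: square_integrable_iff_sqnorm L2_tendsto_sqnorm\<close>)

lemma L2_tendsto_integral_scaleR':
  assumes f: "\<And>k. square_integrable M (f k)" "square_integrable M g" and h: "square_integrable M h"
    and lim: "L2_tendsto M f g"
  shows "(\<lambda>k. \<integral>x. h x *\<^sub>R f k x \<partial>M) \<longlonglongrightarrow> (\<integral>x. h x *\<^sub>R g x \<partial>M)"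
proof (rule tendsto_if_norm_squared_le)
  show "ennreal ((norm ((\<integral>x. h x *\<^sub>R f k x \<partial>M) - (\<integral>x. h x *\<^sub>R g x \<partial>M)))\<^sup>2)
    \<le> sqnorm M h * sqnorm M (\<lambda>x. f k x - g x)" for k
  proof -
    have "(\<integral>x. h x *\<^sub>R f k x \<partial>M) - (\<integral>x. h x *\<^sub>R g x \<partial>M) = (\<integral>x. h x *\<^sub>R (f k x - g x) \<partial>M)"
      unfolding scaleR_diff_right
      by (intro Bochner_Integration.integral_diff[symmetric] integrable_scaleR_square_integrable f h)
    then show ?thesis
      using norm_integral_scaleR_squared_le[OF h square_integrable_diff[OF f(1)[of k] f(2)]] by simp
  qed
qed (use h lim in \<open>auto simp: square_integrable_iff_sqnorm L2_tendsto_sqnorm\<close>)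

lemma tendsto_0_le_ennreal:
  fixes f :: "nat \<Rightarrow> ennreal"
  assumes "\<And>k. f k \<le> u k" "u \<longlonglongrightarrow> 0"
  shows "f \<longlonglongrightarrow> 0"
  using assms by (intro tendsto_sandwich[of "\<lambda>_. 0" f sequentially u]) auto

lemma L2_tendsto_lincomb:
  assumes [measurable]: "\<And>k. f k \<in> borel_measurable M" "f' \<in> borel_measurable M"
    "\<And>k. g k \<in> borel_measurable M" "g' \<in> borel_measurable M"
    and lim: "L2_tendsto M f f'" "L2_tendsto M g g'"
  shows "L2_tendsto M (\<lambda>k x. a *\<^sub>R f k x + b *\<^sub>R g k x) (\<lambda>x. a *\<^sub>R f' x + b *\<^sub>R g' x)"
  unfolding L2_tendsto_sqnorm
proof (rule tendsto_0_le_ennreal)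
  let ?u = "\<lambda>k. 2 * (ennreal (a\<^sup>2) * sqnorm M (\<lambda>x. f k x - f' x)) + 2 * (ennreal (b\<^sup>2) * sqnorm M (\<lambda>x. g k x - g' x))"
  have "?u \<longlonglongrightarrow> 2 * (ennreal (a\<^sup>2) * 0) + 2 * (ennreal (b\<^sup>2) * 0)"
    using lim unfolding L2_tendsto_sqnorm by (intro tendsto_add ennreal_tendsto_cmult) auto
  then show "?u \<longlonglongrightarrow> 0" by simp
  show "sqnorm M (\<lambda>x. a *\<^sub>R f k x + b *\<^sub>R g k x - (a *\<^sub>R f' x + b *\<^sub>R g' x)) \<le> ?u k" for k
  proof -
    have "(\<lambda>x. a *\<^sub>R f k x + b *\<^sub>R g k x - (a *\<^sub>R f' x + b *\<^sub>R g' x))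
      = (\<lambda>x. a *\<^sub>R (f k x - f' x) + b *\<^sub>R (g k x - g' x))" by (simp add: algebra_simps)
    then show ?thesis
      using sqnorm_add_le[of "\<lambda>x. a *\<^sub>R (f k x - f' x)" M "\<lambda>x. b *\<^sub>R (g k x - g' x)"]
      by (simp add: sqnorm_scaleR)
  qed
qed

lemma L2_tendsto_trans:
  assumes [measurable]: "\<And>k. f k \<in> borel_measurable M" "\<And>k. g k \<in> borel_measurable M" "h \<in> borel_measurable M"
    and fg: "(\<lambda>k. sqnorm M (\<lambda>x. f k x - g k x)) \<longlonglongrightarrow> 0" and gh: "L2_tendsto M g h"
  shows "L2_tendsto M f h"
  unfolding L2_tendsto_sqnorm
proof (rule tendsto_0_le_ennreal)
  let ?u = "\<lambda>k. 2 * sqnorm M (\<lambda>x. f k x - g k x) + 2 * sqnorm M (\<lambda>x. g k x - h x)"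
  have "?u \<longlonglongrightarrow> 2 * 0 + 2 * 0"
    using fg gh unfolding L2_tendsto_sqnorm by (intro tendsto_add ennreal_tendsto_cmult) auto
  then show "?u \<longlonglongrightarrow> 0" by simp
  show "sqnorm M (\<lambda>x. f k x - h x) \<le> ?u k" for k
    by (intro sqnorm_triangle) measurable
qed

lemma L2_tendsto_square_integrable:
  assumes f: "\<And>k. square_integrable M (f k)" and g: "g \<in> borel_measurable M" and lim: "L2_tendsto M f g"
  shows "square_integrable M g"
proof -
  have "\<forall>\<^sub>F k in sequentially. sqnorm M (\<lambda>x. f k x - g x) < 1"
    using lim unfolding L2_tendsto_sqnorm by (rule order_tendstoD) simp
  then obtain k where k: "sqnorm M (\<lambda>x. f k x - g x) < 1" by (auto simp: eventually_sequentially)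
  have fk: "f k \<in> borel_measurable M" "sqnorm M (f k) < \<infinity>" using f[of k] by (auto simp: square_integrable_iff_sqnorm)
  have "sqnorm M (\<lambda>x. f k x - g x) < \<infinity>" using k by (rule less_trans) simp
  then have "square_integrable M (\<lambda>x. f k x - g x)" using fk g by (simp add: square_integrable_iff_sqnorm)
  from square_integrable_diff[OF f[of k] this] show ?thesis by simp
qed

text \<open>On a finite measure space L2-Cauchy implies L1-Cauchy, which provides a subsequence
  converging almost everywhere. Fatou's lemma along it brings the limit back into the L2 estimates
  of the full sequence.\<close>

lemma (in finite_measure) L2_complete:
  fixes f :: "nat \<Rightarrow> 'a \<Rightarrow> 'b::euclidean_space"
  assumes f: "\<And>k. square_integrable M (f k)"
    and cauchy: "\<And>e::real. e > 0 \<Longrightarrow> \<exists>N. \<forall>i\<ge>N. \<forall>j\<ge>N. sqnorm M (\<lambda>x. f i x - f j x) \<le> ennreal e"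
  obtains g where "square_integrable M g" "L2_tendsto M f g"
proof -
  have [measurable]: "f k \<in> borel_measurable M" for k using f by (simp add: square_integrable_def)
  let ?m = "measure M (space M)"
  have "\<exists>N. \<forall>i\<ge>N. \<forall>j\<ge>N. (\<integral>x. norm (f i x - f j x) \<partial>M) < e" if e: "e > 0" for e
  proof -
    define d where "d = e / 2"
    have d: "d > 0" using e by (simp add: d_def)
    \<comment> \<open>The summand 1 allows a measure space of total mass 0.\<close>
    have pos: "?m + 1 > 0" by (simp add: add_nonneg_pos)
    obtain N where N: "\<And>i j. i \<ge> N \<Longrightarrow> j \<ge> N \<Longrightarrow> sqnorm M (\<lambda>x. f i x - f j x) \<le> ennreal (d\<^sup>2 / (?m + 1))"
      using cauchy[of "d\<^sup>2 / (?m + 1)"] d pos by auto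
    have "(\<integral>x. norm (f i x - f j x) \<partial>M) < e" if ij: "i \<ge> N" "j \<ge> N" for i j
    proof -
      have 1: "square_integrable M (\<lambda>_. 1 :: real)" by (simp add: square_integrable_def)
      have 2: "square_integrable M (\<lambda>x. norm (f i x - f j x))"
        using square_integrable_diff[OF f[of i] f[of j]] by (simp add: square_integrable_def)
      have "ennreal ((norm (\<integral>x. 1 *\<^sub>R norm (f i x - f j x) \<partial>M))\<^sup>2)
        \<le> sqnorm M (\<lambda>_. 1 :: real) * sqnorm M (\<lambda>x. norm (f i x - f j x))"
        by (rule norm_integral_scaleR_squared_le[OF 1 2])
      also have "sqnorm M (\<lambda>_. 1 :: real) = ennreal ?m" by (simp add: sqnorm_def emeasure_eq_measure)
      also have "sqnorm M (\<lambda>x. norm (f i x - f j x)) = sqnorm M (\<lambda>x. f i x - f j x)" by (simp add: sqnorm_def)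
      also have "ennreal ?m * \<dots> \<le> ennreal ?m * ennreal (d\<^sup>2 / (?m + 1))" by (intro mult_left_mono N ij) simp
      also have "\<dots> = ennreal (?m * (d\<^sup>2 / (?m + 1)))" by (rule ennreal_mult'[symmetric]) simp
      also have "\<dots> \<le> ennreal (d\<^sup>2)" using pos by (intro ennreal_leI) (simp add: field_simps)
      finally have "(\<integral>x. norm (f i x - f j x) \<partial>M)\<^sup>2 \<le> d\<^sup>2" by simp
      then have "(\<integral>x. norm (f i x - f j x) \<partial>M) \<le> d"
        by (rule power2_le_imp_le) (use d in simp)
      then show ?thesis using e unfolding d_def by linarith
    qed
    then show ?thesis by (intro exI[of _ N] allI impI)
  qed
  from cauchy_L1_AE_cauchy_subseq[OF square_integrable_imp_integrable[OF f] this]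
  obtain r where r: "strict_mono r" "AE x in M. Cauchy (\<lambda>i. f (r i) x)" .
  define g where "g x = lim (\<lambda>i. f (r i) x)" for x
  have g [measurable]: "g \<in> borel_measurable M" unfolding g_def by measurable
  have lim: "AE x in M. (\<lambda>i. f (r i) x) \<longlonglongrightarrow> g x"
    using r(2) by eventually_elim (simp add: g_def Cauchy_convergent_iff convergent_LIMSEQ_iff)
  \<comment> \<open>Fatou in the second index: \<open>f (r n)\<close> tends to \<open>g\<close>
    almost everywhere while \<open>f i\<close> is held fixed.\<close>
  have close: "sqnorm M (\<lambda>x. f i x - g x) \<le> ennreal e"
    if N: "\<And>i j. i \<ge> N \<Longrightarrow> j \<ge> N \<Longrightarrow> sqnorm M (\<lambda>x. f i x - f j x) \<le> ennreal e" and i: "i \<ge> N" for i N e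
  proof -
    have "sqnorm M (\<lambda>x. f i x - g x) = (\<integral>\<^sup>+x. liminf (\<lambda>n. ennreal ((norm (f i x - f (r n) x))\<^sup>2)) \<partial>M)"
      unfolding sqnorm_def
    proof (rule nn_integral_cong_AE)
      show "AE x in M. ennreal ((norm (f i x - g x))\<^sup>2) = liminf (\<lambda>n. ennreal ((norm (f i x - f (r n) x))\<^sup>2))"
        using lim
      proof eventually_elim
        case (elim x)
        have "(\<lambda>n. ennreal ((norm (f i x - f (r n) x))\<^sup>2)) \<longlonglongrightarrow> ennreal ((norm (f i x - g x))\<^sup>2)"
          by (intro tendsto_ennrealI tendsto_intros elim)
        then show ?case by (intro lim_imp_Liminf[symmetric]) simp_all
      qed
    qed
    also have "\<dots> \<le> liminf (\<lambda>n. sqnorm M (\<lambda>x. f i x - f (r n) x))"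
      unfolding sqnorm_def by (rule nn_integral_liminf) measurable
    also have "\<dots> \<le> liminf (\<lambda>n. ennreal e)"
    proof (rule Liminf_mono)
      have "sqnorm M (\<lambda>x. f i x - f (r n) x) \<le> ennreal e" if "n \<ge> N" for n
        using N[OF i, of "r n"] that seq_suble[OF r(1), of n] by simp
      then show "\<forall>\<^sub>F n in sequentially. sqnorm M (\<lambda>x. f i x - f (r n) x) \<le> ennreal e"
        by (auto simp: eventually_sequentially)
    qed
    finally show ?thesis by (simp add: Liminf_const)
  qed
  have "L2_tendsto M f g"
    unfolding L2_tendsto_sqnorm
  proof (rule order_tendstoI)
    fix a :: ennreal assume "0 < a"
    then obtain z where "0 < z" "z < a" using dense by blast
    then obtain e where e: "e > 0" "ennreal e < a" by (cases z) (auto simp: ennreal_less_iff)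
    then show "\<forall>\<^sub>F k in sequentially. sqnorm M (\<lambda>x. f k x - g x) < a"
      using cauchy[OF e(1)] close[of _ e] e(2) unfolding eventually_sequentially
      by (blast intro: le_less_trans)
  qed simp
  then show ?thesis using that L2_tendsto_square_integrable[of M f g, OF f g] by blast
qed


section \<open>Weak gradients and traces\<close>

lemma has_real_derivative_max_0_squared:
  "((\<lambda>s. (max 0 s)\<^sup>2) has_real_derivative 2 * max 0 s) (at (s::real))"
proof -
  consider "s > 0" | "s < 0" | "s = 0" by linarith
  then show ?thesis
  proof cases
    case 1
    have "((\<lambda>s. s\<^sup>2) has_real_derivative 2 * max 0 s) (at s)"
      using 1 by (auto intro!: derivative_eq_intros)
    then show ?thesis
      by (rule DERIV_cong_ev[OF refl _ refl, THEN iffD2, rotated])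
         (use 1 in \<open>auto intro!: eventually_mono[OF eventually_nhds_in_open[of "{0<..}"]]\<close>)
  next
    case 2
    have "((\<lambda>s. 0) has_real_derivative 2 * max 0 s) (at s)"
      using 2 by (auto intro!: derivative_eq_intros)
    then show ?thesis
      by (rule DERIV_cong_ev[OF refl _ refl, THEN iffD2, rotated])
         (use 2 in \<open>auto intro!: eventually_mono[OF eventually_nhds_in_open[of "{..<0}"]]\<close>)
  next
    case 3
    have "((\<lambda>h. (max 0 h)\<^sup>2 / h) \<longlongrightarrow> 0) (at (0::real))"
    proof (rule Lim_null_comparison)
      have "norm ((max 0 h)\<^sup>2 / h) \<le> \<bar>h\<bar>" for h :: real
        by (auto simp: max_def power2_eq_square)
      then show "\<forall>\<^sub>F h in at 0. norm ((max 0 h)\<^sup>2 / h) \<le> \<bar>h\<bar>" by simp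
      show "((\<lambda>h. \<bar>h\<bar>) \<longlongrightarrow> 0) (at (0::real))" by (rule tendsto_rabs_zero) simp
    qed
    then show ?thesis using 3 by (simp add: DERIV_def)
  qed
qed

text \<open>For a pair of centre and radius, the square of the positive part of a quadratic
  polynomial. The square makes it continuously differentiable, which is the regularity asked of test
  functions.\<close>

definition ball_bump :: "'a::euclidean_space \<times> real \<Rightarrow> 'a \<Rightarrow> real" where
  "ball_bump b x = (max 0 ((snd b)\<^sup>2 - (x - fst b) \<bullet> (x - fst b)))\<^sup>2"

lemma ball_bump_nonneg: "ball_bump b x \<ge> 0"
  by (simp add: ball_bump_def)

lemma ball_bump_pos_iff: "snd b > 0 \<Longrightarrow> ball_bump b x > 0 \<longleftrightarrow> x \<in> ball (fst b) (snd b)"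
proof -
  assume "snd b > 0"
  have "ball_bump b x > 0 \<longleftrightarrow> (norm (x - fst b))\<^sup>2 < (snd b)\<^sup>2"
    by (auto simp: ball_bump_def power2_norm_eq_inner max_def)
  also have "\<dots> \<longleftrightarrow> norm (x - fst b) < snd b"
    using \<open>snd b > 0\<close> by (auto intro: power2_less_imp_less power_strict_mono)
  finally show ?thesis by (simp add: dist_norm norm_minus_commute)
qed

lemma C1_ball_bump:
  "C1_with_gradient (ball_bump b) (\<lambda>x. (- 4 * max 0 ((snd b)\<^sup>2 - (x - fst b) \<bullet> (x - fst b))) *\<^sub>R (x - fst b))"
  unfolding C1_with_gradient_def
proof
  show "\<forall>x. GDERIV (ball_bump b) x :> (- 4 * max 0 ((snd b)\<^sup>2 - (x - fst b) \<bullet> (x - fst b))) *\<^sub>R (x - fst b)"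
  proof
    fix x
    have 1: "GDERIV (\<lambda>x. (snd b)\<^sup>2 - (x - fst b) \<bullet> (x - fst b)) x :> - 2 *\<^sub>R (x - fst b)"
      unfolding gderiv_def
      by (auto intro!: derivative_eq_intros simp: inner_commute algebra_simps)
    show "GDERIV (ball_bump b) x :> (- 4 * max 0 ((snd b)\<^sup>2 - (x - fst b) \<bullet> (x - fst b))) *\<^sub>R (x - fst b)"
      unfolding ball_bump_def[abs_def]
      using GDERIV_DERIV_compose[OF 1 has_real_derivative_max_0_squared] by (simp add: algebra_simps)
  qed
  show "continuous_on UNIV (\<lambda>x. (- 4 * max 0 ((snd b)\<^sup>2 - (x - fst b) \<bullet> (x - fst b))) *\<^sub>R (x - fst b))"
    by (intro continuous_intros)
qed

lemma C1_with_gradient_lincomb: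
  assumes "C1_with_gradient \<phi> D\<phi>" "C1_with_gradient \<psi> D\<psi>"
  shows "C1_with_gradient (\<lambda>x. a * \<phi> x + b * \<psi> x) (\<lambda>x. a *\<^sub>R D\<phi> x + b *\<^sub>R D\<psi> x)"
  unfolding C1_with_gradient_def
proof (intro conjI allI)
  fix x
  have "GDERIV \<phi> x :> D\<phi> x" "GDERIV \<psi> x :> D\<psi> x" using assms by (auto simp: C1_with_gradient_def)
  then show "GDERIV (\<lambda>x. a * \<phi> x + b * \<psi> x) x :> a *\<^sub>R D\<phi> x + b *\<^sub>R D\<psi> x"
    unfolding gderiv_def by (auto intro!: derivative_eq_intros simp: inner_add_right)
qed (use assms in \<open>auto simp: C1_with_gradient_def intro!: continuous_intros\<close>)

lemma C1_with_gradient_sum: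
  assumes "finite I" "\<And>i. i \<in> I \<Longrightarrow> C1_with_gradient (\<phi> i) (D\<phi> i)"
  shows "C1_with_gradient (\<lambda>x. \<Sum>i\<in>I. \<phi> i x) (\<lambda>x. \<Sum>i\<in>I. D\<phi> i x)"
  using assms
proof (induction I rule: finite_induct)
  case empty
  show ?case by (simp add: C1_with_gradient_def GDERIV_const)
next
  case (insert i I)
  then show ?case using C1_with_gradient_lincomb[of "\<phi> i" "D\<phi> i" "\<lambda>x. \<Sum>i\<in>I. \<phi> i x" "\<lambda>x. \<Sum>i\<in>I. D\<phi> i x" 1 1] by simp
qed

text \<open>As \<open>d\<close> tends to 0 these quotients increase to the indicator of
  \<open>{x. \<phi> x > 0}\<close>; they are bounded by 1 and vanish exactly where
  \<open>\<phi>\<close> does.\<close>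

lemma C1_with_gradient_saturate:
  assumes \<phi>: "C1_with_gradient \<phi> D\<phi>" "\<And>x. \<phi> x \<ge> 0" and d: "d > 0"
  shows "C1_with_gradient (\<lambda>x. \<phi> x / (d + \<phi> x)) (\<lambda>x. (d / (d + \<phi> x)\<^sup>2) *\<^sub>R D\<phi> x)"
  unfolding C1_with_gradient_def
proof (intro conjI allI)
  fix x
  have pos: "d + \<phi> x > 0" using \<phi>(2)[of x] d by simp
  have 1: "GDERIV \<phi> x :> D\<phi> x" using \<phi> by (auto simp: C1_with_gradient_def)
  have 2: "((\<lambda>s. s / (d + s)) has_real_derivative d / (d + \<phi> x)\<^sup>2) (at (\<phi> x))"
    using pos by (auto intro!: derivative_eq_intros simp: field_simps power2_eq_square)
  show "GDERIV (\<lambda>x. \<phi> x / (d + \<phi> x)) x :> (d / (d + \<phi> x)\<^sup>2) *\<^sub>R D\<phi> x"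
    by (rule GDERIV_DERIV_compose[OF 1 2])
next
  have "d + \<phi> x \<noteq> 0" for x using \<phi>(2)[of x] d by simp
  then show "continuous_on UNIV (\<lambda>x. (d / (d + \<phi> x)\<^sup>2) *\<^sub>R D\<phi> x)"
    using C1_with_gradientD(3,4)[OF \<phi>(1)] by (intro continuous_intros) auto
qed

lemma finite_measure_lebesgue_on_bounded:
  "open \<Omega> \<Longrightarrow> bounded \<Omega> \<Longrightarrow> finite_measure (lebesgue_on (\<Omega> :: 'a::euclidean_space set))"
  by (intro finite_measure_lebesgue_on bounded_set_imp_lmeasurable) (auto simp: borel_open)

text \<open>No mollifiers are used. Dominated convergence passes from saturated bumps to indicators
  of finite unions of balls, then of open sets, and then of measurable sets up to null sets; a
  function with zero integral over every measurable set vanishes almost everywhere.\<close>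

lemma AE_0_if_C1_tests_0:
  fixes G :: "'a::euclidean_space \<Rightarrow> 'a"
  assumes \<Omega>: "open \<Omega>" "bounded \<Omega>" and G: "integrable (lebesgue_on \<Omega>) G"
    and test: "\<And>\<phi> D\<phi>. C1_with_gradient \<phi> D\<phi> \<Longrightarrow> compact_support_in \<Omega> \<phi> \<Longrightarrow>
      (\<integral>x. \<phi> x *\<^sub>R G x \<partial>lebesgue_on \<Omega>) = 0"
  shows "AE x in lebesgue_on \<Omega>. G x = 0"
proof -
  let ?M = "lebesgue_on \<Omega>"
  interpret finite_measure ?M by (rule finite_measure_lebesgue_on_bounded[OF \<Omega>])
  have \<Omega>s: "\<Omega> \<in> sets lebesgue" using \<Omega> by (simp add: borel_open)
  have space: "space ?M = \<Omega>" by (simp add: space_restrict_space)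
  have meas: "S \<in> sets lebesgue \<Longrightarrow> S \<inter> \<Omega> \<in> sets ?M" for S
    using \<Omega>s by (simp add: sets_restrict_space_iff)
  have ind: "S \<in> sets lebesgue \<Longrightarrow> (indicator S :: 'a \<Rightarrow> real) \<in> borel_measurable ?M" for S
    by (intro measurable_restrict_space1 borel_measurable_indicator)
  have opl: "open S \<Longrightarrow> S \<in> sets lebesgue" for S :: "'a set" by (simp add: borel_open)
  have [measurable]: "G \<in> borel_measurable ?M" using G by simp
  have nG: "integrable ?M (\<lambda>x. norm (G x))" using G by simp
  have balls: "(\<integral>x. indicator (\<Union>b\<in>I. ball (fst b) (snd b)) x *\<^sub>R G x \<partial>?M) = 0"
    if I: "finite I" "\<And>b. b \<in> I \<Longrightarrow> snd b > 0 \<and> cball (fst b) (snd b) \<subseteq> \<Omega>" for I :: "('a \<times> real) set"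
  proof -
    define S where "S x = (\<Sum>b\<in>I. ball_bump b x)" for x
    have S0: "S x \<ge> 0" for x unfolding S_def by (intro sum_nonneg ball_bump_nonneg)
    have S: "S x > 0 \<longleftrightarrow> x \<in> (\<Union>b\<in>I. ball (fst b) (snd b))" for x
    proof -
      have "S x = 0 \<longleftrightarrow> (\<forall>b\<in>I. ball_bump b x = 0)"
        unfolding S_def using I(1) by (intro sum_nonneg_eq_0_iff ball_bump_nonneg)
      then have "S x > 0 \<longleftrightarrow> (\<exists>b\<in>I. ball_bump b x > 0)"
        using S0[of x] ball_bump_nonneg[of _ x] by (auto simp: less_le)
      also have "\<dots> \<longleftrightarrow> (\<exists>b\<in>I. x \<in> ball (fst b) (snd b))"
        using I(2) by (intro bex_cong refl ball_bump_pos_iff) auto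
      finally show ?thesis by simp
    qed
    obtain DS where C1: "C1_with_gradient S DS"
      unfolding S_def using C1_with_gradient_sum[OF I(1), of ball_bump, OF C1_ball_bump] by blast
    have S_meas [measurable]: "S \<in> borel_measurable ?M"
      using C1_with_gradientD(1)[OF C1] by (intro measurable_restrict_space1 measurable_completion) simp
    \<comment> \<open>\<open>\<psi> n\<close> is a bounded sequence of test functions converging to the indicator of the union.\<close>
    define \<psi> where "\<psi> n x = S x / (1 / real (Suc n) + S x)" for n x
    have \<psi>: "C1_with_gradient (\<psi> n) (\<lambda>x. (1 / real (Suc n) / (1 / real (Suc n) + S x)\<^sup>2) *\<^sub>R DS x)" for n
      unfolding \<psi>_def by (rule C1_with_gradient_saturate[OF C1 S0]) simp
    have "compact_support_in \<Omega> (\<psi> n)" for n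
    proof -
      have "closed (\<Union>b\<in>I. cball (fst b) (snd b))" "bounded (\<Union>b\<in>I. cball (fst b) (snd b))"
        using I(1) by auto
      moreover have "{x. \<psi> n x \<noteq> 0} \<subseteq> (\<Union>b\<in>I. cball (fst b) (snd b))"
      proof
        fix x assume "x \<in> {x. \<psi> n x \<noteq> 0}"
        then have "S x \<noteq> 0" by (auto simp: \<psi>_def)
        then have "x \<in> (\<Union>b\<in>I. ball (fst b) (snd b))" using S[of x] S0[of x] by simp
        then show "x \<in> (\<Union>b\<in>I. cball (fst b) (snd b))" using ball_subset_cball by fast
      qed
      ultimately have "closure {x. \<psi> n x \<noteq> 0} \<subseteq> (\<Union>b\<in>I. cball (fst b) (snd b))" "bounded {x. \<psi> n x \<noteq> 0}"
        using closure_minimal bounded_subset by metis+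
      moreover have "(\<Union>b\<in>I. cball (fst b) (snd b)) \<subseteq> \<Omega>" using I(2) by auto
      ultimately show ?thesis unfolding compact_support_in_def compact_closure by blast
    qed
    then have 0: "(\<integral>x. \<psi> n x *\<^sub>R G x \<partial>?M) = 0" for n by (rule test[OF \<psi>])
    have "(\<lambda>n. \<integral>x. \<psi> n x *\<^sub>R G x \<partial>?M) \<longlonglongrightarrow> (\<integral>x. indicator (\<Union>b\<in>I. ball (fst b) (snd b)) x *\<^sub>R G x \<partial>?M)"
    proof (rule integral_dominated_convergence[OF _ _ nG])
      show "(\<lambda>x. indicator (\<Union>b\<in>I. ball (fst b) (snd b)) x *\<^sub>R G x) \<in> borel_measurable ?M"
        by (intro borel_measurable_scaleR ind opl) auto
      show "(\<lambda>x. \<psi> n x *\<^sub>R G x) \<in> borel_measurable ?M" for n unfolding \<psi>_def by measurable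
      have "(\<lambda>n. \<psi> n x) \<longlonglongrightarrow> indicator (\<Union>b\<in>I. ball (fst b) (snd b)) x" for x
      proof (cases "S x > 0")
        case True
        have "(\<lambda>n. S x / (1 / real (Suc n) + S x)) \<longlonglongrightarrow> S x / (0 + S x)"
          by (intro tendsto_intros LIMSEQ_Suc lim_1_over_n) (use True in auto)
        then show ?thesis using True S[of x] by (simp add: \<psi>_def)
      next
        case False
        then show ?thesis using S[of x] S0[of x] by (simp add: \<psi>_def)
      qed
      then show "AE x in ?M. (\<lambda>n. \<psi> n x *\<^sub>R G x) \<longlonglongrightarrow> indicator (\<Union>b\<in>I. ball (fst b) (snd b)) x *\<^sub>R G x"
        by (intro AE_I2 tendsto_scaleR tendsto_const)
      have "\<bar>\<psi> n x\<bar> \<le> 1" for n x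
      proof -
        have "1 / real (Suc n) + S x > 0" using S0[of x] by (simp add: add_pos_nonneg)
        then show ?thesis using S0[of x] unfolding \<psi>_def by (subst abs_of_nonneg) (auto simp: divide_le_eq simp del: of_nat_Suc)
      qed
      then show "AE x in ?M. norm (\<psi> n x *\<^sub>R G x) \<le> norm (G x)" for n
        by (intro AE_I2) (simp add: mult_left_le_one_le)
    qed
    then show ?thesis using 0 LIMSEQ_unique[OF _ tendsto_const] by simp
  qed
  have opn: "(\<integral>x. indicator U x *\<^sub>R G x \<partial>?M) = 0" if U: "open U" "U \<subseteq> \<Omega>" for U
  proof -
    \<comment> \<open>Requiring the closed balls to lie in \<open>U\<close> gives finite sums of
      bumps compact support inside \<open>\<Omega>\<close>.\<close>
    define \<B> where "\<B> = {b. snd b > 0 \<and> cball (fst b) (snd b) \<subseteq> U}"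
    have "(\<Union>b\<in>\<B>. ball (fst b) (snd b)) = U"
    proof
      show "(\<Union>b\<in>\<B>. ball (fst b) (snd b)) \<subseteq> U" using ball_subset_cball by (fastforce simp: \<B>_def)
      show "U \<subseteq> (\<Union>b\<in>\<B>. ball (fst b) (snd b))"
      proof
        fix x assume "x \<in> U"
        then obtain e where "e > 0" "cball x e \<subseteq> U" using U(1) open_contains_cball by blast
        then have "(x, e) \<in> \<B>" "x \<in> ball (fst (x, e)) (snd (x, e))" by (auto simp: \<B>_def)
        then show "x \<in> (\<Union>b\<in>\<B>. ball (fst b) (snd b))" by blast
      qed
    qed
    moreover obtain F where F: "F \<subseteq> (\<lambda>b. ball (fst b) (snd b)) ` \<B>" "countable F" "\<Union>F = (\<Union>b\<in>\<B>. ball (fst b) (snd b))"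
      using Lindelof[of "(\<lambda>b. ball (fst b) (snd b)) ` \<B>"] by auto
    moreover obtain \<C> where \<C>: "\<C> \<subseteq> \<B>" "countable \<C>" "F = (\<lambda>b. ball (fst b) (snd b)) ` \<C>"
      using countable_subset_image[THEN iffD1, OF conjI[OF F(2,1)]] by auto
    ultimately have UC: "U = (\<Union>b\<in>\<C>. ball (fst b) (snd b))" by simp
    define I where "I n = {b\<in>\<C>. to_nat_on \<C> b < n}" for n
    have fin: "finite (I n)" for n
    proof (rule finite_imageD)
      show "finite (to_nat_on \<C> ` I n)" by (rule finite_subset[of _ "{..<n}"]) (auto simp: I_def)
      show "inj_on (to_nat_on \<C>) (I n)" by (rule inj_on_subset[OF inj_on_to_nat_on[OF \<C>(2)]]) (auto simp: I_def)
    qed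
    let ?V = "\<lambda>n. \<Union>b\<in>I n. ball (fst b) (snd b)"
    have 0: "(\<integral>x. indicator (?V n) x *\<^sub>R G x \<partial>?M) = 0" for n
      by (rule balls[OF fin]) (use \<C>(1) U(2) in \<open>auto simp: I_def \<B>_def\<close>)
    have "(\<lambda>n. \<integral>x. indicator (?V n) x *\<^sub>R G x \<partial>?M) \<longlonglongrightarrow> (\<integral>x. indicator U x *\<^sub>R G x \<partial>?M)"
    proof (rule integral_dominated_convergence[OF _ _ nG])
      show "(\<lambda>x. indicator U x *\<^sub>R G x) \<in> borel_measurable ?M"
        using U by (intro borel_measurable_scaleR ind opl) auto
      show "(\<lambda>x. indicator (?V n) x *\<^sub>R G x) \<in> borel_measurable ?M" for n
        by (intro borel_measurable_scaleR ind opl) auto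
      have "(\<lambda>n. indicator (?V n) x :: real) \<longlonglongrightarrow> indicator U x" for x
      proof (cases "x \<in> U")
        case True
        then obtain b where b: "b \<in> \<C>" "x \<in> ball (fst b) (snd b)" using UC by blast
        have "x \<in> ?V n" if "n > to_nat_on \<C> b" for n
        proof -
          have "b \<in> I n" using b that by (simp add: I_def)
          then show ?thesis using b(2) by blast
        qed
        then have "\<forall>\<^sub>F n in sequentially. indicator (?V n) x = (1 :: real)"
          by (intro eventually_mono[OF eventually_gt_at_top[of "to_nat_on \<C> b"]]) (simp add: indicator_def)
        then show ?thesis using True by (simp add: tendsto_eventually)
      next
        case False
        then have "x \<notin> ?V n" for n using UC by (auto simp: I_def)
        then show ?thesis using False by simp
      qed
      then show "AE x in ?M. (\<lambda>n. indicator (?V n) x *\<^sub>R G x) \<longlonglongrightarrow> indicator U x *\<^sub>R G x"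
        by (intro AE_I2 tendsto_scaleR tendsto_const)
      show "AE x in ?M. norm (indicator (?V n) x *\<^sub>R G x) \<le> norm (G x)" for n
        by (intro AE_I2) (simp add: indicator_def)
    qed
    then show ?thesis using 0 LIMSEQ_unique[OF _ tendsto_const] by simp
  qed
  show ?thesis
  proof (rule density_zero[OF G])
    fix A assume A: "A \<in> sets ?M"
    then have A: "A \<in> sets lebesgue" "A \<subseteq> \<Omega>" using \<Omega>s by (auto simp: sets_restrict_space_iff)
    \<comment> \<open>Measurable sets are reached through decreasing open sets: up to the null set
      \<open>N\<close>, \<open>A\<close> is a countable intersection of open sets.\<close>
    obtain C N :: "'a set" where C: "gdelta C" "N \<in> null_sets lebesgue" "A \<union> N = C" "disjnt A N"
      using lebesgue_set_almost_gdelta[OF A(1)] by metis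
    obtain F :: "nat \<Rightarrow> 'a set" where F: "\<And>n. open (F n)" "C = (\<Inter>n. F n)"
      using C(1) by (auto elim: gdelta.cases)
    define V where "V n = (\<Inter>k\<le>n. F k) \<inter> \<Omega>" for n
    have V: "open (V n)" "V n \<subseteq> \<Omega>" for n using F(1) \<Omega> by (auto simp: V_def)
    have N: "AE x in ?M. x \<notin> N"
      using C(2) by (intro AE_restrict_space_iff[THEN iffD2]) (auto simp: \<Omega>s intro: AE_not_in[THEN eventually_mono])
    have "(\<lambda>n. \<integral>x. indicator (V n) x *\<^sub>R G x \<partial>?M) \<longlonglongrightarrow> (\<integral>x. indicator A x *\<^sub>R G x \<partial>?M)"
    proof (rule integral_dominated_convergence[OF _ _ nG])
      show "(\<lambda>x. indicator A x *\<^sub>R G x) \<in> borel_measurable ?M"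
        using A by (intro borel_measurable_scaleR ind) auto
      show "(\<lambda>x. indicator (V n) x *\<^sub>R G x) \<in> borel_measurable ?M" for n
        using V(1)[of n] by (intro borel_measurable_scaleR ind opl) auto
      show "AE x in ?M. (\<lambda>n. indicator (V n) x *\<^sub>R G x) \<longlonglongrightarrow> indicator A x *\<^sub>R G x"
        using N AE_space
      proof eventually_elim
        case (elim x)
        have "(\<lambda>n. indicator (V n) x :: real) \<longlonglongrightarrow> indicator A x"
        proof (cases "x \<in> A")
          case True
          then have "x \<in> V n" for n using A(2) C(3) F(2) by (auto simp: V_def)
          then show ?thesis using True by simp
        next
          case False
          then have "x \<notin> C" using elim C(3) by auto
          then obtain m where m: "x \<notin> F m" using F(2) by auto
          then have "x \<notin> V n" if "n \<ge> m" for n using that by (auto simp: V_def)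
          then have "\<forall>\<^sub>F n in sequentially. indicator (V n) x = (0 :: real)"
            by (intro eventually_mono[OF eventually_ge_at_top[of m]]) (simp add: indicator_def)
          then show ?thesis using False by (simp add: tendsto_eventually)
        qed
        then show ?case by (intro tendsto_scaleR tendsto_const)
      qed
      show "AE x in ?M. norm (indicator (V n) x *\<^sub>R G x) \<le> norm (G x)" for n
        by (intro AE_I2) (simp add: indicator_def)
    qed
    then show "set_lebesgue_integral ?M A G = 0"
      using opn[OF V] LIMSEQ_unique[OF _ tendsto_const] by (simp add: set_lebesgue_integral_def)
  qed
qed


lemma integral_lincomb:
  fixes f g :: "'a \<Rightarrow> 'b::euclidean_space"
  assumes "integrable M f" "integrable M g"
  shows "(\<integral>x. a *\<^sub>R f x + b *\<^sub>R g x \<partial>M) = a *\<^sub>R (\<integral>x. f x \<partial>M) + b *\<^sub>R (\<integral>x. g x \<partial>M)"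
  using assms by simp

section \<open>Calculus of weak gradients and traces\<close>

locale bounded_open =
  fixes \<Omega> :: "'a::euclidean_space set"
  assumes bounded_\<Omega>: "bounded \<Omega>" and open_\<Omega>: "open \<Omega>"
begin

abbreviation "\<mu> \<equiv> lebesgue_on \<Omega>"
abbreviation "\<sigma> \<equiv> surface_measure \<Omega>"

sublocale \<mu>: finite_measure \<mu>
  by (rule finite_measure_lebesgue_on_bounded[OF open_\<Omega> bounded_\<Omega>])

lemma nn_integral_\<mu>: "(\<integral>\<^sup>+x. f x \<partial>\<mu>) = (\<integral>\<^sup>+x. f x \<partial>leb \<Omega>)"
  using open_\<Omega> by (simp add: nn_integral_restrict_space nn_integral_completion borel_open)

lemma borel_measurable_\<mu>: "f \<in> borel_measurable borel \<Longrightarrow> f \<in> borel_measurable \<mu>"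
  by (intro measurable_restrict_space1 measurable_completion) simp

lemma borel_measurable_\<sigma>: "f \<in> borel_measurable borel \<Longrightarrow> f \<in> borel_measurable \<sigma>"
  unfolding surface_measure_def
  by (intro measurable_restrict_space1) (simp add: measurable_cong_sets[OF sets_hausdorff_measure refl])

lemma dirichlet_eq_sqnorm: "dirichlet \<Omega> G = sqnorm \<mu> G"
  using open_\<Omega> by (simp add: dirichlet_def sqnorm_def nn_integral_\<mu> nn_integral_leb)

lemma continuous_square_integrable:
  fixes f :: "'a \<Rightarrow> 'b::euclidean_space"
  assumes f: "continuous_on UNIV f"
  shows "square_integrable \<mu> f"
proof -
  have fm: "f \<in> borel_measurable \<mu>" by (intro borel_measurable_\<mu> borel_measurable_continuous_onI f)
  have "bounded (f ` closure \<Omega>)"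
    using bounded_\<Omega> by (intro compact_imp_bounded compact_continuous_image continuous_on_subset[OF f]) auto
  then obtain B where B: "\<And>x. x \<in> closure \<Omega> \<Longrightarrow> norm (f x) \<le> B" by (auto simp: bounded_iff)
  have "AE x in \<mu>. norm ((norm (f x))\<^sup>2) \<le> B\<^sup>2"
  proof (rule AE_I2)
    fix x assume "x \<in> space \<mu>"
    then have "norm (f x) \<le> B" using B closure_subset by (auto simp: space_restrict_space)
    then show "norm ((norm (f x))\<^sup>2) \<le> B\<^sup>2" by (simp add: power_mono)
  qed
  then have "integrable \<mu> (\<lambda>x. (norm (f x))\<^sup>2)"
    using fm by (intro \<mu>.integrable_const_bound) auto
  then show ?thesis using fm by (simp add: square_integrable_def)
qed

lemma C1_square_integrable:
  assumes "C1_with_gradient \<phi> D\<phi>"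
  shows "square_integrable \<mu> \<phi>" "square_integrable \<mu> D\<phi>"
  using C1_with_gradientD(3,4)[OF assms] by (auto intro: continuous_square_integrable)

lemma has_weak_gradientD:
  assumes "has_weak_gradient \<Omega> u G"
  shows "square_integrable \<mu> u" "square_integrable \<mu> G"
    "u \<in> borel_measurable \<mu>" "G \<in> borel_measurable \<mu>"
    "C1_with_gradient \<phi> D\<phi> \<Longrightarrow> compact_support_in \<Omega> \<phi> \<Longrightarrow>
      (\<integral>x. u x *\<^sub>R D\<phi> x \<partial>\<mu>) = - (\<integral>x. \<phi> x *\<^sub>R G x \<partial>\<mu>)"
  using assms unfolding has_weak_gradient_def by (auto simp: square_integrable_def)

text \<open>Makes the choice in \<open>weak_gradient\<close> harmless: any weak gradient can replace
  the chosen one inside integrals.\<close>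

lemma has_weak_gradient_unique:
  assumes u: "has_weak_gradient \<Omega> u G" and v: "has_weak_gradient \<Omega> v H" and uv: "AE x in \<mu>. u x = v x"
  shows "AE x in \<mu>. G x = H x"
proof -
  note U = has_weak_gradientD[OF u] and V = has_weak_gradientD[OF v]
  have "AE x in \<mu>. G x - H x = 0"
  proof (rule AE_0_if_C1_tests_0[OF open_\<Omega> bounded_\<Omega>])
    show "integrable \<mu> (\<lambda>x. G x - H x)"
      by (intro \<mu>.square_integrable_imp_integrable square_integrable_diff U V)
    fix \<phi> :: "'a \<Rightarrow> real" and D\<phi> assume \<phi>: "C1_with_gradient \<phi> D\<phi>" "compact_support_in \<Omega> \<phi>"
    have "(\<integral>x. u x *\<^sub>R D\<phi> x \<partial>\<mu>) = (\<integral>x. v x *\<^sub>R D\<phi> x \<partial>\<mu>)"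
    proof (rule integral_cong_AE)
      show "AE x in \<mu>. u x *\<^sub>R D\<phi> x = v x *\<^sub>R D\<phi> x" using uv by auto
    qed (use U V C1_square_integrable[OF \<phi>(1)] in \<open>auto simp: square_integrable_def\<close>)
    then have "(\<integral>x. \<phi> x *\<^sub>R G x \<partial>\<mu>) = (\<integral>x. \<phi> x *\<^sub>R H x \<partial>\<mu>)"
      using U(5)[OF \<phi>] V(5)[OF \<phi>] by simp
    then show "(\<integral>x. \<phi> x *\<^sub>R (G x - H x) \<partial>\<mu>) = 0"
      unfolding scaleR_diff_right using U V C1_square_integrable[OF \<phi>(1)]
      by (subst Bochner_Integration.integral_diff) (auto intro: integrable_scaleR_square_integrable)
  qed
  then show ?thesis by simp
qed

lemma has_weak_gradient_lincomb:
  assumes u: "has_weak_gradient \<Omega> u G" and v: "has_weak_gradient \<Omega> v H"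
  shows "has_weak_gradient \<Omega> (\<lambda>x. a * u x + b * v x) (\<lambda>x. a *\<^sub>R G x + b *\<^sub>R H x)"
  unfolding has_weak_gradient_def
proof (intro conjI allI impI)
  note U = has_weak_gradientD[OF u] and V = has_weak_gradientD[OF v]
  show "square_integrable \<mu> (\<lambda>x. a * u x + b * v x)"
    using square_integrable_lincomb[OF U(1) V(1), of a b] by simp
  show "square_integrable \<mu> (\<lambda>x. a *\<^sub>R G x + b *\<^sub>R H x)"
    by (rule square_integrable_lincomb[OF U(2) V(2)])
  fix \<phi> :: "'a \<Rightarrow> real" and D\<phi> assume \<phi>: "C1_with_gradient \<phi> D\<phi> \<and> compact_support_in \<Omega> \<phi>"
  then have C1: "C1_with_gradient \<phi> D\<phi>" and supp: "compact_support_in \<Omega> \<phi>" by auto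
  note S = C1_square_integrable[OF C1]
  have "(\<integral>x. (a * u x + b * v x) *\<^sub>R D\<phi> x \<partial>\<mu>) = (\<integral>x. a *\<^sub>R (u x *\<^sub>R D\<phi> x) + b *\<^sub>R (v x *\<^sub>R D\<phi> x) \<partial>\<mu>)"
    by (simp add: scaleR_left_distrib)
  also have "\<dots> = a *\<^sub>R (\<integral>x. u x *\<^sub>R D\<phi> x \<partial>\<mu>) + b *\<^sub>R (\<integral>x. v x *\<^sub>R D\<phi> x \<partial>\<mu>)"
    by (intro integral_lincomb integrable_scaleR_square_integrable U V S)
  also have "\<dots> = - (a *\<^sub>R (\<integral>x. \<phi> x *\<^sub>R G x \<partial>\<mu>) + b *\<^sub>R (\<integral>x. \<phi> x *\<^sub>R H x \<partial>\<mu>))"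
    using U(5)[OF C1 supp] V(5)[OF C1 supp] by simp
  also have "a *\<^sub>R (\<integral>x. \<phi> x *\<^sub>R G x \<partial>\<mu>) + b *\<^sub>R (\<integral>x. \<phi> x *\<^sub>R H x \<partial>\<mu>) = (\<integral>x. a *\<^sub>R (\<phi> x *\<^sub>R G x) + b *\<^sub>R (\<phi> x *\<^sub>R H x) \<partial>\<mu>)"
    by (intro integral_lincomb[symmetric] integrable_scaleR_square_integrable U V S)
  also have "\<dots> = (\<integral>x. \<phi> x *\<^sub>R (a *\<^sub>R G x + b *\<^sub>R H x) \<partial>\<mu>)"
    by (simp add: scaleR_right_distrib mult.commute)
  finally show "(\<integral>x. (a * u x + b * v x) *\<^sub>R D\<phi> x \<partial>\<mu>) = - (\<integral>x. \<phi> x *\<^sub>R (a *\<^sub>R G x + b *\<^sub>R H x) \<partial>\<mu>)" .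
qed

text \<open>The weak gradient is a closed operator, since both sides of the test identity are
  continuous in L2.\<close>

lemma has_weak_gradient_limit:
  assumes u: "\<And>k. has_weak_gradient \<Omega> (u k) (G k)"
    and v: "square_integrable \<mu> v" "L2_tendsto \<mu> u v" and H: "square_integrable \<mu> H" "L2_tendsto \<mu> G H"
  shows "has_weak_gradient \<Omega> v H"
  unfolding has_weak_gradient_def
proof (intro conjI allI impI)
  fix \<phi> :: "'a \<Rightarrow> real" and D\<phi> assume \<phi>: "C1_with_gradient \<phi> D\<phi> \<and> compact_support_in \<Omega> \<phi>"
  then have C1: "C1_with_gradient \<phi> D\<phi>" and supp: "compact_support_in \<Omega> \<phi>" by auto
  note S = C1_square_integrable[OF C1]
  have "(\<lambda>k. \<integral>x. u k x *\<^sub>R D\<phi> x \<partial>\<mu>) \<longlonglongrightarrow> (\<integral>x. v x *\<^sub>R D\<phi> x \<partial>\<mu>)"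
    by (rule L2_tendsto_integral_scaleR[OF has_weak_gradientD(1)[OF u] v(1) S(2) v(2)])
  moreover have "(\<lambda>k. - (\<integral>x. \<phi> x *\<^sub>R G k x \<partial>\<mu>)) \<longlonglongrightarrow> - (\<integral>x. \<phi> x *\<^sub>R H x \<partial>\<mu>)"
    by (intro tendsto_minus L2_tendsto_integral_scaleR'[OF has_weak_gradientD(2)[OF u] H(1) S(1) H(2)])
  ultimately show "(\<integral>x. v x *\<^sub>R D\<phi> x \<partial>\<mu>) = - (\<integral>x. \<phi> x *\<^sub>R H x \<partial>\<mu>)"
    unfolding has_weak_gradientD(5)[OF u C1 supp] by (rule LIMSEQ_unique)
qed (use v H in auto)

lemma has_weak_gradient_weak_gradient: "u \<in> H1 \<Omega> \<Longrightarrow> has_weak_gradient \<Omega> u (weak_gradient \<Omega> u)"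
  using someI_ex[of "has_weak_gradient \<Omega> u"] by (simp add: H1_def weak_gradient_def)

lemma weak_gradient_AE_eq: "has_weak_gradient \<Omega> u G \<Longrightarrow> AE x in \<mu>. weak_gradient \<Omega> u x = G x"
  using has_weak_gradient_weak_gradient[of u] by (intro has_weak_gradient_unique) (auto simp: H1_def)

lemma H1_lincomb: "u \<in> H1 \<Omega> \<Longrightarrow> v \<in> H1 \<Omega> \<Longrightarrow> (\<lambda>x. a * u x + b * v x) \<in> H1 \<Omega>"
  using has_weak_gradient_lincomb unfolding H1_def by blast

lemma weak_gradient_lincomb:
  assumes "u \<in> H1 \<Omega>" "v \<in> H1 \<Omega>"
  shows "AE x in \<mu>. weak_gradient \<Omega> (\<lambda>x. a * u x + b * v x) x = a *\<^sub>R weak_gradient \<Omega> u x + b *\<^sub>R weak_gradient \<Omega> v x"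
  by (intro weak_gradient_AE_eq has_weak_gradient_lincomb has_weak_gradient_weak_gradient assms)

lemma has_traceE:
  assumes "has_trace \<Omega> u g"
  obtains G \<phi> D\<phi> where "g \<in> borel_measurable \<sigma>" "has_weak_gradient \<Omega> u G"
    "\<And>k::nat. C1_with_gradient (\<phi> k) (D\<phi> k)"
    "L2_tendsto \<mu> \<phi> u" "L2_tendsto \<mu> D\<phi> G" "L2_tendsto \<sigma> \<phi> g"
  using assms unfolding has_trace_def by blast

lemma has_trace_lincomb:
  assumes u: "has_trace \<Omega> u g" and v: "has_trace \<Omega> v h"
  shows "has_trace \<Omega> (\<lambda>x. a * u x + b * v x) (\<lambda>x. a * g x + b * h x)"
proof -
  obtain G \<phi> D\<phi> where U: "g \<in> borel_measurable \<sigma>" "has_weak_gradient \<Omega> u G" "\<And>k::nat. C1_with_gradient (\<phi> k) (D\<phi> k)"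
    "L2_tendsto \<mu> \<phi> u" "L2_tendsto \<mu> D\<phi> G" "L2_tendsto \<sigma> \<phi> g"
    by (rule has_traceE[OF u]) blast
  obtain H \<psi> D\<psi> where V: "h \<in> borel_measurable \<sigma>" "has_weak_gradient \<Omega> v H" "\<And>k::nat. C1_with_gradient (\<psi> k) (D\<psi> k)"
    "L2_tendsto \<mu> \<psi> v" "L2_tendsto \<mu> D\<psi> H" "L2_tendsto \<sigma> \<psi> h"
    by (rule has_traceE[OF v]) blast
  note mu = has_weak_gradientD(3,4)[OF U(2)] has_weak_gradientD(3,4)[OF V(2)]
  note m = borel_measurable_\<mu>[OF C1_with_gradientD(1)] borel_measurable_\<mu>[OF C1_with_gradientD(2)]
    borel_measurable_\<sigma>[OF C1_with_gradientD(1)]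
  have "L2_tendsto \<mu> (\<lambda>k x. a * \<phi> k x + b * \<psi> k x) (\<lambda>x. a * u x + b * v x)"
    using L2_tendsto_lincomb[OF m(1)[OF U(3)] mu(1) m(1)[OF V(3)] mu(3) U(4) V(4), of a b] by simp
  moreover have "L2_tendsto \<mu> (\<lambda>k x. a *\<^sub>R D\<phi> k x + b *\<^sub>R D\<psi> k x) (\<lambda>x. a *\<^sub>R G x + b *\<^sub>R H x)"
    by (rule L2_tendsto_lincomb[OF m(2)[OF U(3)] mu(2) m(2)[OF V(3)] mu(4) U(5) V(5)])
  moreover have "L2_tendsto \<sigma> (\<lambda>k x. a * \<phi> k x + b * \<psi> k x) (\<lambda>x. a * g x + b * h x)"
    using L2_tendsto_lincomb[OF m(3)[OF U(3)] U(1) m(3)[OF V(3)] V(1) U(6) V(6), of a b] by simp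
  moreover have "(\<lambda>x. a * g x + b * h x) \<in> borel_measurable \<sigma>" using U(1) V(1) by simp
  ultimately show ?thesis
    unfolding has_trace_def
    by (intro conjI exI[of _ "\<lambda>x. a *\<^sub>R G x + b *\<^sub>R H x"] exI[of _ "\<lambda>k x. a * \<phi> k x + b * \<psi> k x"]
        exI[of _ "\<lambda>k x. a *\<^sub>R D\<phi> k x + b *\<^sub>R D\<psi> k x"] allI
        has_weak_gradient_lincomb[OF U(2) V(2)] C1_with_gradient_lincomb[OF U(3) V(3)])
qed

lemma trace_eq_on_lincomb:
  assumes "trace_eq_on \<Omega> \<Gamma> u g" "trace_eq_on \<Omega> \<Gamma> v h"
  shows "trace_eq_on \<Omega> \<Gamma> (\<lambda>x. a * u x + b * v x) (\<lambda>x. a * g x + b * h x)"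
proof -
  obtain g' h' where g': "has_trace \<Omega> u g'" "AE x in \<sigma>. x \<in> \<Gamma> \<longrightarrow> g' x = g x"
    and h': "has_trace \<Omega> v h'" "AE x in \<sigma>. x \<in> \<Gamma> \<longrightarrow> h' x = h x"
    using assms unfolding trace_eq_on_def by blast
  have "AE x in \<sigma>. x \<in> \<Gamma> \<longrightarrow> a * g' x + b * h' x = a * g x + b * h x"
    using g'(2) h'(2) by eventually_elim auto
  then show ?thesis unfolding trace_eq_on_def using has_trace_lincomb[OF g'(1) h'(1)] by blast
qed

end

section \<open>Trace and Poincare inequalities\<close>

locale lipschitz_domain = bounded_open +
  assumes connected_\<Omega>: "connected \<Omega>" and lipschitz_\<Omega>: "lipschitz_boundary \<Omega>" and nonempty_\<Omega>: "\<Omega> \<noteq> {}"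
begin

lemma embedded_\<sigma>: "embedded_finite_measure \<sigma>"
  and linked_\<sigma>: "linked \<Omega> \<sigma> (leb \<Omega>)"
  and linked_\<Omega>: "linked \<Omega> (leb \<Omega>) (leb \<Omega>)"
  using linked_lipschitz_domain[OF bounded_\<Omega> connected_\<Omega> open_\<Omega> lipschitz_\<Omega> nonempty_\<Omega>] by auto

sublocale \<sigma>: finite_measure \<sigma>
  using embedded_\<sigma> by (simp add: embedded_finite_measure_def)

lemma embedded_leb: "embedded_finite_measure (leb \<Omega>)"
  using bounded_\<Omega> open_\<Omega> by (intro embedded_finite_measure_leb) auto

lemma emeasure_leb_pos: "emeasure (leb \<Omega>) (space (leb \<Omega>)) > 0"
proof -
  obtain x r where "r > 0" "ball x r \<subseteq> \<Omega>" using nonempty_\<Omega> open_\<Omega> by (meson ex_in_conv open_contains_ball)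
  then have "0 < emeasure lborel (ball x r)" "emeasure lborel (ball x r) \<le> emeasure lborel \<Omega>"
    using emeasure_leb_ball_pos[of r x] open_\<Omega> by (auto simp: emeasure_restrict_space space_restrict_space intro!: emeasure_mono)
  then show ?thesis using open_\<Omega> by (simp add: emeasure_restrict_space space_restrict_space)
qed

lemma linked_\<sigma>': "linked \<Omega> (leb \<Omega>) \<sigma>"
  by (rule linked_sym[OF embedded_\<sigma> embedded_leb emeasure_leb_pos linked_\<sigma> linked_\<Omega>])

text \<open>Compare \<open>\<phi> a\<close> with \<open>\<phi> y\<close> and average over
  \<open>y\<close> in \<open>\<beta>\<close>. With \<open>\<alpha>\<close> on the boundary and
  \<open>\<beta>\<close> the volume this is the trace inequality; with the roles exchanged and
  \<open>\<beta>\<close> restricted to a boundary part it is the Poincare inequality.\<close>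

lemma linked_square_le:
  assumes \<alpha>: "embedded_finite_measure \<alpha>" and \<beta>: "embedded_finite_measure \<beta>" "emeasure \<beta> (space \<beta>) > 0"
    and l: "linked \<Omega> \<alpha> \<beta>"
  obtains C :: real where "C \<ge> 0" "\<And>\<phi> D\<phi>. C1_with_gradient \<phi> D\<phi> \<Longrightarrow>
    sqnorm \<alpha> \<phi> \<le> ennreal C * (sqnorm \<beta> \<phi> + sqnorm \<mu> D\<phi>)"
proof -
  interpret \<alpha>: finite_measure \<alpha> using \<alpha> by (simp add: embedded_finite_measure_def)
  interpret \<beta>: finite_measure \<beta> using \<beta> by (simp add: embedded_finite_measure_def)
  define s where "s = measure \<alpha> (space \<alpha>)"
  define m where "m = measure \<beta> (space \<beta>)"
  have m: "m > 0" "emeasure \<beta> (space \<beta>) = ennreal m" using \<beta>(2) by (auto simp: m_def \<beta>.emeasure_eq_measure)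
  obtain K :: real where K: "\<And>\<phi> D\<phi>. C1_with_gradient \<phi> D\<phi> \<Longrightarrow>
     (\<integral>\<^sup>+x. mean_gap \<beta> \<phi> x \<partial>\<alpha>) \<le> ennreal K * dirichlet \<Omega> D\<phi>"
    using l unfolding linked_def by blast
  \<comment> \<open>One constant for both summands. A link may come with a negative
    \<open>K\<close>, which counts as 0 in \<open>ennreal\<close>.\<close>
  define B where "B = max 0 K + s"
  have B: "B \<ge> max 0 K" "B \<ge> s" "B \<ge> 0" by (auto simp: B_def s_def)
  \<comment> \<open>The 2 stems from the squared sum, the division by \<open>m\<close> from
    averaging over \<open>\<beta>\<close>.\<close>
  define C where "C = 2 * B / m"
  have C: "C \<ge> 0" using m B by (simp add: C_def)
  have "sqnorm \<alpha> \<phi> \<le> ennreal C * (sqnorm \<beta> \<phi> + sqnorm \<mu> D\<phi>)" if C1: "C1_with_gradient \<phi> D\<phi>" for \<phi> D\<phi>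
  proof -
    note meas = C1_with_gradientD(1)[OF C1]
    note [measurable] = borel_measurable_embedded[OF \<alpha> meas] borel_measurable_embedded[OF \<beta>(1) meas]
      borel_measurable_embedded[OF \<alpha> borel_measurable_mean_squared_diff[OF \<beta>(1) meas]]
    have pt: "ennreal m * ennreal ((norm (\<phi> a))\<^sup>2) \<le> 2 * mean_gap \<beta> \<phi> a + 2 * sqnorm \<beta> \<phi>" for a
    proof -
      have "ennreal m * ennreal ((norm (\<phi> a))\<^sup>2) = (\<integral>\<^sup>+y. ennreal ((\<phi> a)\<^sup>2) \<partial>\<beta>)"
        using m by (simp add: mult.commute)
      also have "\<dots> \<le> (\<integral>\<^sup>+y. 2 * ennreal ((\<phi> a - \<phi> y)\<^sup>2) + 2 * ennreal ((norm (\<phi> y))\<^sup>2) \<partial>\<beta>)"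
        using ennreal_norm_add_squared_le[of "\<phi> a - \<phi> y" "\<phi> y" for y] by (intro nn_integral_mono) simp
      also have "\<dots> = 2 * mean_gap \<beta> \<phi> a + 2 * sqnorm \<beta> \<phi>"
        by (simp add: nn_integral_add nn_integral_cmult mean_gap_def sqnorm_def)
      finally show ?thesis .
    qed
    have "ennreal m * sqnorm \<alpha> \<phi> = (\<integral>\<^sup>+a. ennreal m * ennreal ((norm (\<phi> a))\<^sup>2) \<partial>\<alpha>)"
      unfolding sqnorm_def by (rule nn_integral_cmult[symmetric]) measurable
    also have "\<dots> \<le> (\<integral>\<^sup>+a. 2 * mean_gap \<beta> \<phi> a + 2 * sqnorm \<beta> \<phi> \<partial>\<alpha>)"
      by (intro nn_integral_mono pt)
    also have "\<dots> = 2 * (\<integral>\<^sup>+a. mean_gap \<beta> \<phi> a \<partial>\<alpha>) + 2 * (sqnorm \<beta> \<phi> * ennreal s)"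
      by (simp add: nn_integral_add nn_integral_cmult s_def \<alpha>.emeasure_eq_measure mult_ac)
    also have "\<dots> \<le> 2 * (ennreal (max 0 K) * sqnorm \<mu> D\<phi>) + 2 * (sqnorm \<beta> \<phi> * ennreal s)"
      using K[OF C1] by (intro add_mono mult_left_mono) (auto simp: dirichlet_eq_sqnorm ennreal_max_0)
    also have "\<dots> \<le> 2 * (ennreal B * sqnorm \<mu> D\<phi>) + 2 * (sqnorm \<beta> \<phi> * ennreal B)"
      by (intro add_mono mult_left_mono mult_right_mono ennreal_leI B) auto
    also have "\<dots> = ennreal (2 * B) * (sqnorm \<beta> \<phi> + sqnorm \<mu> D\<phi>)"
      using B by (simp add: ennreal_mult' distrib_left mult_ac add.commute)
    finally have "ennreal (1 / m) * (ennreal m * sqnorm \<alpha> \<phi>)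
      \<le> ennreal (1 / m) * (ennreal (2 * B) * (sqnorm \<beta> \<phi> + sqnorm \<mu> D\<phi>))"
      by (rule mult_left_mono) simp
    moreover have "ennreal (1 / m) * ennreal m = 1" using m by (simp add: ennreal_mult'[symmetric])
    moreover have "ennreal (1 / m) * ennreal (2 * B) = ennreal C"
      using m by (simp add: ennreal_mult'[symmetric] C_def)
    ultimately show ?thesis by (simp add: mult.assoc[symmetric])
  qed
  then show ?thesis by (rule that[OF C])
qed

lemma sqnorm_leb: "sqnorm (leb \<Omega>) f = sqnorm \<mu> f"
  by (simp add: sqnorm_def nn_integral_\<mu>)

lemma trace_inequality:
  obtains C :: real where "C \<ge> 0" "\<And>\<phi> D\<phi>. C1_with_gradient \<phi> D\<phi> \<Longrightarrow>
    sqnorm \<sigma> \<phi> \<le> ennreal C * (sqnorm \<mu> \<phi> + sqnorm \<mu> D\<phi>)"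
  using linked_square_le[OF embedded_\<sigma> embedded_leb emeasure_leb_pos linked_\<sigma>] unfolding sqnorm_leb by blast

text \<open>The boundary integral has to stay: functions approximating one with zero trace need not
  vanish on \<open>\<Gamma>\<close> themselves.\<close>

lemma poincare_C1:
  assumes \<Gamma>: "emeasure \<sigma> \<Gamma> > 0"
  obtains C :: real where "C \<ge> 0" "\<And>\<phi> D\<phi>. C1_with_gradient \<phi> D\<phi> \<Longrightarrow>
    sqnorm \<mu> \<phi> \<le> ennreal C * (sqnorm \<mu> D\<phi> + (\<integral>\<^sup>+x. ennreal ((norm (\<phi> x))\<^sup>2) * indicator \<Gamma> x \<partial>\<sigma>))"
proof -
  let ?\<beta> = "restrict_space \<sigma> \<Gamma>"
  \<comment> \<open>A nonmeasurable set has \<open>emeasure\<close> 0 by convention, so positivity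
    implies measurability.\<close>
  have \<Gamma>s: "\<Gamma> \<in> sets \<sigma>" using \<Gamma> emeasure_notin_sets by force
  then have sub: "\<Gamma> \<inter> space \<sigma> = \<Gamma>" by (auto dest: sets.sets_into_space)
  have int: "(\<integral>\<^sup>+x. f x \<partial>?\<beta>) = (\<integral>\<^sup>+x. f x * indicator \<Gamma> x \<partial>\<sigma>)" for f
    using \<Gamma>s by (intro nn_integral_restrict_space) (simp add: sub)
  have \<beta>: "embedded_finite_measure ?\<beta>"
    using embedded_\<sigma> \<Gamma>s unfolding embedded_finite_measure_def
    by (auto intro!: finite_measure_restrict_space measurable_restrict_space1)
  have pos: "emeasure ?\<beta> (space ?\<beta>) > 0"
    using \<Gamma> \<Gamma>s by (simp add: emeasure_restrict_space space_restrict_space sub)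
  \<comment> \<open>Restricting the inner measure to \<open>\<Gamma>\<close> only decreases the mean
    gap, so the link to the whole boundary suffices.\<close>
  have "linked \<Omega> (leb \<Omega>) ?\<beta>"
  proof -
    obtain C :: real where C: "\<And>\<phi> D\<phi>. C1_with_gradient \<phi> D\<phi> \<Longrightarrow>
       (\<integral>\<^sup>+x. mean_gap \<sigma> \<phi> x \<partial>leb \<Omega>) \<le> ennreal C * dirichlet \<Omega> D\<phi>"
      using linked_\<sigma>' unfolding linked_def by blast
    have "mean_gap ?\<beta> \<phi> x \<le> mean_gap \<sigma> \<phi> x" for \<phi> x
      unfolding mean_gap_def int by (intro nn_integral_mono) (simp add: indicator_def)
    then show ?thesis unfolding linked_def using C by (meson nn_integral_mono order_trans)
  qed
  from linked_square_le[OF embedded_leb \<beta> pos this]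
  obtain C :: real where "C \<ge> 0" "\<And>\<phi> D\<phi>. C1_with_gradient \<phi> D\<phi> \<Longrightarrow>
    sqnorm \<mu> \<phi> \<le> ennreal C * (sqnorm ?\<beta> \<phi> + sqnorm \<mu> D\<phi>)" unfolding sqnorm_leb by blast
  then show ?thesis by (intro that[of C]) (simp_all add: sqnorm_def int add.commute)
qed

lemma poincare:
  assumes \<Gamma>: "emeasure \<sigma> \<Gamma> > 0"
  obtains C :: real where "C \<ge> 0" "\<And>w. w \<in> H1 \<Omega> \<Longrightarrow> trace_eq_on \<Omega> \<Gamma> w (\<lambda>_. 0) \<Longrightarrow>
    sqnorm \<mu> w \<le> ennreal C * sqnorm \<mu> (weak_gradient \<Omega> w)"
proof -
  have \<Gamma>s [measurable]: "\<Gamma> \<in> sets \<sigma>" using \<Gamma> emeasure_notin_sets by force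
  obtain C :: real where C: "C \<ge> 0" "\<And>\<phi> D\<phi>. C1_with_gradient \<phi> D\<phi> \<Longrightarrow>
    sqnorm \<mu> \<phi> \<le> ennreal C * (sqnorm \<mu> D\<phi> + (\<integral>\<^sup>+x. ennreal ((norm (\<phi> x))\<^sup>2) * indicator \<Gamma> x \<partial>\<sigma>))"
    using poincare_C1[OF \<Gamma>] by blast
  have "sqnorm \<mu> w \<le> ennreal (4 * C) * sqnorm \<mu> (weak_gradient \<Omega> w)"
    if w: "trace_eq_on \<Omega> \<Gamma> w (\<lambda>_. 0)" for w
  proof -
    obtain g where g: "has_trace \<Omega> w g" "AE x in \<sigma>. x \<in> \<Gamma> \<longrightarrow> g x = 0"
      using w unfolding trace_eq_on_def by (elim exE conjE)
    obtain G \<phi> D\<phi> where U: "g \<in> borel_measurable \<sigma>" "has_weak_gradient \<Omega> w G" "\<And>k::nat. C1_with_gradient (\<phi> k) (D\<phi> k)"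
      "L2_tendsto \<mu> \<phi> w" "L2_tendsto \<mu> D\<phi> G" "L2_tendsto \<sigma> \<phi> g"
      by (rule has_traceE[OF g(1)]) blast
    note m = borel_measurable_\<mu>[OF C1_with_gradientD(1)[OF U(3)]] borel_measurable_\<mu>[OF C1_with_gradientD(2)[OF U(3)]]
      has_weak_gradientD(3,4)[OF U(2)]
    let ?e = "\<lambda>k. sqnorm \<mu> (\<lambda>x. \<phi> k x - w x)" let ?d = "\<lambda>k. sqnorm \<mu> (\<lambda>x. D\<phi> k x - G x)"
    let ?t = "\<lambda>k. sqnorm \<sigma> (\<lambda>x. \<phi> k x - g x)"
    \<comment> \<open>Splitting \<open>w\<close> and then the gradient each costs a factor 2;
      together they give the final constant \<open>4 * C\<close>.\<close>
    have "sqnorm \<mu> w \<le> 2 * ?e k + 2 * (ennreal C * ((2 * ?d k + 2 * sqnorm \<mu> G) + ?t k))" for k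
    proof -
      have "sqnorm \<mu> w \<le> 2 * ?e k + 2 * sqnorm \<mu> (\<phi> k)"
        using sqnorm_add_le[of "\<lambda>x. w x - \<phi> k x" \<mu> "\<phi> k"] m by (simp add: sqnorm_diff_commute[of \<mu> w])
      also have "sqnorm \<mu> (\<phi> k) \<le> ennreal C * (sqnorm \<mu> (D\<phi> k) + (\<integral>\<^sup>+x. ennreal ((norm (\<phi> k x))\<^sup>2) * indicator \<Gamma> x \<partial>\<sigma>))"
        by (rule C(2)[OF U(3)])
      also have "sqnorm \<mu> (D\<phi> k) \<le> 2 * ?d k + 2 * sqnorm \<mu> G"
        using sqnorm_add_le[of "\<lambda>x. D\<phi> k x - G x" \<mu> G] m by simp
      \<comment> \<open>On \<open>\<Gamma>\<close> the trace \<open>g\<close> is 0, so there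
        \<open>\<phi> k\<close> is its own distance to \<open>g\<close>, which tends to 0.\<close>
      also have "(\<integral>\<^sup>+x. ennreal ((norm (\<phi> k x))\<^sup>2) * indicator \<Gamma> x \<partial>\<sigma>) \<le> ?t k"
        unfolding sqnorm_def using g(2) by (intro nn_integral_mono_AE, eventually_elim) (auto simp: indicator_def)
      finally show ?thesis by (simp add: mult_left_mono add_mono)
    qed
    moreover have "(\<lambda>k. 2 * ?e k + 2 * (ennreal C * ((2 * ?d k + 2 * sqnorm \<mu> G) + ?t k)))
      \<longlonglongrightarrow> 2 * 0 + 2 * (ennreal C * ((2 * 0 + 2 * sqnorm \<mu> G) + 0))"
      using U(4-6) unfolding L2_tendsto_sqnorm by (intro tendsto_add ennreal_tendsto_cmult tendsto_const) auto
    ultimately have "sqnorm \<mu> w \<le> 2 * 0 + 2 * (ennreal C * ((2 * 0 + 2 * sqnorm \<mu> G) + 0))"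
      by (intro LIMSEQ_le_const) auto
    also have "\<dots> = ennreal (4 * C) * sqnorm \<mu> G"
    proof -
      have "ennreal (4 * C) = ennreal (2 * (C * 2))" by (rule arg_cong[where f = ennreal]) simp
      also have "\<dots> = 2 * (ennreal C * 2)" using C(1) by (subst ennreal_mult, auto, subst ennreal_mult, auto)
      finally show ?thesis by (simp add: mult.assoc)
    qed
    also have "sqnorm \<mu> G = sqnorm \<mu> (weak_gradient \<Omega> w)"
      by (rule sqnorm_cong_AE[symmetric, OF weak_gradient_AE_eq[OF U(2)]])
    finally show ?thesis .
  qed
  then show ?thesis using C(1) by (intro that[of "4 * C"]) auto
qed

end


section \<open>Completeness of functions with prescribed traces\<close>

lemma L2_tendsto_Cauchy:
  assumes m: "\<And>k. f k \<in> borel_measurable M" "g \<in> borel_measurable M" and lim: "L2_tendsto M f g"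
    and e: "e > (0::real)"
  shows "\<exists>N. \<forall>i\<ge>N. \<forall>j\<ge>N. sqnorm M (\<lambda>x. f i x - f j x) \<le> ennreal e"
proof -
  have "\<forall>\<^sub>F k in sequentially. sqnorm M (\<lambda>x. f k x - g x) < ennreal (e / 4)"
    using lim e unfolding L2_tendsto_sqnorm by (intro order_tendstoD) auto
  then obtain N where N: "\<And>k. k \<ge> N \<Longrightarrow> sqnorm M (\<lambda>x. f k x - g x) < ennreal (e / 4)"
    by (auto simp: eventually_sequentially)
  have "sqnorm M (\<lambda>x. f i x - f j x) \<le> ennreal e" if "i \<ge> N" "j \<ge> N" for i j
  proof -
    have "sqnorm M (\<lambda>x. f i x - f j x) \<le> 2 * sqnorm M (\<lambda>x. f i x - g x) + 2 * sqnorm M (\<lambda>x. g x - f j x)"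
      by (rule sqnorm_triangle[OF m(1) m(2) m(1)])
    also have "sqnorm M (\<lambda>x. g x - f j x) = sqnorm M (\<lambda>x. f j x - g x)" by (rule sqnorm_diff_commute)
    also have "2 * sqnorm M (\<lambda>x. f i x - g x) + 2 * \<dots> \<le> 2 * ennreal (e / 4) + 2 * ennreal (e / 4)"
      using N[OF that(1)] N[OF that(2)] by (intro add_mono mult_left_mono) auto
    also have "2 * ennreal (e / 4) = ennreal (e / 2)" using ennreal_mult'[of 2 "e / 4"] by simp
    also have "ennreal (e / 2) + ennreal (e / 2) = ennreal e" using ennreal_plus[of "e / 2" "e / 2"] e by simp
    finally show ?thesis .
  qed
  then show ?thesis by (intro exI[of _ N] allI impI)
qed

lemma tendsto_ennreal_inverse_Suc: "(\<lambda>k. ennreal (1 / real (Suc k))) \<longlonglongrightarrow> 0"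
proof -
  have "(\<lambda>k. ennreal (1 / real (Suc k))) \<longlonglongrightarrow> ennreal 0"
    by (intro tendsto_ennrealI LIMSEQ_Suc lim_1_over_n)
  then show ?thesis by simp
qed

context lipschitz_domain
begin

lemma C1_square_integrable_\<sigma>:
  assumes C1: "C1_with_gradient \<phi> D\<phi>"
  shows "square_integrable \<sigma> \<phi>"
proof -
  obtain C :: real where C: "C \<ge> 0" "\<And>\<phi> D\<phi>. C1_with_gradient \<phi> D\<phi> \<Longrightarrow>
    sqnorm \<sigma> \<phi> \<le> ennreal C * (sqnorm \<mu> \<phi> + sqnorm \<mu> D\<phi>)" using trace_inequality by blast
  have "ennreal C * (sqnorm \<mu> \<phi> + sqnorm \<mu> D\<phi>) < \<infinity>"
    using C1_square_integrable[OF C1] by (auto simp: square_integrable_iff_sqnorm ennreal_mult_less_top)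
  then have "sqnorm \<sigma> \<phi> < \<infinity>" using C(2)[OF C1] by (rule le_less_trans[rotated])
  then show ?thesis
    using borel_measurable_\<sigma>[OF C1_with_gradientD(1)[OF C1]] by (simp add: square_integrable_iff_sqnorm)
qed

lemma trace_approximation:
  assumes u: "has_trace \<Omega> u g" and e: "e > (0::real)"
  obtains \<phi> D\<phi> where "C1_with_gradient \<phi> D\<phi>" "sqnorm \<mu> (\<lambda>x. \<phi> x - u x) \<le> ennreal e"
    "sqnorm \<mu> (\<lambda>x. D\<phi> x - weak_gradient \<Omega> u x) \<le> ennreal e" "sqnorm \<sigma> (\<lambda>x. \<phi> x - g x) \<le> ennreal e"
proof -
  obtain G \<phi> D\<phi> where U: "g \<in> borel_measurable \<sigma>" "has_weak_gradient \<Omega> u G" "\<And>k::nat. C1_with_gradient (\<phi> k) (D\<phi> k)"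
    "L2_tendsto \<mu> \<phi> u" "L2_tendsto \<mu> D\<phi> G" "L2_tendsto \<sigma> \<phi> g"
    by (rule has_traceE[OF u]) blast
  have "\<forall>\<^sub>F k in sequentially. sqnorm \<mu> (\<lambda>x. \<phi> k x - u x) < ennreal e \<and> sqnorm \<mu> (\<lambda>x. D\<phi> k x - G x) < ennreal e
    \<and> sqnorm \<sigma> (\<lambda>x. \<phi> k x - g x) < ennreal e"
    using U(4-6) e unfolding L2_tendsto_sqnorm by (intro eventually_conj order_tendstoD(2)) auto
  then obtain k where k: "sqnorm \<mu> (\<lambda>x. \<phi> k x - u x) < ennreal e" "sqnorm \<mu> (\<lambda>x. D\<phi> k x - G x) < ennreal e"
    "sqnorm \<sigma> (\<lambda>x. \<phi> k x - g x) < ennreal e" by (auto simp: eventually_sequentially)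
  have "AE x in \<mu>. D\<phi> k x - weak_gradient \<Omega> u x = D\<phi> k x - G x"
    using weak_gradient_AE_eq[OF U(2)] by eventually_elim simp
  then have "sqnorm \<mu> (\<lambda>x. D\<phi> k x - weak_gradient \<Omega> u x) = sqnorm \<mu> (\<lambda>x. D\<phi> k x - G x)" by (rule sqnorm_cong_AE)
  then show ?thesis using k by (intro that[OF U(3)[of k]]) auto
qed

text \<open>Each \<open>v k\<close> has its own approximating sequence. Taking one function per
  \<open>k\<close>, close to \<open>v k\<close> in value, gradient and trace, gives a diagonal
  sequence for the limit. The trace inequality makes its boundary values Cauchy, and their limit is
  the required trace.\<close>

lemma H1_trace_complete:
  assumes v: "\<And>k. v k \<in> H1 \<Omega>" and tr: "\<And>k. trace_eq_on \<Omega> \<Gamma> (v k) w" and \<Gamma>: "\<Gamma> \<in> sets \<sigma>"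
    and cv: "\<And>e::real. e > 0 \<Longrightarrow> \<exists>N. \<forall>i\<ge>N. \<forall>j\<ge>N. sqnorm \<mu> (\<lambda>x. v i x - v j x) \<le> ennreal e"
    and cg: "\<And>e::real. e > 0 \<Longrightarrow> \<exists>N. \<forall>i\<ge>N. \<forall>j\<ge>N.
      sqnorm \<mu> (\<lambda>x. weak_gradient \<Omega> (v i) x - weak_gradient \<Omega> (v j) x) \<le> ennreal e"
  obtains u where "u \<in> H1 \<Omega>" "trace_eq_on \<Omega> \<Gamma> u w" "L2_tendsto \<mu> v u"
    "L2_tendsto \<mu> (\<lambda>k. weak_gradient \<Omega> (v k)) (weak_gradient \<Omega> u)"
proof -
  note vg = has_weak_gradient_weak_gradient[OF v]
  obtain u where u: "square_integrable \<mu> u" "L2_tendsto \<mu> v u"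
    using \<mu>.L2_complete[OF has_weak_gradientD(1)[OF vg] cv] by blast
  obtain G where G: "square_integrable \<mu> G" "L2_tendsto \<mu> (\<lambda>k. weak_gradient \<Omega> (v k)) G"
    using \<mu>.L2_complete[OF has_weak_gradientD(2)[OF vg] cg] by blast
  have uG: "has_weak_gradient \<Omega> u G" by (rule has_weak_gradient_limit[OF vg u G])
  then have uH: "u \<in> H1 \<Omega>" by (auto simp: H1_def)
  note um = has_weak_gradientD(3,4)[OF uG]
  have "\<exists>g. has_trace \<Omega> (v k) g \<and> (AE x in \<sigma>. x \<in> \<Gamma> \<longrightarrow> g x = w x)" for k
    using tr[of k] by (simp add: trace_eq_on_def)
  then obtain g where g: "\<And>k. has_trace \<Omega> (v k) (g k)" "\<And>k. AE x in \<sigma>. x \<in> \<Gamma> \<longrightarrow> g k x = w x" by metis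
  have gm: "g k \<in> borel_measurable \<sigma>" for k using g(1)[of k] by (simp add: has_trace_def)
  let ?P = "\<lambda>k p. C1_with_gradient (fst p) (snd p) \<and> sqnorm \<mu> (\<lambda>x. fst p x - v k x) \<le> ennreal (1 / real (Suc k)) \<and>
    sqnorm \<mu> (\<lambda>x. snd p x - weak_gradient \<Omega> (v k) x) \<le> ennreal (1 / real (Suc k)) \<and>
    sqnorm \<sigma> (\<lambda>x. fst p x - g k x) \<le> ennreal (1 / real (Suc k))"
  have "\<forall>k. \<exists>p. ?P k p"
  proof
    fix k
    have "1 / real (Suc k) > 0" by simp
    from trace_approximation[OF g(1)[of k] this]
    obtain \<phi> D\<phi> where "C1_with_gradient \<phi> D\<phi>" "sqnorm \<mu> (\<lambda>x. \<phi> x - v k x) \<le> ennreal (1 / real (Suc k))"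
      "sqnorm \<mu> (\<lambda>x. D\<phi> x - weak_gradient \<Omega> (v k) x) \<le> ennreal (1 / real (Suc k))"
      "sqnorm \<sigma> (\<lambda>x. \<phi> x - g k x) \<le> ennreal (1 / real (Suc k))" .
    then have "?P k (\<phi>, D\<phi>)" by simp
    then show "\<exists>p. ?P k p" by (rule exI)
  qed
  from choice[OF this] obtain p where p: "\<And>k. C1_with_gradient (fst (p k)) (snd (p k))"
    "\<And>k. sqnorm \<mu> (\<lambda>x. fst (p k) x - v k x) \<le> ennreal (1 / real (Suc k))"
    "\<And>k. sqnorm \<mu> (\<lambda>x. snd (p k) x - weak_gradient \<Omega> (v k) x) \<le> ennreal (1 / real (Suc k))"
    "\<And>k. sqnorm \<sigma> (\<lambda>x. fst (p k) x - g k x) \<le> ennreal (1 / real (Suc k))" by auto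
  define \<psi> where "\<psi> k = fst (p k)" for k
  define D\<psi> where "D\<psi> k = snd (p k)" for k
  have C1: "C1_with_gradient (\<psi> k) (D\<psi> k)" for k using p(1) by (simp add: \<psi>_def D\<psi>_def)
  note m = borel_measurable_\<mu>[OF C1_with_gradientD(1)[OF C1]] borel_measurable_\<mu>[OF C1_with_gradientD(2)[OF C1]]
    borel_measurable_\<sigma>[OF C1_with_gradientD(1)[OF C1]]
  have l1: "L2_tendsto \<mu> \<psi> u"
    by (rule L2_tendsto_trans[OF m(1) has_weak_gradientD(3)[OF vg] um(1) _ u(2)])
       (rule tendsto_0_le_ennreal[OF p(2)[folded \<psi>_def] tendsto_ennreal_inverse_Suc])
  have l2: "L2_tendsto \<mu> D\<psi> G"
    by (rule L2_tendsto_trans[OF m(2) has_weak_gradientD(4)[OF vg] um(2) _ G(2)])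
       (rule tendsto_0_le_ennreal[OF p(3)[folded D\<psi>_def] tendsto_ennreal_inverse_Suc])
  obtain C :: real where C: "C \<ge> 0" "\<And>\<phi> D\<phi>. C1_with_gradient \<phi> D\<phi> \<Longrightarrow>
    sqnorm \<sigma> \<phi> \<le> ennreal C * (sqnorm \<mu> \<phi> + sqnorm \<mu> D\<phi>)" using trace_inequality by blast
  have c\<sigma>: "\<exists>N. \<forall>i\<ge>N. \<forall>j\<ge>N. sqnorm \<sigma> (\<lambda>x. \<psi> i x - \<psi> j x) \<le> ennreal e" if e: "e > 0" for e
  proof -
    \<comment> \<open>Ensures \<open>C * (d + d) \<le> e\<close> also when
      \<open>C = 0\<close>.\<close>
    define d where "d = e / (2 * C + 1)"
    have d: "d > 0" using e C(1) by (simp add: d_def)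
    have "(2 * C + 1) * d = e" using C(1) by (simp add: d_def)
    then have dC: "C * (d + d) \<le> e" using d by (simp add: algebra_simps)
    obtain N1 N2 where N1: "\<And>i j. i \<ge> N1 \<Longrightarrow> j \<ge> N1 \<Longrightarrow> sqnorm \<mu> (\<lambda>x. \<psi> i x - \<psi> j x) \<le> ennreal d"
      and N2: "\<And>i j. i \<ge> N2 \<Longrightarrow> j \<ge> N2 \<Longrightarrow> sqnorm \<mu> (\<lambda>x. D\<psi> i x - D\<psi> j x) \<le> ennreal d"
      using L2_tendsto_Cauchy[OF m(1) um(1) l1 d] L2_tendsto_Cauchy[OF m(2) um(2) l2 d] by blast
    have "sqnorm \<sigma> (\<lambda>x. \<psi> i x - \<psi> j x) \<le> ennreal e" if "i \<ge> max N1 N2" "j \<ge> max N1 N2" for i j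
    proof -
      have "C1_with_gradient (\<lambda>x. \<psi> i x - \<psi> j x) (\<lambda>x. D\<psi> i x - D\<psi> j x)"
        using C1_with_gradient_lincomb[OF C1[of i] C1[of j], of 1 "-1"] by simp
      then have "sqnorm \<sigma> (\<lambda>x. \<psi> i x - \<psi> j x)
        \<le> ennreal C * (sqnorm \<mu> (\<lambda>x. \<psi> i x - \<psi> j x) + sqnorm \<mu> (\<lambda>x. D\<psi> i x - D\<psi> j x))" by (rule C(2))
      also have "\<dots> \<le> ennreal C * (ennreal d + ennreal d)"
        using that by (intro mult_left_mono add_mono N1 N2) auto
      also have "ennreal d + ennreal d = ennreal (d + d)"
        by (rule ennreal_plus[symmetric]) (use d in auto)
      also have "ennreal C * \<dots> = ennreal (C * (d + d))" by (rule ennreal_mult'[symmetric, OF C(1)])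
      also have "\<dots> \<le> ennreal e" using dC by (rule ennreal_leI)
      finally show ?thesis .
    qed
    then show ?thesis by (intro exI[of _ "max N1 N2"] allI impI)
  qed
  obtain h where h: "square_integrable \<sigma> h" "L2_tendsto \<sigma> \<psi> h"
    using \<sigma>.L2_complete[OF C1_square_integrable_\<sigma>[OF C1] c\<sigma>] by blast
  have hm: "h \<in> borel_measurable \<sigma>" using h(1) by (simp add: square_integrable_def)
  have tr_u: "has_trace \<Omega> u h"
    unfolding has_trace_def using hm uG C1 l1 l2 h(2) by blast
  have gh: "L2_tendsto \<sigma> g h"
    by (rule L2_tendsto_trans[OF gm m(3) hm _ h(2)])
       (rule tendsto_0_le_ennreal[OF p(4)[folded \<psi>_def, unfolded sqnorm_diff_commute[of \<sigma> "\<psi> k" for k]] tendsto_ennreal_inverse_Suc])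
  \<comment> \<open>All \<open>g k\<close> agree with \<open>w\<close> on \<open>\<Gamma>\<close>
    almost everywhere, so \<open>g 0\<close> may stand for each of them. It also stands for
    \<open>w\<close>, about which no measurability is assumed.\<close>
  define T where "T = (\<integral>\<^sup>+x. ennreal ((norm (g 0 x - h x))\<^sup>2) * indicator \<Gamma> x \<partial>\<sigma>)"
  have "T \<le> sqnorm \<sigma> (\<lambda>x. g k x - h x)" for k
  proof -
    have "T \<le> (\<integral>\<^sup>+x. ennreal ((norm (g k x - h x))\<^sup>2) \<partial>\<sigma>)"
      unfolding T_def using g(2)[of 0] g(2)[of k]
      by (intro nn_integral_mono_AE, eventually_elim) (auto simp: indicator_def)
    then show ?thesis by (simp add: sqnorm_def)
  qed
  then have "T \<le> 0" using gh unfolding L2_tendsto_sqnorm by (intro LIMSEQ_le_const) auto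
  then have "AE x in \<sigma>. ennreal ((norm (g 0 x - h x))\<^sup>2) * indicator \<Gamma> x = 0"
    unfolding T_def using gm[of 0] hm \<Gamma> by (subst (asm) le_zero_eq, subst (asm) nn_integral_0_iff_AE) auto
  then have "AE x in \<sigma>. x \<in> \<Gamma> \<longrightarrow> h x = w x"
    using g(2)[of 0] by eventually_elim auto
  then have "trace_eq_on \<Omega> \<Gamma> u w" using tr_u unfolding trace_eq_on_def by blast
  moreover have "L2_tendsto \<mu> (\<lambda>k. weak_gradient \<Omega> (v k)) (weak_gradient \<Omega> u)"
  proof -
    have "sqnorm \<mu> (\<lambda>x. weak_gradient \<Omega> (v k) x - weak_gradient \<Omega> u x) = sqnorm \<mu> (\<lambda>x. weak_gradient \<Omega> (v k) x - G x)" for k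
      using weak_gradient_AE_eq[OF uG] by (intro sqnorm_cong_AE, eventually_elim) simp
    then show ?thesis using G(2) by (simp add: L2_tendsto_sqnorm)
  qed
  ultimately show ?thesis using uH u(2) by (intro that)
qed

end


section \<open>Minimisation of the quadratic form\<close>

lemma inner_exchange_matrix:
  fixes w z :: "real ^ 2"
  shows "w \<bullet> (exchange_matrix ks *v z) = ks * ((z $ 1 - z $ 2) * (w $ 1 - w $ 2))"
  by (simp add: exchange_matrix_def matrix_vector_mult_def inner_vec_def sum_2 algebra_simps)

lemma interaction_range:
  fixes r :: real
  assumes "0 \<le> r \<and> r \<le> 1"
  shows "0 \<le> r * (1 - r)" "r * (1 - r) \<le> 1"
  using assms mult_mono[of r 1 "1 - r" 1] by auto

lemma integrable_bounded_mult:
  fixes f c :: "'a \<Rightarrow> real"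
  assumes f: "integrable M f" and c: "c \<in> borel_measurable M" "AE x in M. \<bar>c x\<bar> \<le> C"
  shows "integrable M (\<lambda>x. c x * f x)"
proof (rule Bochner_Integration.integrable_bound)
  show "integrable M (\<lambda>x. C * f x)" using f by simp
  show "AE x in M. norm (c x * f x) \<le> norm (C * f x)"
    using c(2) by eventually_elim (auto simp: abs_mult intro!: mult_right_mono)
qed (use f c in simp)

locale variational_problem = lipschitz_domain +
  fixes \<Gamma> :: "2 \<Rightarrow> 'a set" and K :: "real ^ 2 ^ 2" and ks :: real and \<rho> :: "'a \<Rightarrow> real"
  assumes \<Gamma>_pos: "\<And>i. emeasure (surface_measure \<Omega>) (\<Gamma> i) > 0"
    and K_pos: "\<And>i j. K $ i $ j > 0" and ks_pos: "ks > 0" and \<rho>_design: "\<rho> \<in> designs \<Omega>"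
begin

abbreviation H :: "('a \<Rightarrow> real ^ 2) set" where
  "H \<equiv> {v. \<forall>i. (\<lambda>x. v x $ i) \<in> H1 \<Omega>}"

abbreviation B :: "('a \<Rightarrow> real ^ 2) \<Rightarrow> ('a \<Rightarrow> real ^ 2) \<Rightarrow> real" where
  "B u v \<equiv> euler_lagrange_form \<Omega> K ks \<rho> u v"

abbreviation grad :: "('a \<Rightarrow> real ^ 2) \<Rightarrow> 2 \<Rightarrow> 'a \<Rightarrow> 'a" where
  "grad u i \<equiv> weak_gradient \<Omega> (\<lambda>x. u x $ i)"

text \<open>The integrand of the Euler--Lagrange form with the matrix multiplied out, which exhibits
  its symmetry and, on the diagonal, its sign.\<close>

definition energy_density :: "('a \<Rightarrow> real ^ 2) \<Rightarrow> ('a \<Rightarrow> real ^ 2) \<Rightarrow> 'a \<Rightarrow> real" where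
  "energy_density u v x = (\<Sum>i\<in>UNIV. conductivity K \<rho> i x * (grad u i x \<bullet> grad v i x))
     + ks * (\<rho> x * (1 - \<rho> x)) * ((u x $ 1 - u x $ 2) * (v x $ 1 - v x $ 2))"

lemma B_eq_integral: "B u v = (\<integral>x. energy_density u v x \<partial>\<mu>)"
  unfolding euler_lagrange_form_def energy_density_def inner_exchange_matrix
  by (intro Bochner_Integration.integral_cong) (simp_all add: mult_ac)

lemma \<rho>_range: "AE x in \<mu>. 0 \<le> \<rho> x \<and> \<rho> x \<le> 1" and \<rho>_measurable: "\<rho> \<in> borel_measurable \<mu>"
  using \<rho>_design by (auto simp: designs_def square_integrable_def)

text \<open>With \<open>\<Lambda>\<close>, the ellipticity constants: each conductivity is a convex
  combination of two entries of \<open>K\<close>, hence lies between them.\<close>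

definition \<kappa> :: real where "\<kappa> = min (min (K $ 1 $ 1) (K $ 1 $ 2)) (min (K $ 2 $ 1) (K $ 2 $ 2))"
definition \<Lambda> :: real where "\<Lambda> = K $ 1 $ 1 + K $ 1 $ 2 + K $ 2 $ 1 + K $ 2 $ 2"

lemma \<kappa>_pos: "\<kappa> > 0" using K_pos by (simp add: \<kappa>_def)
lemma \<Lambda>_pos: "\<Lambda> > 0" using K_pos by (simp add: \<Lambda>_def add_pos_pos)

lemma K_range: "\<kappa> \<le> K $ i $ j" "K $ i $ j \<le> \<Lambda>"
  using exhaust_2[of i] exhaust_2[of j] K_pos[of 1 1] K_pos[of 1 2] K_pos[of 2 1] K_pos[of 2 2]
  by (auto simp: \<kappa>_def \<Lambda>_def)

lemma conductivity_range:
  assumes "0 \<le> \<rho> x \<and> \<rho> x \<le> 1"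
  shows "\<kappa> \<le> conductivity K \<rho> i x" "conductivity K \<rho> i x \<le> \<Lambda>"
proof -
  have "\<kappa> * \<rho> x + \<kappa> * (1 - \<rho> x) \<le> conductivity K \<rho> i x"
    unfolding conductivity_def using assms by (intro add_mono mult_right_mono K_range) auto
  then show "\<kappa> \<le> conductivity K \<rho> i x" by (simp add: algebra_simps)
  have "conductivity K \<rho> i x \<le> \<Lambda> * \<rho> x + \<Lambda> * (1 - \<rho> x)"
    unfolding conductivity_def using assms by (intro add_mono mult_right_mono K_range) auto
  then show "conductivity K \<rho> i x \<le> \<Lambda>" by (simp add: algebra_simps)
qed

lemma conductivity_measurable: "conductivity K \<rho> i \<in> borel_measurable \<mu>"
  unfolding conductivity_def[abs_def] using \<rho>_measurable by measurable

lemma component_H1D: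
  assumes "u \<in> H"
  shows "(\<lambda>x. u x $ i) \<in> H1 \<Omega>" "square_integrable \<mu> (\<lambda>x. u x $ i)" "square_integrable \<mu> (grad u i)"
proof -
  show u: "(\<lambda>x. u x $ i) \<in> H1 \<Omega>" using assms by simp
  show "square_integrable \<mu> (\<lambda>x. u x $ i)" "square_integrable \<mu> (grad u i)"
    using has_weak_gradientD(1,2)[OF has_weak_gradient_weak_gradient[OF u]] by auto
qed

lemma integrable_energy_density:
  assumes u: "u \<in> H" and v: "v \<in> H"
  shows "integrable \<mu> (energy_density u v)"
  unfolding energy_density_def[abs_def]
proof (intro Bochner_Integration.integrable_add Bochner_Integration.integrable_sum)
  fix i :: 2
  show "integrable \<mu> (\<lambda>x. conductivity K \<rho> i x * (grad u i x \<bullet> grad v i x))"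
  proof (rule integrable_bounded_mult[OF _ conductivity_measurable])
    show "integrable \<mu> (\<lambda>x. grad u i x \<bullet> grad v i x)"
      by (intro integrable_inner_square_integrable component_H1D u v)
    show "AE x in \<mu>. \<bar>conductivity K \<rho> i x\<bar> \<le> \<Lambda>"
      using \<rho>_range
    proof eventually_elim
      case (elim x)
      then show ?case using conductivity_range[OF elim, of i] \<kappa>_pos by simp
    qed
  qed
next
  have d: "square_integrable \<mu> (\<lambda>x. w x $ 1 - w x $ 2)" if "w \<in> H" for w
    by (intro square_integrable_diff component_H1D that)
  show "integrable \<mu> (\<lambda>x. ks * (\<rho> x * (1 - \<rho> x)) * ((u x $ 1 - u x $ 2) * (v x $ 1 - v x $ 2)))"
  proof (rule integrable_bounded_mult)
    show "integrable \<mu> (\<lambda>x. (u x $ 1 - u x $ 2) * (v x $ 1 - v x $ 2))"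
      using integrable_inner_square_integrable[OF d[OF u] d[OF v]] by simp
    show "(\<lambda>x. ks * (\<rho> x * (1 - \<rho> x))) \<in> borel_measurable \<mu>" using \<rho>_measurable by measurable
    show "AE x in \<mu>. \<bar>ks * (\<rho> x * (1 - \<rho> x))\<bar> \<le> ks"
      using \<rho>_range
    proof eventually_elim
      case (elim x)
      then show ?case using interaction_range[OF elim] ks_pos by (simp add: abs_mult)
    qed
  qed
qed

lemma H_lincomb: "u \<in> H \<Longrightarrow> v \<in> H \<Longrightarrow> (\<lambda>x. a *\<^sub>R u x + b *\<^sub>R v x) \<in> H"
  using H1_lincomb by simp

lemma B_commute: "B u v = B v u"
  unfolding B_eq_integral energy_density_def by (simp add: inner_commute mult_ac)

text \<open>Chosen weak gradients are linear only almost everywhere, so the integrands are compared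
  up to null sets.\<close>

lemma B_lincomb_left:
  assumes u: "u \<in> H" and v: "v \<in> H" and w: "w \<in> H"
  shows "B (\<lambda>x. a *\<^sub>R u x + b *\<^sub>R v x) w = a * B u w + b * B v w"
proof -
  have g: "AE x in \<mu>. grad (\<lambda>x. a *\<^sub>R u x + b *\<^sub>R v x) i x = a *\<^sub>R grad u i x + b *\<^sub>R grad v i x" for i
    using weak_gradient_lincomb[of "\<lambda>x. u x $ i" "\<lambda>x. v x $ i" a b] u v by simp
  have "AE x in \<mu>. energy_density (\<lambda>x. a *\<^sub>R u x + b *\<^sub>R v x) w x = a *\<^sub>R energy_density u w x + b *\<^sub>R energy_density v w x"
    using g[of 1] g[of 2] by eventually_elim (simp add: energy_density_def sum_2 inner_add_left algebra_simps)
  then have "B (\<lambda>x. a *\<^sub>R u x + b *\<^sub>R v x) w = (\<integral>x. a *\<^sub>R energy_density u w x + b *\<^sub>R energy_density v w x \<partial>\<mu>)"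
    unfolding B_eq_integral
    using integrable_energy_density[OF H_lincomb[OF u v, of a b] w] integrable_energy_density[OF u w] integrable_energy_density[OF v w]
    by (intro integral_cong_AE) auto
  also have "\<dots> = a *\<^sub>R B u w + b *\<^sub>R B v w"
    unfolding B_eq_integral by (intro integral_lincomb integrable_energy_density u v w)
  finally show ?thesis by simp
qed

lemma B_lincomb_square:
  assumes u: "u \<in> H" and v: "v \<in> H"
  shows "B (\<lambda>x. a *\<^sub>R u x + b *\<^sub>R v x) (\<lambda>x. a *\<^sub>R u x + b *\<^sub>R v x) = a\<^sup>2 * B u u + 2 * a * b * B u v + b\<^sup>2 * B v v"
proof -
  let ?w = "\<lambda>x. a *\<^sub>R u x + b *\<^sub>R v x"
  have "B ?w ?w = a * B ?w u + b * B ?w v"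
    by (simp only: B_lincomb_left[OF u v H_lincomb[OF u v]] B_commute[of _ ?w])
  also have "B ?w u = a * B u u + b * B u v" using B_lincomb_left[OF u v u] B_commute[of v u] by simp
  also have "B ?w v = a * B u v + b * B v v" by (rule B_lincomb_left[OF u v v])
  finally show ?thesis by (simp add: algebra_simps power2_eq_square)
qed

lemma energy_density_nonneg: "AE x in \<mu>. 0 \<le> energy_density u u x"
  using \<rho>_range
proof eventually_elim
  case (elim x)
  have "0 \<le> conductivity K \<rho> i x" for i using conductivity_range(1)[OF elim, of i] \<kappa>_pos by simp
  then have "0 \<le> (\<Sum>i\<in>UNIV. conductivity K \<rho> i x * (grad u i x \<bullet> grad u i x))"
    by (intro sum_nonneg mult_nonneg_nonneg) auto
  then show ?case unfolding energy_density_def using interaction_range[OF elim] ks_pos by simp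
qed

lemma B_nonneg: "0 \<le> B u u"
  unfolding B_eq_integral by (rule integral_nonneg_AE[OF energy_density_nonneg])

text \<open>All terms of the energy density on the diagonal are nonnegative; keeping one gradient
  term and its lower bound \<open>\<kappa>\<close> gives the estimate.\<close>

lemma sqnorm_grad_le: 
  assumes u: "u \<in> H"
  shows "sqnorm \<mu> (grad u i) \<le> ennreal (B u u / \<kappa>)"
proof -
  have "AE x in \<mu>. \<kappa> * (norm (grad u i x))\<^sup>2 \<le> energy_density u u x"
    using \<rho>_range
  proof eventually_elim
    case (elim x)
    note c = conductivity_range(1)[OF elim]
    have c0: "0 \<le> conductivity K \<rho> j x" for j using c[of j] \<kappa>_pos by simp
    have "\<kappa> * (norm (grad u i x))\<^sup>2 \<le> conductivity K \<rho> i x * (grad u i x \<bullet> grad u i x)"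
      unfolding power2_norm_eq_inner by (intro mult_right_mono c) auto
    also have "\<dots> \<le> (\<Sum>j\<in>UNIV. conductivity K \<rho> j x * (grad u j x \<bullet> grad u j x))"
      using c0 by (intro member_le_sum[of i UNIV "\<lambda>j. conductivity K \<rho> j x * (grad u j x \<bullet> grad u j x)"]) auto
    also have "\<dots> \<le> energy_density u u x"
      unfolding energy_density_def using interaction_range[OF elim] ks_pos by simp
    finally show ?case .
  qed
  then have "(\<integral>x. \<kappa> * (norm (grad u i x))\<^sup>2 \<partial>\<mu>) \<le> B u u"
    unfolding B_eq_integral using component_H1D(3)[OF u] integrable_energy_density[OF u u]
    by (intro integral_mono_AE) (auto simp: square_integrable_def)
  then have "(\<integral>x. (norm (grad u i x))\<^sup>2 \<partial>\<mu>) \<le> B u u / \<kappa>"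
    using \<kappa>_pos by (simp add: field_simps)
  then show ?thesis using sqnorm_eq_integral[OF component_H1D(3)[OF u]] by (simp add: ennreal_leI)
qed

text \<open>Continuity of the form, used to make it vanish along the differences to the limit. The
  summand \<open>2 * ks\<close> comes from
  \<open>(a - b)\<^sup>2 \<le> 2 * a\<^sup>2 + 2 * b\<^sup>2\<close> and the bound 1 on the exchange
  coefficient.\<close>

lemma B_le_sqnorm:
  assumes u: "u \<in> H"
  shows "ennreal (B u u) \<le> ennreal (\<Lambda> + 2 * ks) * (\<Sum>i\<in>UNIV. sqnorm \<mu> (grad u i) + sqnorm \<mu> (\<lambda>x. u x $ i))"
proof -
  let ?N = "\<lambda>i x. ennreal ((norm (grad u i x))\<^sup>2) + ennreal ((norm (u x $ i))\<^sup>2)"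
  have [measurable]: "(\<lambda>x. u x $ i) \<in> borel_measurable \<mu>" "grad u i \<in> borel_measurable \<mu>" for i
    using component_H1D(2,3)[OF u] by (auto simp: square_integrable_def)
  have "ennreal (B u u) = (\<integral>\<^sup>+x. ennreal (energy_density u u x) \<partial>\<mu>)"
    unfolding B_eq_integral
    by (rule nn_integral_eq_integral[symmetric, OF integrable_energy_density[OF u u] energy_density_nonneg])
  also have "\<dots> \<le> (\<integral>\<^sup>+x. ennreal (\<Lambda> + 2 * ks) * (\<Sum>i\<in>UNIV. ?N i x) \<partial>\<mu>)"
  proof (rule nn_integral_mono_AE)
    show "AE x in \<mu>. ennreal (energy_density u u x) \<le> ennreal (\<Lambda> + 2 * ks) * (\<Sum>i\<in>UNIV. ?N i x)"
      using \<rho>_range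
    proof eventually_elim
      case (elim x)
      let ?g = "\<lambda>i. (norm (grad u i x))\<^sup>2" let ?u = "\<lambda>i. (norm (u x $ i))\<^sup>2"
      have 1: "conductivity K \<rho> i x * (grad u i x \<bullet> grad u i x) \<le> \<Lambda> * ?g i" for i
        unfolding power2_norm_eq_inner using conductivity_range(2)[OF elim] by (intro mult_right_mono) auto
      have "(u x $ 1 - u x $ 2) * (u x $ 1 - u x $ 2) \<le> 2 * ?u 1 + 2 * ?u 2"
        using zero_le_power2[of "u x $ 1 + u x $ 2"] by (simp add: power2_eq_square algebra_simps)
      then have "(\<rho> x * (1 - \<rho> x)) * ((u x $ 1 - u x $ 2) * (u x $ 1 - u x $ 2)) \<le> 1 * (2 * ?u 1 + 2 * ?u 2)"
        using interaction_range[OF elim] by (intro mult_mono) auto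
      then have 2: "ks * (\<rho> x * (1 - \<rho> x)) * ((u x $ 1 - u x $ 2) * (u x $ 1 - u x $ 2)) \<le> ks * (2 * ?u 1 + 2 * ?u 2)"
        using ks_pos by (simp add: mult.assoc)
      have "energy_density u u x \<le> \<Lambda> * ?g 1 + \<Lambda> * ?g 2 + ks * (2 * ?u 1 + 2 * ?u 2)"
        unfolding energy_density_def sum_2 by (intro add_mono 1 2)
      also have "\<dots> \<le> (\<Lambda> + 2 * ks) * (\<Sum>i\<in>UNIV. ?g i + ?u i)"
        using \<Lambda>_pos ks_pos by (simp add: sum_2 algebra_simps)
      finally have "ennreal (energy_density u u x) \<le> ennreal ((\<Lambda> + 2 * ks) * (\<Sum>i\<in>UNIV. ?g i + ?u i))" by (rule ennreal_leI)
      also have "\<dots> = ennreal (\<Lambda> + 2 * ks) * (\<Sum>i\<in>UNIV. ?N i x)"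
        using \<Lambda>_pos ks_pos by (subst ennreal_mult') (auto simp: sum_2 ennreal_plus)
      finally show ?case .
    qed
  qed
  also have "\<dots> = ennreal (\<Lambda> + 2 * ks) * (\<Sum>i\<in>UNIV. sqnorm \<mu> (grad u i) + sqnorm \<mu> (\<lambda>x. u x $ i))"
    unfolding sqnorm_def by (simp add: nn_integral_cmult nn_integral_sum nn_integral_add sum_2)
  finally show ?thesis .
qed

text \<open>For a fixed design the last term is a constant, so minimising
  \<open>L_functional\<close> means minimising the quadratic form, whatever the sign of
  \<open>lam\<close>.\<close>

lemma L_functional_eq:
  assumes u: "u \<in> H"
  shows "L_functional \<Omega> K ks lam u \<rho> = 1/2 * B u u - lam * (\<integral>x. \<rho> x \<partial>\<mu>)"
proof -
  have "integrable \<mu> \<rho>"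
    using \<rho>_design by (intro \<mu>.square_integrable_imp_integrable) (simp add: designs_def)
  have "L_functional \<Omega> K ks lam u \<rho> = (\<integral>x. 1/2 * energy_density u u x - lam * \<rho> x \<partial>\<mu>)"
    unfolding L_functional_def energy_density_def inner_exchange_matrix
    by (intro Bochner_Integration.integral_cong) (simp_all only: power2_norm_eq_inner distrib_left mult_ac)
  also have "\<dots> = (\<integral>x. 1/2 * energy_density u u x \<partial>\<mu>) - (\<integral>x. lam * \<rho> x \<partial>\<mu>)"
    using \<open>integrable \<mu> \<rho>\<close> integrable_energy_density[OF u u] by (intro Bochner_Integration.integral_diff) auto
  finally show ?thesis by (simp add: B_eq_integral)
qed

lemma admissibleD:
  assumes "v \<in> admissible \<Omega> \<Gamma> w"
  shows "v \<in> H" "trace_eq_on \<Omega> (\<Gamma> i) (\<lambda>x. v x $ i) (w i)"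
  using assms by (auto simp: admissible_def)

lemma admissible_lincomb:
  assumes "u \<in> admissible \<Omega> \<Gamma> g" "v \<in> admissible \<Omega> \<Gamma> h"
  shows "(\<lambda>x. a *\<^sub>R u x + b *\<^sub>R v x) \<in> admissible \<Omega> \<Gamma> (\<lambda>i x. a * g i x + b * h i x)"
  using assms H1_lincomb trace_eq_on_lincomb by (simp add: admissible_def)

text \<open>Only the gradient terms are used. Each component vanishes on its own boundary part of
  positive measure, so the Poincare inequality applies to it separately, also where the species do
  not interact.\<close>

lemma coercive:
  obtains C :: real where "C > 0"
    "\<And>w i. w \<in> admissible \<Omega> \<Gamma> (\<lambda>i x. 0) \<Longrightarrow> sqnorm \<mu> (\<lambda>x. w x $ i) \<le> ennreal (C * B w w)"
    "\<And>w i. w \<in> admissible \<Omega> \<Gamma> (\<lambda>i x. 0) \<Longrightarrow> sqnorm \<mu> (grad w i) \<le> ennreal (C * B w w)"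
proof -
  have "\<forall>i. \<exists>P::real. P \<ge> 0 \<and> (\<forall>w. w \<in> H1 \<Omega> \<longrightarrow> trace_eq_on \<Omega> (\<Gamma> i) w (\<lambda>_. 0) \<longrightarrow>
    sqnorm \<mu> w \<le> ennreal P * sqnorm \<mu> (weak_gradient \<Omega> w))"
  proof
    fix i
    obtain P :: real where "P \<ge> 0" "\<And>w. w \<in> H1 \<Omega> \<Longrightarrow> trace_eq_on \<Omega> (\<Gamma> i) w (\<lambda>_. 0) \<Longrightarrow>
      sqnorm \<mu> w \<le> ennreal P * sqnorm \<mu> (weak_gradient \<Omega> w)" using poincare[OF \<Gamma>_pos[of i]] by metis
    then show "\<exists>P::real. P \<ge> 0 \<and> (\<forall>w. w \<in> H1 \<Omega> \<longrightarrow> trace_eq_on \<Omega> (\<Gamma> i) w (\<lambda>_. 0) \<longrightarrow>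
      sqnorm \<mu> w \<le> ennreal P * sqnorm \<mu> (weak_gradient \<Omega> w))" by blast
  qed
  from choice[OF this] obtain P :: "2 \<Rightarrow> real" where P: "\<And>i. P i \<ge> 0"
    "\<And>i w. w \<in> H1 \<Omega> \<Longrightarrow> trace_eq_on \<Omega> (\<Gamma> i) w (\<lambda>_. 0) \<Longrightarrow> sqnorm \<mu> w \<le> ennreal (P i) * sqnorm \<mu> (weak_gradient \<Omega> w)"
    by blast
  \<comment> \<open>Dominates \<open>P i / \<kappa>\<close> for the values and
    \<open>1 / \<kappa>\<close> for the gradients.\<close>
  define C where "C = (1 + P 1 + P 2) / \<kappa>"
  have C: "C > 0" using P(1)[of 1] P(1)[of 2] \<kappa>_pos by (simp add: C_def)
  have PC: "P i / \<kappa> \<le> C" "1 / \<kappa> \<le> C" for i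
    using exhaust_2[of i] P(1)[of 1] P(1)[of 2] \<kappa>_pos by (auto simp: C_def intro!: divide_right_mono)
  show ?thesis
  proof (rule that[OF C])
    fix w i assume w: "w \<in> admissible \<Omega> \<Gamma> (\<lambda>i x. 0)"
    note wH = admissibleD(1)[OF w]
    have g: "sqnorm \<mu> (grad w i) \<le> ennreal (B w w / \<kappa>)" by (rule sqnorm_grad_le[OF wH])
    have "sqnorm \<mu> (\<lambda>x. w x $ i) \<le> ennreal (P i) * sqnorm \<mu> (grad w i)"
      using P(2)[OF component_H1D(1)[OF wH] admissibleD(2)[OF w]] .
    also have "\<dots> \<le> ennreal (P i) * ennreal (B w w / \<kappa>)" by (intro mult_left_mono g) simp
    also have "\<dots> = ennreal (P i / \<kappa> * B w w)" using P(1) by (simp add: ennreal_mult'[symmetric])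
    also have "\<dots> \<le> ennreal (C * B w w)" by (intro ennreal_leI mult_right_mono PC B_nonneg)
    finally show "sqnorm \<mu> (\<lambda>x. w x $ i) \<le> ennreal (C * B w w)" .
    have "ennreal (1 / \<kappa> * B w w) \<le> ennreal (C * B w w)" by (intro ennreal_leI mult_right_mono PC B_nonneg)
    then show "sqnorm \<mu> (grad w i) \<le> ennreal (C * B w w)" using g by simp
  qed
qed

section \<open>Stationarity, uniqueness and existence of minimisers\<close>

text \<open>No derivative is taken: if the form at \<open>\<phi>\<close> were nonzero, one explicit
  step from \<open>u\<close> along \<open>\<phi>\<close> would lower the energy.\<close>

lemma euler_lagrange:
  assumes u: "u \<in> admissible \<Omega> \<Gamma> g" and min: "\<And>v. v \<in> admissible \<Omega> \<Gamma> g \<Longrightarrow> B u u \<le> B v v"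
    and \<phi>: "\<phi> \<in> admissible \<Omega> \<Gamma> (\<lambda>i x. 0)"
  shows "B u \<phi> = 0"
proof (rule ccontr)
  assume ne: "B u \<phi> \<noteq> 0"
  note uH = admissibleD(1)[OF u] and \<phi>H = admissibleD(1)[OF \<phi>]
  let ?b = "B u \<phi>" let ?c = "B \<phi> \<phi> + 1"
  have c: "?c > 0" using B_nonneg[of \<phi>] by simp
  \<comment> \<open>The minimiser of \<open>2 * s * ?b + s\<^sup>2 * ?c\<close>, with value
    \<open>- ?b\<^sup>2 / ?c\<close>. The 1 in \<open>?c\<close> avoids division by 0.\<close>
  define s where "s = - ?b / ?c"
  have "(\<lambda>x. 1 *\<^sub>R u x + s *\<^sub>R \<phi> x) \<in> admissible \<Omega> \<Gamma> g"
    using admissible_lincomb[OF u \<phi>, of 1 s] by simp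
  from min[OF this] have "0 \<le> 2 * s * ?b + s\<^sup>2 * B \<phi> \<phi>"
    unfolding B_lincomb_square[OF uH \<phi>H] by simp
  also have "\<dots> = (2 * s * ?b + s\<^sup>2 * ?c) - s\<^sup>2" by (simp add: algebra_simps)
  also have "2 * s * ?b + s\<^sup>2 * ?c = - (?b\<^sup>2 / ?c)"
    using c by (simp add: s_def power2_eq_square)
  finally have "?b\<^sup>2 / ?c + s\<^sup>2 \<le> 0" by simp
  moreover have "?b\<^sup>2 / ?c > 0" using ne c by simp
  ultimately show False by (smt (verit) zero_le_power2)
qed

text \<open>The difference of two minimisers is an admissible test function for both Euler--Lagrange
  equations; subtracting them shows that its energy is 0, and coercivity applies.\<close>

lemma minimizer_unique:
  assumes u: "u \<in> admissible \<Omega> \<Gamma> g" "\<And>w. w \<in> admissible \<Omega> \<Gamma> g \<Longrightarrow> B u u \<le> B w w"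
    and v: "v \<in> admissible \<Omega> \<Gamma> g" "\<And>w. w \<in> admissible \<Omega> \<Gamma> g \<Longrightarrow> B v v \<le> B w w"
  shows "AE x in \<mu>. u x = v x"
proof -
  define w where "w x = 1 *\<^sub>R u x + (-1) *\<^sub>R v x" for x
  have w: "w \<in> admissible \<Omega> \<Gamma> (\<lambda>i x. 0)"
    unfolding w_def using admissible_lincomb[OF u(1) v(1), of 1 "-1"] by simp
  have "B w w = 1 * B u w + (-1) * B v w"
    using B_lincomb_left[OF admissibleD(1)[OF u(1)] admissibleD(1)[OF v(1)] admissibleD(1)[OF w], of 1 "-1"]
    by (simp only: w_def[abs_def])
  then have "B w w = 0" using euler_lagrange[OF u w] euler_lagrange[OF v w] by simp
  then have z: "sqnorm \<mu> (\<lambda>x. w x $ i) = 0" for i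
    using coercive w by (metis ennreal_0 le_zero_eq mult_zero_right)
  have "AE x in \<mu>. w x $ i = 0" for i
  proof -
    have "(\<lambda>x. w x $ i) \<in> borel_measurable \<mu>"
      using component_H1D(2)[OF admissibleD(1)[OF w]] by (simp add: square_integrable_def)
    then show ?thesis using z[of i] unfolding sqnorm_def by (subst (asm) nn_integral_0_iff_AE) auto
  qed
  from this[of 1] this[of 2] show ?thesis
    by eventually_elim (simp add: w_def vec_eq_iff forall_2)
qed

lemma minimizer_exists:
  assumes ne: "admissible \<Omega> \<Gamma> g \<noteq> {}"
  shows "\<exists>u\<in>admissible \<Omega> \<Gamma> g. \<forall>v\<in>admissible \<Omega> \<Gamma> g. B u u \<le> B v v"
proof -
  let ?A = "admissible \<Omega> \<Gamma> g"
  let ?q = "\<lambda>v. B v v"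
  define m where "m = Inf (?q ` ?A)"
  have bdd: "bdd_below (?q ` ?A)" by (rule bdd_belowI[of _ 0]) (auto intro: B_nonneg)
  have m_le: "m \<le> ?q v" if "v \<in> ?A" for v unfolding m_def using bdd that by (intro cInf_lower) auto
  have m0: "m \<ge> 0" unfolding m_def using ne by (intro cInf_greatest) (auto intro: B_nonneg)
  have "\<forall>k. \<exists>v. v \<in> ?A \<and> ?q v < m + 1 / real (Suc k)"
  proof
    fix k
    have "Inf (?q ` ?A) < m + 1 / real (Suc k)" by (simp add: m_def)
    then show "\<exists>v. v \<in> ?A \<and> ?q v < m + 1 / real (Suc k)" using ne bdd by (subst (asm) cInf_less_iff) auto
  qed
  from choice[OF this] obtain v where v: "\<And>k. v k \<in> ?A" "\<And>k. ?q (v k) < m + 1 / real (Suc k)" by blast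
  note vH = admissibleD(1)[OF v(1)]
  obtain C :: real where C: "C > 0"
    "\<And>w i. w \<in> admissible \<Omega> \<Gamma> (\<lambda>i x. 0) \<Longrightarrow> sqnorm \<mu> (\<lambda>x. w x $ i) \<le> ennreal (C * ?q w)"
    "\<And>w i. w \<in> admissible \<Omega> \<Gamma> (\<lambda>i x. 0) \<Longrightarrow> sqnorm \<mu> (grad w i) \<le> ennreal (C * ?q w)"
    using coercive by blast
  have cauchy: "\<exists>N. \<forall>k\<ge>N. \<forall>l\<ge>N. sqnorm \<mu> (\<lambda>x. v k x $ i - v l x $ i) \<le> ennreal e \<and>
    sqnorm \<mu> (\<lambda>x. grad (v k) i x - grad (v l) i x) \<le> ennreal e" if e: "e > 0" for e :: real and i
  proof -
    have "e / (4 * C) > 0" using e C(1) by simp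
    \<comment> \<open>The energy of a difference will be at most \<open>4 / (N + 1)\<close>, and
      coercivity multiplies it by \<open>C\<close>.\<close>
    then obtain N :: nat where N: "1 / real (Suc N) < e / (4 * C)" using nat_approx_posE by blast
    have "sqnorm \<mu> (\<lambda>x. v k x $ i - v l x $ i) \<le> ennreal e \<and>
      sqnorm \<mu> (\<lambda>x. grad (v k) i x - grad (v l) i x) \<le> ennreal e" if kl: "k \<ge> N" "l \<ge> N" for k l
    proof -
      define w where "w x = 1 *\<^sub>R v k x + (-1) *\<^sub>R v l x" for x
      have w: "w \<in> admissible \<Omega> \<Gamma> (\<lambda>i x. 0)"
        unfolding w_def using admissible_lincomb[OF v(1)[of k] v(1)[of l], of 1 "-1"] by simp
      \<comment> \<open>The midpoint is admissible, so its energy is at least \<open>m\<close>.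
        Expanding it and the energy of the difference gives the parallelogram identity, in which the
        mixed term cancels.\<close>
      have "(\<lambda>x. (1/2) *\<^sub>R v k x + (1/2) *\<^sub>R v l x) \<in> ?A"
        using admissible_lincomb[OF v(1)[of k] v(1)[of l], of "1/2" "1/2"] by (simp add: field_sum_of_halves)
      from m_le[OF this] have mid: "m \<le> (1/2)\<^sup>2 * ?q (v k) + 2 * (1/2) * (1/2) * B (v k) (v l) + (1/2)\<^sup>2 * ?q (v l)"
        unfolding B_lincomb_square[OF vH vH] .
      have "?q w = 1\<^sup>2 * ?q (v k) + 2 * 1 * (-1) * B (v k) (v l) + (-1)\<^sup>2 * ?q (v l)"
        using B_lincomb_square[OF vH[of k] vH[of l], of 1 "-1"] by (simp only: w_def[abs_def])
      also have "\<dots> \<le> 2 * ?q (v k) + 2 * ?q (v l) - 4 * m"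
        using mid by (simp add: power2_eq_square algebra_simps)
      also have "\<dots> \<le> 2 * (1 / real (Suc k)) + 2 * (1 / real (Suc l))"
        using v(2)[of k] v(2)[of l] by simp
      also have "\<dots> \<le> 2 * (1 / real (Suc N)) + 2 * (1 / real (Suc N))"
        using kl by (intro add_mono mult_left_mono divide_left_mono) auto
      also have "\<dots> = 4 * (1 / real (Suc N))" by simp
      also have "\<dots> \<le> 4 * (e / (4 * C))" using N by (intro mult_left_mono) auto
      also have "\<dots> = e / C" by simp
      finally have "C * ?q w \<le> e" using C(1) by (simp add: field_simps)
      then have le: "ennreal (C * ?q w) \<le> ennreal e" by (rule ennreal_leI)
      have "sqnorm \<mu> (\<lambda>x. v k x $ i - v l x $ i) = sqnorm \<mu> (\<lambda>x. w x $ i)" by (simp add: w_def)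
      moreover have "sqnorm \<mu> (\<lambda>x. grad (v k) i x - grad (v l) i x) = sqnorm \<mu> (grad w i)"
      proof (rule sqnorm_cong_AE)
        show "AE x in \<mu>. grad (v k) i x - grad (v l) i x = grad w i x"
          using weak_gradient_lincomb[OF component_H1D(1)[OF vH[of k], of i] component_H1D(1)[OF vH[of l], of i], of 1 "-1"]
          by eventually_elim (simp add: w_def)
      qed
      ultimately show ?thesis using C(2)[OF w, of i] C(3)[OF w, of i] le by (simp add: order_trans)
    qed
    then show ?thesis by (intro exI[of _ N] allI impI)
  qed
  have "\<forall>i. \<exists>u. u \<in> H1 \<Omega> \<and> trace_eq_on \<Omega> (\<Gamma> i) u (g i) \<and> L2_tendsto \<mu> (\<lambda>k x. v k x $ i) u \<and>
    L2_tendsto \<mu> (\<lambda>k. grad (v k) i) (weak_gradient \<Omega> u)"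
  proof
    fix i
    have \<Gamma>s: "\<Gamma> i \<in> sets \<sigma>" using \<Gamma>_pos[of i] emeasure_notin_sets by force
    have c: "\<exists>N. \<forall>k\<ge>N. \<forall>l\<ge>N. sqnorm \<mu> (\<lambda>x. v k x $ i - v l x $ i) \<le> ennreal e"
      "\<exists>N. \<forall>k\<ge>N. \<forall>l\<ge>N. sqnorm \<mu> (\<lambda>x. grad (v k) i x - grad (v l) i x) \<le> ennreal e"
      if "e > 0" for e :: real
      using cauchy[OF that, of i] by blast+
    from H1_trace_complete[OF component_H1D(1)[OF vH] admissibleD(2)[OF v(1)] \<Gamma>s c]
    obtain u where "u \<in> H1 \<Omega>" "trace_eq_on \<Omega> (\<Gamma> i) u (g i)" "L2_tendsto \<mu> (\<lambda>k x. v k x $ i) u"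
      "L2_tendsto \<mu> (\<lambda>k. grad (v k) i) (weak_gradient \<Omega> u)" .
    then show "\<exists>u. u \<in> H1 \<Omega> \<and> trace_eq_on \<Omega> (\<Gamma> i) u (g i) \<and> L2_tendsto \<mu> (\<lambda>k x. v k x $ i) u \<and>
      L2_tendsto \<mu> (\<lambda>k. grad (v k) i) (weak_gradient \<Omega> u)" by blast
  qed
  from choice[OF this] obtain u' where u': "\<And>i. u' i \<in> H1 \<Omega>" "\<And>i. trace_eq_on \<Omega> (\<Gamma> i) (u' i) (g i)"
    "\<And>i. L2_tendsto \<mu> (\<lambda>k x. v k x $ i) (u' i)" "\<And>i. L2_tendsto \<mu> (\<lambda>k. grad (v k) i) (weak_gradient \<Omega> (u' i))"
    by blast
  define u :: "'a \<Rightarrow> real ^ 2" where "u x = (\<chi> i. u' i x)" for x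
  have ui: "(\<lambda>x. u x $ i) = u' i" for i by (simp add: u_def)
  have u: "u \<in> ?A" unfolding admissible_def using u'(1,2) by (simp add: ui)
  note uH = admissibleD(1)[OF u]
  define z where "z k = (\<lambda>x. 1 *\<^sub>R u x + (-1) *\<^sub>R v k x)" for k
  have zH: "z k \<in> H" for k unfolding z_def by (rule H_lincomb[OF uH vH])
  have qz: "(\<lambda>k. ?q (z k)) \<longlonglongrightarrow> 0"
  proof -
    have s1: "sqnorm \<mu> (\<lambda>x. z k x $ i) = sqnorm \<mu> (\<lambda>x. v k x $ i - u' i x)" for k i
      by (simp add: z_def sqnorm_diff_commute[of \<mu> "\<lambda>x. v k x $ i"] u_def)
    have s2: "sqnorm \<mu> (grad (z k) i) = sqnorm \<mu> (\<lambda>x. grad (v k) i x - weak_gradient \<Omega> (u' i) x)" for k i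
    proof -
      have "AE x in \<mu>. grad (z k) i x = weak_gradient \<Omega> (u' i) x - grad (v k) i x"
        using weak_gradient_lincomb[OF component_H1D(1)[OF uH, of i] component_H1D(1)[OF vH[of k], of i], of 1 "-1"]
        by eventually_elim (simp add: z_def ui)
      then have "sqnorm \<mu> (grad (z k) i) = sqnorm \<mu> (\<lambda>x. weak_gradient \<Omega> (u' i) x - grad (v k) i x)"
        by (rule sqnorm_cong_AE)
      then show ?thesis by (simp only: sqnorm_diff_commute)
    qed
    have "(\<lambda>k. ennreal (\<Lambda> + 2 * ks) * (\<Sum>i\<in>UNIV. sqnorm \<mu> (grad (z k) i) + sqnorm \<mu> (\<lambda>x. z k x $ i)))
      \<longlonglongrightarrow> ennreal (\<Lambda> + 2 * ks) * (\<Sum>i\<in>(UNIV :: 2 set). 0 + 0)"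
      using u'(3,4) unfolding s1 s2 L2_tendsto_sqnorm
      by (intro ennreal_tendsto_cmult tendsto_sum tendsto_add) auto
    then have "(\<lambda>k. ennreal (?q (z k))) \<longlonglongrightarrow> 0"
      by (intro tendsto_0_le_ennreal[OF B_le_sqnorm[OF zH]]) simp
    then have "(\<lambda>k. ennreal (?q (z k))) \<longlonglongrightarrow> ennreal 0" by simp
    then show ?thesis by (subst (asm) tendsto_ennreal_iff) (simp_all add: B_nonneg)
  qed
  have qv: "(\<lambda>k. ?q (v k)) \<longlonglongrightarrow> m"
  proof (rule tendsto_sandwich)
    show "(\<lambda>k. m) \<longlonglongrightarrow> m" by simp
    have "(\<lambda>k. m + 1 / real (Suc k)) \<longlonglongrightarrow> m + 0" by (intro tendsto_intros LIMSEQ_Suc lim_1_over_n)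
    then show "(\<lambda>k. m + 1 / real (Suc k)) \<longlonglongrightarrow> m" by simp
    show "\<forall>\<^sub>F k in sequentially. m \<le> ?q (v k)" using m_le[OF v(1)] by simp
    show "\<forall>\<^sub>F k in sequentially. ?q (v k) \<le> m + 1 / real (Suc k)" using v(2) by (simp add: less_imp_le)
  qed
  \<comment> \<open>The mixed term is estimated with a weight \<open>t\<close> instead of by
    Cauchy-Schwarz, which avoids square roots; the error term tends to 0 for each fixed
    \<open>t\<close>.\<close>
  have est: "?q u \<le> (1 + t) * m" if t: "t > 0" for t
  proof -
    have "?q u \<le> (1 + t) * ?q (v k) + (1 + 1 / t) * ?q (z k)" for k
    proof -
      have uz: "u = (\<lambda>x. 1 *\<^sub>R v k x + 1 *\<^sub>R z k x)" by (simp add: z_def)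
      have "?q u = ?q (v k) + 2 * B (v k) (z k) + ?q (z k)"
        using B_lincomb_square[OF vH[of k] zH[of k], of 1 1] uz by simp
      moreover have "0 \<le> t\<^sup>2 * ?q (v k) + 2 * t * (-1) * B (v k) (z k) + (-1)\<^sup>2 * ?q (z k)"
        using B_nonneg[of "\<lambda>x. t *\<^sub>R v k x + (-1) *\<^sub>R z k x"] unfolding B_lincomb_square[OF vH zH] .
      then have "2 * B (v k) (z k) \<le> t * ?q (v k) + ?q (z k) / t"
        using t by (simp add: field_simps power2_eq_square)
      ultimately show ?thesis by (simp add: distrib_right)
    qed
    moreover have "(\<lambda>k. (1 + t) * ?q (v k) + (1 + 1 / t) * ?q (z k)) \<longlonglongrightarrow> (1 + t) * m + (1 + 1 / t) * 0"
      by (intro tendsto_intros qv qz)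
    ultimately show ?thesis by (intro LIMSEQ_le_const[of _ "(1 + t) * m"]) auto
  qed
  \<comment> \<open>Lets \<open>t\<close> tend to 0 through \<open>t = e / (m + 1)\<close>, for
    which \<open>t * m \<le> e\<close>, including the case \<open>m = 0\<close>.\<close>
  have "?q u \<le> m"
  proof (rule field_le_epsilon)
    fix e :: real assume e: "e > 0"
    have "?q u \<le> (1 + e / (m + 1)) * m" using e m0 by (intro est) simp
    also have "\<dots> \<le> m + e" using e m0 by (simp add: field_simps)
    finally show "?q u \<le> m + e" .
  qed
  then show ?thesis using u m_le by (meson order_trans)
qed

end

text \<open>Requiring that the data \<open>ustar\<close> extend to \<open>H1 \<Omega>\<close> makes
  the admissible class nonempty. Minimisers are functions rather than equivalence classes, so
  uniqueness is up to null sets.\<close>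

theorem theorem2p1:
  fixes \<Omega> :: "'a::euclidean_space set"
    and \<Gamma> :: "2 \<Rightarrow> 'a set" and \<Gamma>ins :: "'a set"
    and ustar :: "2 \<Rightarrow> 'a \<Rightarrow> real"
    and K :: "real ^ 2 ^ 2" and ks lam :: real
    and \<rho> :: "'a \<Rightarrow> real"
  assumes "bounded \<Omega>" and "connected \<Omega>" and "open \<Omega>" and "lipschitz_boundary \<Omega>"
    and "frontier \<Omega> = \<Gamma> 1 \<union> \<Gamma> 2 \<union> \<Gamma>ins"
    and "\<forall>i. emeasure (surface_measure \<Omega>) (\<Gamma> i) > 0"
    and "\<forall>i. \<exists>w\<in>H1 \<Omega>. trace_eq_on \<Omega> (\<Gamma> i) w (ustar i)"
    and "K $ 1 $ 2 > 0" and "K $ 2 $ 1 > 0"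
    and "K $ 1 $ 1 > K $ 1 $ 2" and "K $ 1 $ 1 > K $ 2 $ 1"
    and "K $ 2 $ 2 > K $ 1 $ 2" and "K $ 2 $ 2 > K $ 2 $ 1"
    and "ks > 0"
    and "\<rho> \<in> designs \<Omega>"
  shows "(\<exists>u. is_arg_min (\<lambda>v. L_functional \<Omega> K ks lam v \<rho>) (\<lambda>v. v \<in> admissible \<Omega> \<Gamma> ustar) u) \<and>
    (\<forall>u v. is_arg_min (\<lambda>v. L_functional \<Omega> K ks lam v \<rho>) (\<lambda>v. v \<in> admissible \<Omega> \<Gamma> ustar) u \<and>
           is_arg_min (\<lambda>v. L_functional \<Omega> K ks lam v \<rho>) (\<lambda>v. v \<in> admissible \<Omega> \<Gamma> ustar) v \<longrightarrow>
           (AE x in lebesgue_on \<Omega>. u x = v x)) \<and>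
    (\<forall>u. is_arg_min (\<lambda>v. L_functional \<Omega> K ks lam v \<rho>) (\<lambda>v. v \<in> admissible \<Omega> \<Gamma> ustar) u \<longrightarrow>
         (\<forall>\<phi>\<in>admissible \<Omega> \<Gamma> (\<lambda>i x. 0). euler_lagrange_form \<Omega> K ks \<rho> u \<phi> = 0))"
proof -
  \<comment> \<open>The frontier of the empty set is empty and cannot carry a boundary part of
    positive measure.\<close>
  have ne: "\<Omega> \<noteq> {}"
  proof
    assume "\<Omega> = {}"
    then have "space (surface_measure \<Omega>) = {}" by (simp add: surface_measure_def space_restrict_space)
    then show False using assms(6) by (metis emeasure_empty emeasure_notin_sets not_gr_zero sets.sets_into_space subset_empty)
  qed
  \<comment> \<open>The diagonal entries are positive because they exceed positive off-diagonal
    ones.\<close>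
  have Kp: "K $ i $ j > 0" for i j
    using exhaust_2[of i] exhaust_2[of j] assms(8-13) by auto
  interpret variational_problem \<Omega> \<Gamma> K ks \<rho>
    by unfold_locales (use assms ne Kp in auto)
  let ?A = "admissible \<Omega> \<Gamma> ustar"
  have arg_min: "is_arg_min (\<lambda>v. L_functional \<Omega> K ks lam v \<rho>) (\<lambda>v. v \<in> ?A) u \<longleftrightarrow>
    u \<in> ?A \<and> (\<forall>v\<in>?A. B u u \<le> B v v)" for u
  proof -
    have "L_functional \<Omega> K ks lam u \<rho> \<le> L_functional \<Omega> K ks lam v \<rho> \<longleftrightarrow> B u u \<le> B v v"
      if "u \<in> ?A" "v \<in> ?A" for u v
      using L_functional_eq[OF admissibleD(1)[OF that(1)], of lam] L_functional_eq[OF admissibleD(1)[OF that(2)], of lam]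
      by simp
    then show ?thesis unfolding is_arg_min_def by (auto simp: not_less)
  qed
  obtain w where w: "\<And>i. w i \<in> H1 \<Omega>" "\<And>i. trace_eq_on \<Omega> (\<Gamma> i) (w i) (ustar i)"
    using assms(7) by metis
  \<comment> \<open>The constraints act on each component separately, so scalar extensions of the
    data combine into an admissible pair.\<close>
  have "(\<lambda>x. \<chi> i. w i x) \<in> ?A" using w by (simp add: admissible_def)
  then have "?A \<noteq> {}" by blast
  note exists = minimizer_exists[OF this]
  show ?thesis
    unfolding arg_min
  proof (intro conjI allI impI ballI)
    show "\<exists>u. u \<in> ?A \<and> (\<forall>v\<in>?A. B u u \<le> B v v)" using exists by (simp add: Bex_def)
  next
    fix u v assume uv: "(u \<in> ?A \<and> (\<forall>w\<in>?A. B u u \<le> B w w)) \<and> v \<in> ?A \<and> (\<forall>w\<in>?A. B v v \<le> B w w)"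
    show "AE x in lebesgue_on \<Omega>. u x = v x"
      by (rule minimizer_unique[of u ustar v]) (use uv in auto)
  next
    fix u \<phi> assume u: "u \<in> ?A \<and> (\<forall>w\<in>?A. B u u \<le> B w w)" and \<phi>: "\<phi> \<in> admissible \<Omega> \<Gamma> (\<lambda>i x. 0)"
    show "B u \<phi> = 0" by (rule euler_lagrange[of u ustar, OF _ _ \<phi>]) (use u in auto)
  qed
qed


end
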